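(* There is a one-to-one correspondence between the solutions $(a_n(t))_{n\ge0}$, $t\in[0,T)$, of the semi-infinite Volterra lattice having a finite logarithmic Hamiltonian for each $t\in[0,T)$, and the families of even probability measures $d\rho(\lambda,t)$, $t\in[0,T)$, evolving according to $$d\rho(\lambda,t)=\frac{e^{\lambda^2t}\,d\rho(\lambda,0)}{\int_{-\infty}^{\infty}e^{\lambda^2t}\,d\rho(\lambda,0)},$$ having essential support $[-2,2]$ and an at most countable number of mass points outside $[-2,2]$, with accumulation points only in $\{-2,2\}$, and such that for the moments $s_k=s_k(t)=\int_{-\infty}^{\infty}\lambda^k\,d\rho(\lambda,t)$, $k\in\mathbb{Z}_+$ (those with odd index vanish), the following condition holds for each $t\in[0,T)$: $$0<\lim_{n\to\infty}\frac{\Delta_{n+1}}{\Delta_n}<\infty,\qquad \Delta_n=\det(s_{i+j})_{i,j=0}^{n}.$$ Each such lattice has the Lax operator $\mathcal{L}(t)$ whose spectral measure $d\rho(\lambda,t)$ possesses these properties. Conversely, taking such measures $d\rho(\lambda,t)$ and setting $$a_n(t)=\frac{\Delta_{n+1}\Delta_{n-1}}{\Delta_n^2},\quad n\in\mathbb{Z}_+,\qquad \Delta_{-1}=1,$$ one obtains a solution of the semi-infinite Volterra lattice having a finite logarithmic Hamiltonian.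
   Context: $\mathbb{Z}_+=\{0,1,2,\dots\}$, $0<T\le\infty$. The semi-infinite Volterra lattice is the system $\dot a_n=a_n(a_{n+1}-a_{n-1})$, $n\in\mathbb{Z}_+$, $a_{-1}=0$, with $a_n=a_n(t)>0$, $t\in[0,T)$; it is assumed throughout that $\sup_na_n(t)<\infty$. Its logarithmic Hamiltonian is $H_0=\frac12\sum_{n=0}^{\infty}\ln a_n$; "finite" means that the series converges to a finite number. The Lax operator $\mathcal{L}(t)$ is the bounded selfadjoint operator on $\ell^2(\mathbb{Z}_+)$ generated by the Jacobi matrix with zero main diagonal and off-diagonal entries $L_{n,n+1}=L_{n+1,n}=\sqrt{a_n(t)}$, $n\ge0$. Its spectral measure is $d\rho(\lambda,t)=d(E_\lambda(t)e_0,e_0)$, where $E_\lambda(t)$ is the resolution of the identity of $\mathcal{L}(t)$ and $e_0$ is the first standard basis vector. The essential support of a measure is its topological support with isolated points removed (equivalently, the essential spectrum of the corresponding Jacobi operator). *)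

theory Defs
  imports "HOL-Probability.Probability" "Jordan_Normal_Form.Determinant"
begin

section \<open>The complex sequence space and its bounded operators\<close>

text \<open>
  Operators are total functions on all complex sequences; only their values on \<open>ell2\<close> matter.
\<close>

definition ell2 :: "(nat \<Rightarrow> complex) set" where
  "ell2 = {x. summable (\<lambda>n. (cmod (x n))\<^sup>2)}"

definition ell2_inner :: "(nat \<Rightarrow> complex) \<Rightarrow> (nat \<Rightarrow> complex) \<Rightarrow> complex" where
  "ell2_inner x y = (\<Sum>n. x n * cnj (y n))"

definition ell2_norm :: "(nat \<Rightarrow> complex) \<Rightarrow> real" where
  "ell2_norm x = sqrt (\<Sum>n. (cmod (x n))\<^sup>2)"

definition ell2_unit :: "nat \<Rightarrow> nat \<Rightarrow> complex" where
  "ell2_unit k = (\<lambda>n. if n = k then 1 else 0)"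

definition ell2_bounded_operator :: "((nat \<Rightarrow> complex) \<Rightarrow> (nat \<Rightarrow> complex)) \<Rightarrow> bool" where
  "ell2_bounded_operator A \<longleftrightarrow>
     (\<forall>x\<in>ell2. A x \<in> ell2) \<and>
     (\<forall>x\<in>ell2. \<forall>y\<in>ell2. A (\<lambda>n. x n + y n) = (\<lambda>n. A x n + A y n)) \<and>
     (\<forall>x\<in>ell2. \<forall>c. A (\<lambda>n. c * x n) = (\<lambda>n. c * A x n)) \<and>
     (\<exists>C. \<forall>x\<in>ell2. ell2_norm (A x) \<le> C * ell2_norm x)"

definition ell2_bounded_selfadjoint :: "((nat \<Rightarrow> complex) \<Rightarrow> (nat \<Rightarrow> complex)) \<Rightarrow> bool" where
  "ell2_bounded_selfadjoint A \<longleftrightarrow>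
     ell2_bounded_operator A \<and>
     (\<forall>x\<in>ell2. \<forall>y\<in>ell2. ell2_inner (A x) y = ell2_inner x (A y))"

definition ell2_orthogonal_projection :: "((nat \<Rightarrow> complex) \<Rightarrow> (nat \<Rightarrow> complex)) \<Rightarrow> bool" where
  "ell2_orthogonal_projection P \<longleftrightarrow>
     ell2_bounded_selfadjoint P \<and> (\<forall>x\<in>ell2. P (P x) = P x)"

section \<open>Resolutions of the identity and spectral measures\<close>

text \<open>Resolutions of the identity are normalized to be right-continuous.\<close>

definition resolution_of_identity :: "(real \<Rightarrow> (nat \<Rightarrow> complex) \<Rightarrow> (nat \<Rightarrow> complex)) \<Rightarrow> bool" where
  "resolution_of_identity E \<longleftrightarrow>
     (\<forall>l. ell2_orthogonal_projection (E l)) \<and>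
     (\<forall>l m. \<forall>x\<in>ell2. E l (E m x) = E (min l m) x) \<and>
     (\<forall>x\<in>ell2. \<forall>m. ((\<lambda>l. ell2_norm (\<lambda>n. E l x n - E m x n)) \<longlongrightarrow> 0) (at_right m)) \<and>
     (\<forall>x\<in>ell2. ((\<lambda>l. ell2_norm (E l x)) \<longlongrightarrow> 0) at_bot) \<and>
     (\<forall>x\<in>ell2. ((\<lambda>l. ell2_norm (\<lambda>n. E l x n - x n)) \<longlongrightarrow> 0) at_top)"

text \<open>The Borel measure $d(E_\lambda v, v)$.\<close>

definition stieltjes_measure ::
    "(real \<Rightarrow> (nat \<Rightarrow> complex) \<Rightarrow> (nat \<Rightarrow> complex)) \<Rightarrow> (nat \<Rightarrow> complex) \<Rightarrow> real measure" where
  "stieltjes_measure E v = interval_measure (\<lambda>l. Re (ell2_inner (E l v) v))"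

text \<open>
  $E$ is the resolution of the identity of $A$, i.e. $A = \int \lambda\, dE_\lambda$. The integral
  is taken in the weak sense; over the complex scalars the quadratic form of $A$ determines $A$.
\<close>

definition resolution_of_identity_of ::
    "((nat \<Rightarrow> complex) \<Rightarrow> (nat \<Rightarrow> complex)) \<Rightarrow> (real \<Rightarrow> (nat \<Rightarrow> complex) \<Rightarrow> (nat \<Rightarrow> complex)) \<Rightarrow> bool" where
  "resolution_of_identity_of A E \<longleftrightarrow>
     resolution_of_identity E \<and>
     (\<forall>x\<in>ell2. integrable (stieltjes_measure E x) (\<lambda>l. l) \<and>
        ell2_inner (A x) x = complex_of_real (\<integral>l. l \<partial>stieltjes_measure E x))"

definition has_spectral_measure ::
    "((nat \<Rightarrow> complex) \<Rightarrow> (nat \<Rightarrow> complex)) \<Rightarrow> (nat \<Rightarrow> complex) \<Rightarrow> real measure \<Rightarrow> bool" where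
  "has_spectral_measure A v \<rho> \<longleftrightarrow>
     ell2_bounded_selfadjoint A \<and>
     (\<exists>E. resolution_of_identity_of A E \<and> \<rho> = stieltjes_measure E v)"

definition spectral_measure ::
    "((nat \<Rightarrow> complex) \<Rightarrow> (nat \<Rightarrow> complex)) \<Rightarrow> (nat \<Rightarrow> complex) \<Rightarrow> real measure" where
  "spectral_measure A v = (THE \<rho>. has_spectral_measure A v \<rho>)"

section \<open>Volterra lattices\<close>

definition time_interval :: "ereal \<Rightarrow> real set" where
  "time_interval T = {t. 0 \<le> t \<and> ereal t < T}"

definition volterra_rhs :: "(nat \<Rightarrow> real) \<Rightarrow> nat \<Rightarrow> real" where
  "volterra_rhs a n = a n * (a (Suc n) - (if n = 0 then 0 else a (n - 1)))"

text \<open>The derivative at \<open>t = 0\<close> is one-sided.\<close>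

definition volterra_solution :: "ereal \<Rightarrow> (real \<Rightarrow> nat \<Rightarrow> real) \<Rightarrow> bool" where
  "volterra_solution T a \<longleftrightarrow>
     (\<forall>t\<in>time_interval T. \<forall>n. a t n > 0) \<and>
     (\<forall>t\<in>time_interval T. bdd_above (range (a t))) \<and>
     (\<forall>t\<in>time_interval T. \<forall>n.
        ((\<lambda>s. a s n) has_real_derivative volterra_rhs (a t) n) (at t within time_interval T))"

text \<open>
  Convergence to a finite number of the series $H_0 = \frac12 \sum_n \ln a_n$.
\<close>

definition finite_log_hamiltonian :: "(nat \<Rightarrow> real) \<Rightarrow> bool" where
  "finite_log_hamiltonian a \<longleftrightarrow> summable (\<lambda>n. 1 / 2 * ln (a n))"

text \<open>
  Functions of time are made extensional, so that they are determined by their values for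
  \<open>t \<in> [0,T)\<close>.
\<close>

definition volterra_solutions :: "ereal \<Rightarrow> (real \<Rightarrow> nat \<Rightarrow> real) set" where
  "volterra_solutions T = {a \<in> extensional (time_interval T).
     volterra_solution T a \<and> (\<forall>t\<in>time_interval T. finite_log_hamiltonian (a t))}"

definition lax_matrix :: "(nat \<Rightarrow> real) \<Rightarrow> nat \<Rightarrow> nat \<Rightarrow> real" where
  "lax_matrix a i j =
     (if j = Suc i then sqrt (a i) else if i = Suc j then sqrt (a j) else 0)"

text \<open>Each row has at most two nonzero entries, so the series is a finite sum.\<close>

definition lax_operator :: "(nat \<Rightarrow> real) \<Rightarrow> (nat \<Rightarrow> complex) \<Rightarrow> (nat \<Rightarrow> complex)" where
  "lax_operator a x = (\<lambda>i. \<Sum>j. complex_of_real (lax_matrix a i j) * x j)"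

section \<open>Measures and moments\<close>

definition even_measure :: "real measure \<Rightarrow> bool" where
  "even_measure \<rho> \<longleftrightarrow> (\<forall>B\<in>sets borel. emeasure \<rho> (uminus ` B) = emeasure \<rho> B)"

definition topological_support :: "real measure \<Rightarrow> real set" where
  "topological_support \<rho> = {x. \<forall>U. open U \<longrightarrow> x \<in> U \<longrightarrow> emeasure \<rho> U > 0}"

definition essential_support :: "real measure \<Rightarrow> real set" where
  "essential_support \<rho> =
     topological_support \<rho> - {x. x isolated_in (topological_support \<rho>)}"

definition mass_points :: "real measure \<Rightarrow> real set" where
  "mass_points \<rho> = {x. emeasure \<rho> {x} > 0}"

definition moment :: "real measure \<Rightarrow> nat \<Rightarrow> real" where
  "moment \<rho> k = (\<integral>x. x ^ k \<partial>\<rho>)"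

definition hankel_det :: "(nat \<Rightarrow> real) \<Rightarrow> nat \<Rightarrow> real" where
  "hankel_det s n = Determinant.det (mat (n + 1) (n + 1) (\<lambda>(i, j). s (i + j)))"

text \<open>
  Finiteness of the moments has to be required explicitly, because the Bochner integral of a
  non-integrable function is \<open>0\<close>.
\<close>

definition admissible_measure :: "real measure \<Rightarrow> bool" where
  "admissible_measure \<rho> \<longleftrightarrow>
     sets \<rho> = sets borel \<and> prob_space \<rho> \<and> even_measure \<rho> \<and>
     essential_support \<rho> = {-2..2} \<and>
     countable (mass_points \<rho> - {-2..2}) \<and>
     {x. x islimpt (mass_points \<rho> - {-2..2})} \<subseteq> {-2, 2} \<and>
     (\<forall>k. integrable \<rho> (\<lambda>x. x ^ k)) \<and>
     (\<exists>c>0. (\<lambda>n. hankel_det (moment \<rho>) (n + 1) / hankel_det (moment \<rho>) n) \<longlonglongrightarrow> c)"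

definition evolved_measure :: "real measure \<Rightarrow> real \<Rightarrow> real measure" where
  "evolved_measure \<rho> t =
     density \<rho> (\<lambda>x. ennreal (exp (x\<^sup>2 * t) / (\<integral>y. exp (y\<^sup>2 * t) \<partial>\<rho>)))"

definition spectral_families :: "ereal \<Rightarrow> (real \<Rightarrow> real measure) set" where
  "spectral_families T = {\<rho> \<in> extensional (time_interval T).
     \<forall>t\<in>time_interval T. admissible_measure (\<rho> t) \<and> \<rho> t = evolved_measure (\<rho> 0) t}"

section \<open>The two directions of the correspondence\<close>

definition spectral_family_of :: "ereal \<Rightarrow> (real \<Rightarrow> nat \<Rightarrow> real) \<Rightarrow> real \<Rightarrow> real measure" where
  "spectral_family_of T a =
     (\<lambda>t\<in>time_interval T. spectral_measure (lax_operator (a t)) (ell2_unit 0))"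

definition lattice_coeff :: "real measure \<Rightarrow> nat \<Rightarrow> real" where
  "lattice_coeff \<rho> n =
     hankel_det (moment \<rho>) (n + 1) * (if n = 0 then 1 else hankel_det (moment \<rho>) (n - 1))
       / (hankel_det (moment \<rho>) n)\<^sup>2"

definition lattice_of :: "ereal \<Rightarrow> (real \<Rightarrow> real measure) \<Rightarrow> real \<Rightarrow> nat \<Rightarrow> real" where
  "lattice_of T \<rho> = (\<lambda>t\<in>time_interval T. lattice_coeff (\<rho> t))"

end

theory Submission
  imports Defs
begin

text \<open>
  Let \<open>s\<^bsub>k\<^esub>\<close> be the moments of the spectral measure. The Hankel determinants satisfy
  \<open>\<Delta>\<^bsub>n+1\<^esub> / \<Delta>\<^bsub>n\<^esub> = a\<^bsub>0\<^esub> \<cdots> a\<^bsub>n\<^esub>\<close>, so the determinant condition is the convergence of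
  \<open>\<Sum> ln a\<^bsub>n\<^esub>\<close>; it forces \<open>a\<^bsub>n\<^esub> \<rightarrow> 1\<close>, which gives the essential spectrum \<open>[-2, 2]\<close> by Weyl
  sequences inside and by weakly null normalized indicator functions outside. The spectral measure
  of a bounded Jacobi matrix is obtained from the Hausdorff moment problem (positivity of
  \<open>B\<^sup>j (1 - B)\<^sup>k\<close> for \<open>B = (L + R) / 2R\<close>), and the projections have the matrix entries
  \<open>\<integral>\<^bsub>s \<le> \<lambda>\<^esub> p\<^bsub>i\<^esub> p\<^bsub>j\<^esub> d\<rho>\<close> in terms of the orthonormal polynomials. Under the flow,
  \<open>s\<^bsub>k\<^esub>' = s\<^bsub>k+2\<^esub> - s\<^bsub>2\<^esub> s\<^bsub>k\<^esub>\<close>, a linear system after the normalization is removed. Its solution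
  coming from a Volterra lattice is absolutely monotone, hence equal to its Taylor series, which is
  that of \<open>\<integral> x\<^sup>k exp (x\<^sup>2 t) d\<rho>\<close>.
\<close>

section \<open>Moments, Hankel determinants and the Volterra flow\<close>

text \<open>Both directions meet in the moments. \<open>jacobi_moment a n k\<close> stands for the
  integral of \<open>x^k\<close> against the monic orthogonal polynomial of degree \<open>n\<close>.
  As a polynomial in the coefficients, free of square roots and of measures, it can be
  differentiated in time, and for positive \<open>a\<close> it determines \<open>a\<close>. Two
  obstacles shape the rest. An admissible measure is not assumed to have compact support, so its
  moments do not yet identify it. The Hankel condition bounds the coefficients, hence some compactly
  supported measure has the same moments, and the growth of these moments forces the given measure
  into the same interval; only then is it determined. Secondly, \<open>spectral_measure\<close> is a
  definite description over all resolutions of the identity, so the constructed family must be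
  compared with an arbitrary one. A nonzero vector below level \<open>l\<close> for one family,
  projected beyond some \<open>m > l\<close> by the other, would grow both too slowly and too fast
  under powers of the shifted operator.\<close>

fun jacobi_moment :: "(nat \<Rightarrow> real) \<Rightarrow> nat \<Rightarrow> nat \<Rightarrow> real" where
  "jacobi_moment a n 0 = (if n = 0 then 1 else 0)"
| "jacobi_moment a n (Suc k) =
     jacobi_moment a (Suc n) k + (if n = 0 then 0 else a (n - 1) * jacobi_moment a (n - 1) k)"

lemma jacobi_moment_eq_0: "k < n \<Longrightarrow> jacobi_moment a n k = 0"
  by (induction k arbitrary: n) auto

lemma jacobi_moment_diag: "jacobi_moment a n n = (\<Prod>j<n. a j)"
proof (induction n)
  case (Suc n)
  then show ?case by (simp add: jacobi_moment_eq_0 mult.commute)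
qed simp

text \<open>Every step of the recursion changes the level \<open>n\<close> by exactly one; this is
  where the zero diagonal of the Jacobi matrix enters the moments.\<close>

lemma jacobi_moment_odd: "odd (n + k) \<Longrightarrow> jacobi_moment a n k = 0"
proof (induction k arbitrary: n)
  case (Suc k)
  show ?case
  proof (cases n)
    case (Suc m)
    with Suc.prems Suc.IH[of "Suc n"] Suc.IH[of m] show ?thesis by simp
  qed (use Suc.prems Suc.IH[of 1] in simp)
qed (auto elim: oddE)

lemma jacobi_moment_Suc_left:
  "jacobi_moment a (Suc n) k = jacobi_moment a n (Suc k)
     - (if n = 0 then 0 else a (n - 1) * jacobi_moment a (n - 1) k)"
  by simp

text \<open>The coefficient of \<open>x^i\<close> in the monic orthogonal polynomial
  \<open>P_n\<close>, with \<open>P_(n+2) = x P_(n+1) - a_n P_n\<close>.\<close>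

fun monic_coeff :: "(nat \<Rightarrow> real) \<Rightarrow> nat \<Rightarrow> nat \<Rightarrow> real" where
  "monic_coeff a 0 i = (if i = 0 then 1 else 0)"
| "monic_coeff a (Suc 0) i = (if i = 1 then 1 else 0)"
| "monic_coeff a (Suc (Suc n)) i =
     (if i = 0 then 0 else monic_coeff a (Suc n) (i - 1)) - a n * monic_coeff a n i"

lemma monic_coeff_eq_0: "n < i \<Longrightarrow> monic_coeff a n i = 0"
  by (induction a n i rule: monic_coeff.induct) auto

lemma monic_coeff_diag: "monic_coeff a n n = 1"
proof (induction n rule: less_induct)
  case (less n)
  consider "n = 0" | "n = Suc 0" | m where "n = Suc (Suc m)" by (metis nat.exhaust)
  then show ?case using less by cases (auto simp: monic_coeff_eq_0)
qed

lemma sum_monic_coeff_moment: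
  assumes "n \<le> N"
  shows "(\<Sum>i\<le>N. monic_coeff a n i * jacobi_moment a 0 (i + k)) = jacobi_moment a n k"
  using assms
proof (induction n arbitrary: k N rule: less_induct)
  case (less n)
  consider "n = 0" | "n = Suc 0" | m where "n = Suc (Suc m)" by (metis nat.exhaust)
  then show ?case
  proof cases
    case 1
    have "(\<Sum>i\<le>N. monic_coeff a n i * jacobi_moment a 0 (i + k))
        = (\<Sum>i\<le>N. if i = 0 then jacobi_moment a 0 k else 0)"
      by (intro sum.cong) (auto simp: 1)
    then show ?thesis by (simp add: 1)
  next
    case 2
    have "(\<Sum>i\<le>N. monic_coeff a n i * jacobi_moment a 0 (i + k))
        = (\<Sum>i\<le>N. if i = 1 then jacobi_moment a 0 (Suc k) else 0)"
      by (intro sum.cong) (auto simp: 2)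
    then show ?thesis using less.prems by (simp add: 2)
  next
    case (3 m)
    then obtain N' where N: "N = Suc N'" using less.prems by (cases N) auto
    have "(\<Sum>i\<le>N. (if i = 0 then 0 else monic_coeff a (Suc m) (i - 1)) * jacobi_moment a 0 (i + k))
        = (\<Sum>i\<le>N'. monic_coeff a (Suc m) i * jacobi_moment a 0 (i + Suc k))"
      unfolding N by (subst sum.atMost_Suc_shift) simp
    also have "\<dots> = jacobi_moment a (Suc m) (Suc k)"
      using less.IH[of "Suc m" N' "Suc k"] less.prems 3 N by simp
    finally have *: "(\<Sum>i\<le>N. (if i = 0 then 0 else monic_coeff a (Suc m) (i - 1)) *
        jacobi_moment a 0 (i + k)) = jacobi_moment a (Suc m) (Suc k)" .
    have **: "(\<Sum>i\<le>N. monic_coeff a m i * jacobi_moment a 0 (i + k)) = jacobi_moment a m k"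
      using less.IH[of m N k] less.prems 3 by simp
    have "(\<Sum>i\<le>N. monic_coeff a n i * jacobi_moment a 0 (i + k))
       = (\<Sum>i\<le>N. (if i = 0 then 0 else monic_coeff a (Suc m) (i - 1)) * jacobi_moment a 0 (i + k))
         - a m * (\<Sum>i\<le>N. monic_coeff a m i * jacobi_moment a 0 (i + k))"
      by (simp add: 3 sum_subtractf sum_distrib_left left_diff_distrib mult.assoc)
    then show ?thesis by (simp add: * ** 3)
  qed
qed

text \<open>Gaussian elimination by orthogonality: the unit lower triangular matrix \<open>C\<close>
  of polynomial coefficients turns the Hankel matrix into \<open>U\<close>, which is upper
  triangular because \<open>P_i\<close> annihilates the powers \<open>x^j\<close> with
  \<open>j < i\<close>. The diagonal of \<open>U\<close> carries the squared norms of the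
  \<open>P_i\<close>.\<close>

lemma hankel_det_jacobi_moment:
  "hankel_det (jacobi_moment a 0) n = (\<Prod>k\<le>n. \<Prod>j<k. a j)"
proof -
  define N where "N = n + 1"
  define C where "C = mat N N (\<lambda>(i, j). monic_coeff a i j)"
  define H where "H = mat N N (\<lambda>(i, j). jacobi_moment a 0 (i + j))"
  define U where "U = mat N N (\<lambda>(i, j). jacobi_moment a i j)"
  have car: "C \<in> carrier_mat N N" "H \<in> carrier_mat N N" "U \<in> carrier_mat N N"
    by (auto simp: C_def H_def U_def)
  have CH: "C * H = U"
  proof (rule eq_matI)
    fix i j assume ij: "i < dim_row U" "j < dim_col U"
    then have ij': "i < N" "j < N" by (auto simp: U_def)
    have "(C * H) $$ (i, j) = (\<Sum>l\<in>{0..<N}. monic_coeff a i l * jacobi_moment a 0 (l + j))"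
      using ij' by (simp add: C_def H_def scalar_prod_def)
    also have "{0..<N} = {..n}" by (auto simp: N_def)
    finally show "(C * H) $$ (i, j) = U $$ (i, j)"
      using ij' sum_monic_coeff_moment[of i n a j] by (simp add: U_def N_def)
  qed (auto simp: C_def H_def U_def)
  have "Determinant.det C = prod_list (diag_mat C)"
    by (rule det_lower_triangular[OF _ car(1)]) (auto simp: C_def monic_coeff_eq_0)
  also have "\<dots> = 1"
    by (simp add: prod_list_diag_prod C_def monic_coeff_diag)
  finally have dC: "Determinant.det C = 1" .
  have "Determinant.det U = prod_list (diag_mat U)"
    by (rule det_upper_triangular[OF _ car(3)]) (auto simp: U_def upper_triangular_def jacobi_moment_eq_0)
  also have "\<dots> = (\<Prod>k\<in>{0..<N}. \<Prod>j<k. a j)"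
    by (simp add: prod_list_diag_prod U_def jacobi_moment_diag)
  also have "{0..<N} = {..n}" by (auto simp: N_def)
  finally have "Determinant.det U = (\<Prod>k\<le>n. \<Prod>j<k. a j)" .
  moreover have "Determinant.det U = Determinant.det C * Determinant.det H"
    using det_mult[OF car(1,2)] CH by simp
  ultimately show ?thesis using dC by (simp add: hankel_det_def H_def N_def)
qed

lemma hankel_ratio_jacobi_moment:
  assumes "\<And>n. a n > 0"
  shows "hankel_det (jacobi_moment a 0) (n + 1) / hankel_det (jacobi_moment a 0) n = (\<Prod>j\<le>n. a j)"
proof -
  have "(\<Prod>k\<le>n. \<Prod>j<k. a j) > 0"
    by (intro prod_pos) (auto simp: assms)
  then show ?thesis
    by (simp add: hankel_det_jacobi_moment lessThan_Suc_atMost del: prod_zero_iff)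
qed

text \<open>Consecutive Hankel ratios are the partial products of \<open>a\<close>, and
  \<open>lattice_coeff\<close> is the quotient of two neighbouring ratios. The index
  \<open>n = 0\<close> is separate because there \<open>1\<close> takes the place of the determinant
  of index -1.\<close>

lemma lattice_coeff_jacobi_moment:
  assumes "\<And>n. a n > 0" "moment \<rho> = jacobi_moment a 0"
  shows "lattice_coeff \<rho> = a"
proof
  fix n
  have pos: "hankel_det (jacobi_moment a 0) m > 0" for m
    unfolding hankel_det_jacobi_moment by (intro prod_pos) (auto simp: assms)
  show "lattice_coeff \<rho> n = a n"
  proof (cases n)
    case 0
    then show ?thesis
      by (simp add: lattice_coeff_def assms(2) hankel_det_jacobi_moment lessThan_Suc)
  next
    case (Suc m)
    have 1: "hankel_det (jacobi_moment a 0) (Suc n) = hankel_det (jacobi_moment a 0) n * (\<Prod>j\<le>n. a j)"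
      using hankel_ratio_jacobi_moment[of a n] assms(1) pos[of n] by (simp add: field_simps)
    have 2: "hankel_det (jacobi_moment a 0) n = hankel_det (jacobi_moment a 0) m * (\<Prod>j\<le>m. a j)"
      using hankel_ratio_jacobi_moment[of a m] assms(1) pos[of m] Suc by (simp add: field_simps)
    have p: "(\<Prod>j\<le>m. a j) > 0" by (intro prod_pos) (auto simp: assms)
    define P Q H where "P = (\<Prod>j\<le>n. a j)" and "Q = (\<Prod>j\<le>m. a j)"
      and "H = hankel_det (jacobi_moment a 0) m"
    have "lattice_coeff \<rho> n = ((H * Q) * P) * H / (H * Q)\<^sup>2"
      unfolding lattice_coeff_def assms(2) P_def Q_def H_def using 1 2 Suc by simp
    also have "\<dots> = P / Q"
      using pos[of m] p by (simp add: H_def[symmetric] Q_def[symmetric] power2_eq_square)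
    finally have "lattice_coeff \<rho> n = (\<Prod>j\<le>n. a j) / (\<Prod>j\<le>m. a j)"
      by (simp add: P_def Q_def)
    also have "\<dots> = a n" using p by (simp add: Suc del: prod_zero_iff)
    finally show ?thesis .
  qed
qed

text \<open>Under the flow the weight has logarithmic derivative \<open>x^2 - a_0\<close> and the
  monic polynomials satisfy \<open>P_n' = - a_(n-1) a_(n-2) P_(n-2)\<close>; the formula is the
  product rule for the integral of \<open>x^k P_n\<close>. The proof uses no measure: it is an
  induction on \<open>k\<close> through the defining recursion, closed by the Volterra equation at
  the lower neighbour. At \<open>n = 0\<close> the last term is absent, which leaves an equation
  between moments.\<close>

lemma jacobi_moment_volterra_deriv:
  assumes "\<And>n. ((\<lambda>s. a s n) has_real_derivative volterra_rhs (a t) n) (at t within S)"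
  shows "((\<lambda>s. jacobi_moment (a s) n k) has_real_derivative
           jacobi_moment (a t) n (k + 2) - a t 0 * jacobi_moment (a t) n k
           - (if n < 2 then 0 else a t (n - 1) * a t (n - 2) * jacobi_moment (a t) (n - 2) k))
         (at t within S)"
proof (induction k arbitrary: n)
  case 0
  consider "n = 0" | "n = 1" | "n = 2" | "n > 2" by linarith
  then show ?case
    by cases (auto simp: numeral_2_eq_2)
next
  case (Suc k)
  show ?case
  proof (cases n)
    case 0
    have "((\<lambda>s. jacobi_moment (a s) 0 (Suc k)) has_real_derivative
        jacobi_moment (a t) 1 (k + 2) - a t 0 * jacobi_moment (a t) 1 k) (at t within S)"
      using Suc.IH[of 1] by simp
    then show ?thesis by (simp add: 0)
  next
    case n: (Suc m)
    have deriv: "((\<lambda>s. jacobi_moment (a s) n (Suc k)) has_real_derivative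
       (jacobi_moment (a t) (Suc n) (k + 2) - a t 0 * jacobi_moment (a t) (Suc n) k
           - a t n * a t m * jacobi_moment (a t) m k) +
       (volterra_rhs (a t) m * jacobi_moment (a t) m k + a t m *
       (jacobi_moment (a t) m (k + 2) - a t 0 * jacobi_moment (a t) m k
           - (if m < 2 then 0 else a t (m - 1) * a t (m - 2) * jacobi_moment (a t) (m - 2) k))))
       (at t within S)"
      using Suc.IH[of "Suc n"] Suc.IH[of m] assms[of m]
      unfolding n by (auto intro!: derivative_eq_intros)
    have eq: "(jacobi_moment (a t) (Suc n) (k + 2) - a t 0 * jacobi_moment (a t) (Suc n) k
           - a t n * a t m * jacobi_moment (a t) m k) +
       (volterra_rhs (a t) m * jacobi_moment (a t) m k + a t m *
       (jacobi_moment (a t) m (k + 2) - a t 0 * jacobi_moment (a t) m k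
           - (if m < 2 then 0 else a t (m - 1) * a t (m - 2) * jacobi_moment (a t) (m - 2) k)))
      = jacobi_moment (a t) n (Suc k + 2) - a t 0 * jacobi_moment (a t) n (Suc k)
           - (if n < 2 then 0 else a t (n - 1) * a t (n - 2) * jacobi_moment (a t) (n - 2) (Suc k))"
      (is "?l = ?r")
    proof -
      \<comment> \<open>Neighbours of negative index drop out, so the two lowest values of
        \<open>m\<close> need their own instance of the identity.\<close>
      consider "m = 0" | "m = 1" | j where "m = Suc (Suc j)"
        by (metis One_nat_def nat.exhaust)
      then show "?l = ?r"
        by cases (auto simp: n volterra_rhs_def algebra_simps numeral_2_eq_2)
    qed
    show ?thesis using deriv unfolding eq .
  qed
qed

text \<open>This is the derivative of the squared norm \<open>jacobi_moment a n n\<close> under the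
  unnormalized flow: its logarithmic derivative is \<open>a_n + a_(n-1)\<close>. Since
  \<open>a_n\<close> is a quotient of two consecutive norms, subtracting the values at
  \<open>n + 1\<close> and \<open>n\<close> leaves \<open>a_(n+1) - a_(n-1)\<close>, the Volterra
  equation.\<close>

lemma jacobi_moment_diag_add2:
  "jacobi_moment a n (n + 2) - (if n < 2 then 0 else a (n - 1) * a (n - 2) * jacobi_moment a (n - 2) n)
    = (a n + (if n = 0 then 0 else a (n - 1))) * jacobi_moment a n n"
proof (cases n)
  case (Suc m)
  show ?thesis
  proof (cases m)
    case (Suc j)
    have "jacobi_moment a (Suc (Suc n)) n = 0" "jacobi_moment a (Suc n) (Suc n) = a n * jacobi_moment a n n"
      by (simp_all add: jacobi_moment_eq_0 jacobi_moment_diag)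
    then show ?thesis
      by (auto simp: \<open>n = Suc m\<close> Suc algebra_simps)
  qed (simp add: Suc numeral_2_eq_2 jacobi_moment_eq_0 algebra_simps)
qed (simp add: numeral_2_eq_2)

text \<open>Differentiability is known at level 0 only. It climbs together with the Volterra
  equation: levels \<open>n\<close> and \<open>n + 1\<close> give \<open>a_n\<close> as the quotient
  of their diagonal entries, hence its derivative, and then the recursion solved for level
  \<open>n + 2\<close> gives the next derivative formula. The positive factor \<open>\<tau>\<close>
  cancels in the quotient.\<close>

lemma volterra_from_moments:
  fixes a :: "real \<Rightarrow> nat \<Rightarrow> real"
  assumes pos: "\<And>s n. s \<in> S \<Longrightarrow> a s n > 0" "\<And>s. s \<in> S \<Longrightarrow> \<tau> s > 0"
    and deriv: "\<And>s k. s \<in> S \<Longrightarrow> ((\<lambda>s. \<tau> s * jacobi_moment (a s) 0 k) has_real_derivative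
             \<tau> s * jacobi_moment (a s) 0 (k + 2)) (at s within S)"
    and t: "t \<in> S"
  shows "((\<lambda>s. a s n) has_real_derivative volterra_rhs (a t) n) (at t within S)"
proof -
  \<comment> \<open>The right side of the normalized formula without its \<open>a_0\<close> term.
    The case \<open>k = 0\<close> of the hypothesis says \<open>\<tau>' = a_0 \<tau>\<close>, so the
    factor \<open>\<tau>\<close> absorbs that term.\<close>
  define D where "D n k = \<tau> t * (jacobi_moment (a t) n (k + 2)
     - (if n < 2 then 0 else a t (n - 1) * a t (n - 2) * jacobi_moment (a t) (n - 2) k))" for n k
  define Q where "Q n \<longleftrightarrow> (\<forall>k. ((\<lambda>s. \<tau> s * jacobi_moment (a s) n k) has_real_derivative D n k)
     (at t within S))" for n
  define R where "R n \<longleftrightarrow> ((\<lambda>s. a s n) has_real_derivative volterra_rhs (a t) n) (at t within S)" for n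
  have h_pos: "jacobi_moment (a s) n n > 0" if "s \<in> S" for s n
    unfolding jacobi_moment_diag by (intro prod_pos) (auto simp: pos that)
  have R: "R n" if "Q n" "Q (Suc n)" for n
  proof -
    define c where "c m = a t m + (if m = 0 then 0 else a t (m - 1))" for m
    have Dn: "D m m = \<tau> t * (c m * jacobi_moment (a t) m m)" for m
      unfolding D_def using jacobi_moment_diag_add2[of "a t" m] by (simp add: c_def)
    have nz: "\<tau> s * jacobi_moment (a s) n n \<noteq> 0" if "s \<in> S" for s
      using h_pos[OF that, of n] pos(2)[OF that] by simp
    have "((\<lambda>s. (\<tau> s * jacobi_moment (a s) (Suc n) (Suc n)) / (\<tau> s * jacobi_moment (a s) n n))
        has_real_derivative (D (Suc n) (Suc n) * (\<tau> t * jacobi_moment (a t) n n)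
          - (\<tau> t * jacobi_moment (a t) (Suc n) (Suc n)) * D n n) /
          ((\<tau> t * jacobi_moment (a t) n n) * (\<tau> t * jacobi_moment (a t) n n))) (at t within S)"
      using that nz[OF t] unfolding Q_def by (intro DERIV_divide) blast+
    also have "jacobi_moment (a t) (Suc n) (Suc n) = a t n * jacobi_moment (a t) n n"
      unfolding jacobi_moment_diag by simp
    also have "(D (Suc n) (Suc n) * (\<tau> t * jacobi_moment (a t) n n)
          - (\<tau> t * (a t n * jacobi_moment (a t) n n)) * D n n) /
          ((\<tau> t * jacobi_moment (a t) n n) * (\<tau> t * jacobi_moment (a t) n n)) = a t n * (c (Suc n) - c n)"
    proof -
      have "D (Suc n) (Suc n) = \<tau> t * (c (Suc n) * (a t n * jacobi_moment (a t) n n))"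
        unfolding Dn by (simp only: jacobi_moment_diag prod.lessThan_Suc mult.commute)
      moreover have "(x * (c (Suc n) * (y * h)) * (x * h) - x * (y * h) * (x * (c n * h))) /
          (x * h * (x * h)) = y * (c (Suc n) - c n)" if "x > 0" "h > 0" for x y h :: real
        using that by (simp add: field_simps)
      ultimately show ?thesis
        using h_pos[OF t, of n] pos(2)[OF t] by (simp only: Dn[of n])
    qed
    also have "a t n * (c (Suc n) - c n) = volterra_rhs (a t) n"
      by (auto simp: c_def volterra_rhs_def)
    finally show "R n" unfolding R_def
    proof (rule has_field_derivative_transform_within[where d = 1])
      fix s assume "s \<in> S"
      with h_pos[of s n] pos(2)[of s]
      show "\<tau> s * jacobi_moment (a s) (Suc n) (Suc n) / (\<tau> s * jacobi_moment (a s) n n) = a s n"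
        by (simp add: jacobi_moment_diag del: prod_zero_iff)
    qed (use t in auto)
  qed
  have "Q n \<and> Q (Suc n)" for n
  proof (induction n)
    case 0
    then show ?case
      using deriv[OF t] by (auto simp: Q_def D_def jacobi_moment_Suc_left[of _ 0] simp del: jacobi_moment.simps)
  next
    case (Suc n)
    then have QR: "Q n" "Q (Suc n)" "R n" using R by auto
    have "Q (Suc (Suc n))"
      unfolding Q_def
    proof
      fix k
      have "((\<lambda>s. \<tau> s * jacobi_moment (a s) (Suc n) (Suc k) - a s n * (\<tau> s * jacobi_moment (a s) n k))
        has_real_derivative D (Suc n) (Suc k) - (volterra_rhs (a t) n * (\<tau> t * jacobi_moment (a t) n k)
          + D n k * a t n)) (at t within S)"
        using QR unfolding Q_def R_def by (intro DERIV_diff DERIV_mult) blast+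
      also have "(\<lambda>s. \<tau> s * jacobi_moment (a s) (Suc n) (Suc k) - a s n * (\<tau> s * jacobi_moment (a s) n k))
         = (\<lambda>s. \<tau> s * jacobi_moment (a s) (Suc (Suc n)) k)"
        by (simp add: fun_eq_iff algebra_simps)
      also have "D (Suc n) (Suc k) - (volterra_rhs (a t) n * (\<tau> t * jacobi_moment (a t) n k)
          + D n k * a t n) = D (Suc (Suc n)) k"
      proof -
        consider "n = 0" | "n = 1" | j where "n = Suc (Suc j)"
          by (metis One_nat_def nat.exhaust)
        then show ?thesis
          by cases (auto simp: D_def volterra_rhs_def algebra_simps numeral_2_eq_2)
      qed
      finally show "((\<lambda>s. \<tau> s * jacobi_moment (a s) (Suc (Suc n)) k) has_real_derivative
         D (Suc (Suc n)) k) (at t within S)" .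
    qed
    with QR show ?case by simp
  qed
  then show ?thesis using R unfolding R_def by blast
qed

section \<open>The Hausdorff moment problem\<close>

text \<open>The moments grow at most like \<open>C^k\<close>, so the characteristic function is the
  sum of its moment series at every real argument, and Levy's uniqueness theorem applies.\<close>

lemma compact_moments_unique:
  fixes M N :: "real measure"
  assumes M: "real_distribution M" "AE x in M. \<bar>x\<bar> \<le> C"
    and N: "real_distribution N" "AE x in N. \<bar>x\<bar> \<le> C"
    and eq: "\<And>k. (\<integral>x. x ^ k \<partial>M) = (\<integral>x. x ^ k \<partial>N)"
  shows "M = N"
proof (rule Levy_uniqueness[OF M(1) N(1)], rule ext)
  fix t :: real
  define p where "p n = (\<Sum>k\<le>n. ((\<i> * t) ^ k / fact k) * complex_of_real (\<integral>x. x ^ k \<partial>M))" for n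
  have conv: "p \<longlonglongrightarrow> char L t"
    if L: "real_distribution L" "AE x in L. \<bar>x\<bar> \<le> C"
      and eq': "\<And>k. (\<integral>x. x ^ k \<partial>L) = (\<integral>x. x ^ k \<partial>M)" for L :: "real measure"
  proof -
    interpret L: real_distribution L by fact
    have int: "integrable L (\<lambda>x. x ^ k)" for k
    proof (rule L.integrable_const_bound[where B = "C ^ k"])
      show "AE x in L. norm (x ^ k) \<le> C ^ k"
        using L(2) by eventually_elim (simp add: power_abs power_mono)
    qed auto
    have ex: "L.expectation (\<lambda>x. \<bar>x\<bar> ^ n) \<le> C ^ n" for n
    proof -
      have "L.expectation (\<lambda>x. \<bar>x\<bar> ^ n) \<le> L.expectation (\<lambda>x. C ^ n)"
      proof (rule integral_mono_AE)
        show "integrable L (\<lambda>x. \<bar>x\<bar> ^ n)"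
          using integrable_abs[OF int[of n]] by (simp add: power_abs)
        show "AE x in L. \<bar>x\<bar> ^ n \<le> C ^ n"
          using L(2) by eventually_elim (simp add: power_mono)
      qed simp
      then show ?thesis by (simp add: L.prob_space del: L.space_eq_univ)
    qed
    have bd: "norm (p n - char L t) \<le> 2 * ((\<bar>t\<bar> * C) ^ n / fact n)" for n
    proof -
      have "cmod (char L t - p n) \<le> (2 * \<bar>t\<bar> ^ n / fact n) * L.expectation (\<lambda>x. \<bar>x\<bar> ^ n)"
        unfolding p_def eq'[symmetric] by (rule L.char_approx1) (rule int)
      also have "\<dots> \<le> (2 * \<bar>t\<bar> ^ n / fact n) * C ^ n"
        by (intro mult_left_mono ex) auto
      finally show ?thesis by (simp add: norm_minus_commute power_mult_distrib)
    qed
    have "(\<lambda>n. 2 * ((\<bar>t\<bar> * C) ^ n / fact n)) \<longlonglongrightarrow> 2 * 0"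
      using summable_LIMSEQ_zero[OF summable_exp[of "\<bar>t\<bar> * C"]]
      by (intro tendsto_mult_left) (simp add: field_simps)
    then have "(\<lambda>n. p n - char L t) \<longlonglongrightarrow> 0"
      by (intro Lim_null_comparison[of "\<lambda>n. p n - char L t" "\<lambda>n. 2 * ((\<bar>t\<bar> * C) ^ n / fact n)"]
         always_eventually allI bd) simp
    then show ?thesis by (simp add: LIM_zero_iff)
  qed
  show "char M t = char N t"
    by (rule LIMSEQ_unique[OF conv[OF M refl] conv[OF N eq[symmetric]]])
qed

text \<open>Read \<open>c j k\<close> as a linear functional applied to
  \<open>x^j (1 - x)^k\<close>, for which the splitting rule is \<open>1 = x + (1 - x)\<close>. The
  sum expands \<open>(x + (1 - x))^n = 1\<close> inside the functional.\<close>

lemma binomial_sum_complete_monotone: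
  fixes c :: "nat \<Rightarrow> nat \<Rightarrow> real"
  assumes split: "\<And>j k. c j k = c (Suc j) k + c j (Suc k)"
  shows "(\<Sum>k\<le>n. real (n choose k) * c (k + j) (n - k + i)) = c j i"
proof (induction n arbitrary: i j)
  case (Suc n)
  define g where "g k = c (k + j) (Suc n - k + i)" for k
  have "(\<Sum>k\<le>Suc n. real (Suc n choose k) * g k)
      = g 0 + (\<Sum>k\<le>n. real (n choose k) * g (Suc k) + real (n choose Suc k) * g (Suc k))"
    by (subst sum.atMost_Suc_shift) (simp add: algebra_simps)
  also have "\<dots> = (\<Sum>k\<le>n. real (n choose k) * g (Suc k))
      + (\<Sum>k\<le>Suc n. real (n choose k) * g k)"
    by (simp add: sum.atMost_Suc_shift[of "\<lambda>k. real (n choose k) * g k" n] sum.distrib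
      del: sum.atMost_Suc)
  also have "(\<Sum>k\<le>Suc n. real (n choose k) * g k) = (\<Sum>k\<le>n. real (n choose k) * c (k + j) (n - k + Suc i))"
    by (simp add: g_def Suc_diff_le)
  also have "\<dots> = c j (Suc i)" by (rule Suc.IH)
  also have "(\<Sum>k\<le>n. real (n choose k) * g (Suc k)) = (\<Sum>k\<le>n. real (n choose k) * c (k + Suc j) (n - k + i))"
    by (simp add: g_def)
  also have "\<dots> = c (Suc j) i" by (rule Suc.IH)
  finally show ?case by (simp add: g_def split[of j i])
qed simp

text \<open>Falling factorials are used in place of \<open>(k / n)^j\<close> because their quotient
  times a binomial coefficient is again a binomial coefficient. For \<open>k < j\<close> the factor
  with \<open>i = k\<close> vanishes.\<close>

lemma binomial_falling_ratio:
  assumes "j \<le> n" "k \<le> n"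
  shows "real (n choose k) * (\<Prod>i<j. (real k - real i) / (real n - real i))
     = (if j \<le> k then real ((n - j) choose (k - j)) else 0)"
  using assms(1)
proof (induction j)
  case (Suc j)
  have nz: "real n - real j \<noteq> 0" using Suc.prems by simp
  have "real (n choose k) * (\<Prod>i<Suc j. (real k - real i) / (real n - real i))
    = (if j \<le> k then real ((n - j) choose (k - j)) else 0) * ((real k - real j) / (real n - real j))"
    using Suc by (simp add: mult.assoc[symmetric])
  also have "\<dots> = (if Suc j \<le> k then real ((n - Suc j) choose (k - Suc j)) else 0)"
  proof (cases "Suc j \<le> k")
    case True
    define m where "m = k - Suc j"
    have k: "k - j = Suc m" "real k - real j = real (Suc m)" using True by (auto simp: m_def)
    have n: "real n - real j = real (n - j)" using Suc.prems by simp
    have "real (Suc m) * real ((n - j) choose Suc m) = real (n - j) * real ((n - j - 1) choose m)"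
      by (metis binomial_absorption of_nat_mult)
    then show ?thesis using True nz unfolding k n
      by (simp add: m_def[symmetric] field_simps)
  qed auto
  finally show ?case .
qed simp

text \<open>The discrete approximants have the right factorial moments exactly, for each
  \<open>n\<close>; only the passage from factorial to ordinary moments produces an error.\<close>

lemma sum_falling_ratio_complete_monotone:
  fixes c :: "nat \<Rightarrow> nat \<Rightarrow> real"
  assumes split: "\<And>j k. c j k = c (Suc j) k + c j (Suc k)" and "j \<le> n"
  shows "(\<Sum>k\<le>n. (real (n choose k) * c k (n - k)) * (\<Prod>i<j. (real k - real i) / (real n - real i))) = c j 0"
proof -
  have "(\<Sum>k\<le>n. (real (n choose k) * c k (n - k)) * (\<Prod>i<j. (real k - real i) / (real n - real i)))
     = (\<Sum>k\<le>n. (if j \<le> k then real ((n - j) choose (k - j)) else 0) * c k (n - k))"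
    using assms(2) by (intro sum.cong refl, subst binomial_falling_ratio[symmetric]) auto
  also have "\<dots> = (\<Sum>k\<in>{j..n}. real ((n - j) choose (k - j)) * c k (n - k))"
    by (intro sum.mono_neutral_cong_right) auto
  also have "\<dots> = (\<Sum>k\<le>n - j. real ((n - j) choose k) * c (k + j) (n - j - k + 0))"
    using assms(2)
    by (intro sum.reindex_bij_witness[of _ "\<lambda>k. k + j" "\<lambda>k. k - j"]) auto
  also have "\<dots> = c j 0"
    by (rule binomial_sum_complete_monotone) (rule split)
  finally show ?thesis .
qed

text \<open>Bernstein's construction: mass \<open>(n choose k) * c k (n - k)\<close> is placed at
  \<open>k / n\<close>. Its \<open>j\<close>-th moment differs from \<open>c j 0\<close> by a term
  of order \<open>1 / n\<close>, all approximants live on [0, 1], and any weak limit of a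
  subsequence has the required moments.\<close>

theorem hausdorff_moment_problem:
  fixes c :: "nat \<Rightarrow> nat \<Rightarrow> real"
  assumes nn: "\<And>j k. 0 \<le> c j k" and split: "\<And>j k. c j k = c (Suc j) k + c j (Suc k)"
    and one: "c 0 0 = 1"
  obtains M where "real_distribution M" "AE x in M. 0 \<le> x \<and> x \<le> 1" "\<And>j. (\<integral>x. x ^ j \<partial>M) = c j 0"
proof -
  define w where "w n k = (if k \<le> n then real (n choose k) * c k (n - k) else 0)" for n k
  have w_nn: "0 \<le> w n k" for n k by (simp add: w_def nn)
  have w_sum: "(\<Sum>k\<le>n. w n k) = 1" for n
    proof -
    have "(\<Sum>k\<le>n. real (n choose k) * c (k + 0) (n - k + 0)) = c 0 0"
      by (rule binomial_sum_complete_monotone) (rule split)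
    then show ?thesis by (simp add: w_def one)
  qed
  have w_nn_int: "(\<integral>\<^sup>+k. ennreal (w n k) \<partial>count_space UNIV) = 1" for n
  proof -
    have "(\<integral>\<^sup>+k. ennreal (w n k) \<partial>count_space UNIV) = (\<Sum>k\<le>n. ennreal (w n k))"
      by (rule nn_integral_count_space'[where A = "{..n}"]) (auto simp: w_def)
    also have "\<dots> = ennreal (\<Sum>k\<le>n. w n k)" by (rule sum_ennreal) (simp add: w_nn)
    finally show ?thesis by (simp add: w_sum)
  qed
  define P where "P n = embed_pmf (w n)" for n
  have pmf_P: "pmf (P n) k = w n k" for n k
    unfolding P_def by (rule pmf_embed_pmf[OF w_nn w_nn_int])
  define \<mu> where "\<mu> n = distr (measure_pmf (P n)) borel (\<lambda>k. real k / real n)" for n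
  have rd: "real_distribution (\<mu> n)" for n
    unfolding \<mu>_def by (rule prob_space.real_distribution_distr[OF measure_pmf.prob_space_axioms]) simp
  have set_P: "k \<in> set_pmf (P n) \<Longrightarrow> k \<le> n" for k n
    by (auto simp: set_pmf_iff pmf_P w_def split: if_splits)
  have AE_\<mu>: "AE x in \<mu> n. 0 \<le> x \<and> x \<le> 1" for n
  proof -
    have "AE k in measure_pmf (P n). 0 \<le> real k / real n \<and> real k / real n \<le> 1"
      using set_P[of _ n] by (auto simp: AE_measure_pmf_iff divide_le_eq_1)
    then show ?thesis unfolding \<mu>_def by (subst AE_distr_iff) auto
  qed
  have int_\<mu>: "(\<integral>x. f x \<partial>\<mu> n) = (\<Sum>k\<le>n. f (real k / real n) * w n k)"
    if [measurable]: "f \<in> borel_measurable borel" for f :: "real \<Rightarrow> real" and n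
  proof -
    have "(\<integral>x. f x \<partial>\<mu> n) = (\<integral>k. f (real k / real n) \<partial>measure_pmf (P n))"
      unfolding \<mu>_def by (rule integral_distr) auto
    also have "\<dots> = (\<Sum>k\<le>n. f (real k / real n) * pmf (P n) k)"
      by (rule integral_measure_pmf_real) (auto dest: set_P)
    finally show ?thesis by (simp add: pmf_P)
  qed
  have mom: "(\<lambda>n. \<integral>x. x ^ j \<partial>\<mu> n) \<longlonglongrightarrow> c j 0" for j
  proof -
    \<comment> \<open>For \<open>n \<ge> 2 * j + 1\<close> one has
      \<open>|k - i| \<le> n - i\<close> also when \<open>k < i\<close> and the numerator is
      negative. All factors then have modulus at most one, and two products can be compared factor
      by factor.\<close>
    have bd: "norm ((\<integral>x. x ^ j \<partial>\<mu> n) - c j 0) \<le> real j * (real j / (real n - real j))"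
      if n: "n \<ge> 2 * j + 1" for n
    proof -
      have "(\<integral>x. x ^ j \<partial>\<mu> n) - c j 0 = (\<Sum>k\<le>n. (real k / real n) ^ j * w n k)
         - (\<Sum>k\<le>n. w n k * (\<Prod>i<j. (real k - real i) / (real n - real i)))"
      proof -
        have "(\<Sum>k\<le>n. (real (n choose k) * c k (n - k)) * (\<Prod>i<j. (real k - real i) / (real n - real i))) = c j 0"
          using n by (intro sum_falling_ratio_complete_monotone split) auto
        then show ?thesis by (simp add: int_\<mu> w_def)
      qed
      also have "\<dots> = (\<Sum>k\<le>n. w n k * ((\<Prod>i<j. real k / real n)
             - (\<Prod>i<j. (real k - real i) / (real n - real i))))"
        by (simp add: sum_subtractf[symmetric] algebra_simps)
      also have "norm \<dots> \<le> (\<Sum>k\<le>n. w n k * (\<Sum>i<j. real j / (real n - real j)))"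
      proof (intro sum_norm_le)
        fix k assume k: "k \<in> {..n}"
        have "norm ((\<Prod>i<j. real k / real n) - (\<Prod>i<j. (real k - real i) / (real n - real i)))
            \<le> (\<Sum>i<j. norm (real k / real n - (real k - real i) / (real n - real i)))"
          using k n by (intro norm_prod_diff) (auto simp: divide_le_eq_1)
        also have "\<dots> \<le> (\<Sum>i<j. real j / (real n - real j))"
        proof (rule sum_mono)
          fix i assume i: "i \<in> {..<j}"
          have pos: "real n > 0" "real n - real i > 0" "real n - real j > 0" using i n by auto
          have "real k / real n - (real k - real i) / (real n - real i)
             = (real i / (real n - real i)) * ((real n - real k) / real n)"
            using pos by (simp add: field_simps)
          also have "norm \<dots> \<le> (real i / (real n - real i)) * 1"
            unfolding norm_mult using pos k by (intro mult_mono) auto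
          also have "\<dots> \<le> real j / (real n - real j)"
            using i pos by (auto intro!: frac_le)
          finally show "norm (real k / real n - (real k - real i) / (real n - real i))
             \<le> real j / (real n - real j)" .
        qed
        finally show "norm (w n k * ((\<Prod>i<j. real k / real n)
             - (\<Prod>i<j. (real k - real i) / (real n - real i)))) \<le> w n k * (\<Sum>i<j. real j / (real n - real j))"
          unfolding norm_mult using w_nn[of n k] by (intro mult_mono) auto
      qed
      also have "\<dots> = real j * (real j / (real n - real j))"
        by (simp only: sum_distrib_right[symmetric] w_sum) simp
      finally show ?thesis .
    qed
    have "(\<lambda>n. real j * (real j / (real n - real j))) \<longlonglongrightarrow> 0"
      by real_asymp
    then have "(\<lambda>n. (\<integral>x. x ^ j \<partial>\<mu> n) - c j 0) \<longlonglongrightarrow> 0"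
      by (rule Lim_null_comparison[rotated]) (use bd in \<open>auto simp: eventually_sequentially\<close>)
    then show ?thesis by (simp add: LIM_zero_iff)
  qed
  have "tight \<mu>"
    unfolding tight_def
  proof (intro conjI allI impI)
    fix e :: real assume e: "0 < e"
    \<comment> \<open>Tightness is phrased with half-open intervals, so the left end must lie
      strictly below 0, where an approximant may have an atom.\<close>
    have "1 - e < measure (\<mu> n) {-1<..1}" for n
    proof -
      interpret \<mu>n: real_distribution "\<mu> n" by (rule rd)
      have "AE x in \<mu> n. x \<in> {-1<..1}" using AE_\<mu>[of n] by eventually_elim auto
      then have "measure (\<mu> n) {-1<..1} = 1" by (subst \<mu>n.prob_eq_1) auto
      with e show ?thesis by simp
    qed
    then show "\<exists>a b. a < b \<and> (\<forall>n. 1 - e < measure (\<mu> n) {a<..b})"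
      by (intro exI[of _ "-1"] exI[of _ 1]) auto
  qed (rule rd)
  then obtain r M where r: "strict_mono (r :: nat \<Rightarrow> nat)" and M: "real_distribution M"
    and conv: "weak_conv_m (\<mu> \<circ> id \<circ> r) M"
    using tight_imp_convergent_subsubsequence[of \<mu> id] by (auto simp: strict_mono_id)
  interpret M: real_distribution M by (rule M)
  have lim: "(\<lambda>n. \<integral>x. f x \<partial>\<mu> (r n)) \<longlonglongrightarrow> (\<integral>x. f x \<partial>M)"
    if "\<And>x. isCont f x" "\<And>x. norm (f x) \<le> B" for f :: "real \<Rightarrow> real" and B
    using weak_conv_imp_integral_bdd_continuous_conv[of "\<mu> \<circ> id \<circ> r" M f B] conv rd M that by simp
  have AE_M: "AE x in M. 0 \<le> x \<and> x \<le> 1"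
  proof -
    \<comment> \<open>Weak convergence only tests bounded continuous functions; this one is
      nonnegative and vanishes exactly on [0, 1].\<close>
    define f :: "real \<Rightarrow> real" where "f = (\<lambda>x. min 1 (max (- x) (max 0 (x - 1))))"
    have "(\<integral>x. f x \<partial>\<mu> n) = 0" for n
    proof -
      have "(\<integral>x. f x \<partial>\<mu> n) = (\<integral>x. 0 \<partial>\<mu> n)"
      proof (rule integral_cong_AE)
        show "AE x in \<mu> n. f x = 0" using AE_\<mu>[of n] by eventually_elim (auto simp: f_def)
      qed (auto simp: f_def \<mu>_def)
      then show ?thesis by simp
    qed
    moreover have "(\<lambda>n. \<integral>x. f x \<partial>\<mu> (r n)) \<longlonglongrightarrow> (\<integral>x. f x \<partial>M)"
      by (rule lim[of f 1]) (auto simp: f_def intro!: continuous_intros)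
    ultimately have "(\<integral>x. f x \<partial>M) = 0" by (simp add: LIMSEQ_const_iff)
    moreover have "integrable M f"
      by (rule M.integrable_const_bound[where B = 1]) (auto simp: f_def)
    ultimately have "AE x in M. f x = 0"
      by (subst (asm) integral_nonneg_eq_0_iff_AE) (auto simp: f_def)
    then show ?thesis by eventually_elim (auto simp: f_def min_def max_def split: if_splits)
  qed
  have "(\<integral>x. x ^ j \<partial>M) = c j 0" for j
  proof -
    \<comment> \<open>Clamping the argument makes the power a bounded test function and changes
      nothing almost everywhere.\<close>
    define f :: "real \<Rightarrow> real" where "f = (\<lambda>x. (max 0 (min 1 x)) ^ j)"
    have "(\<lambda>n. \<integral>x. f x \<partial>\<mu> (r n)) \<longlonglongrightarrow> (\<integral>x. f x \<partial>M)"
      by (rule lim[of f 1])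
        (auto simp: f_def power_le_one_iff norm_power intro!: continuous_intros power_le_one)
    moreover have "(\<integral>x. f x \<partial>\<mu> n) = (\<integral>x. x ^ j \<partial>\<mu> n)" for n
    proof (rule integral_cong_AE)
      show "AE x in \<mu> n. f x = x ^ j" using AE_\<mu>[of n] by eventually_elim (auto simp: f_def)
    qed (auto simp: f_def \<mu>_def)
    moreover have "(\<integral>x. f x \<partial>M) = (\<integral>x. x ^ j \<partial>M)"
    proof (rule integral_cong_AE)
      show "AE x in M. f x = x ^ j" using AE_M by eventually_elim (auto simp: f_def)
    qed (auto simp: f_def)
    ultimately have "(\<lambda>n. \<integral>x. x ^ j \<partial>\<mu> (r n)) \<longlonglongrightarrow> (\<integral>x. x ^ j \<partial>M)" by simp
    moreover have "(\<lambda>n. \<integral>x. x ^ j \<partial>\<mu> (r n)) \<longlonglongrightarrow> c j 0"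
      using LIMSEQ_subseq_LIMSEQ[OF mom r] by (simp add: o_def)
    ultimately show ?thesis by (rule LIMSEQ_unique)
  qed
  with M AE_M that show thesis by blast
qed

section \<open>The sequence space\<close>

lemma ell2_summable: "x \<in> ell2 \<Longrightarrow> summable (\<lambda>n. (cmod (x n))\<^sup>2)"
  by (simp add: ell2_def)

lemma ell2_norm_nonneg: "x \<in> ell2 \<Longrightarrow> 0 \<le> ell2_norm x"
  by (simp add: ell2_norm_def suminf_nonneg ell2_summable)

lemma ell2_norm_sq: "x \<in> ell2 \<Longrightarrow> (ell2_norm x)\<^sup>2 = (\<Sum>n. (cmod (x n))\<^sup>2)"
  by (simp add: ell2_norm_def ell2_summable suminf_nonneg)

lemma ell2_partial_sum_le: "x \<in> ell2 \<Longrightarrow> finite I \<Longrightarrow> (\<Sum>n\<in>I. (cmod (x n))\<^sup>2) \<le> (ell2_norm x)\<^sup>2"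
  by (simp add: ell2_norm_sq sum_le_suminf ell2_summable)

lemma ell2_L2_set_le: "x \<in> ell2 \<Longrightarrow> finite I \<Longrightarrow> L2_set (\<lambda>n. cmod (x n)) I \<le> ell2_norm x"
  unfolding L2_set_def using ell2_partial_sum_le[of x I] ell2_norm_nonneg[of x]
  by (simp add: real_le_lsqrt sum_nonneg)

lemma ell2_coord_le: "x \<in> ell2 \<Longrightarrow> cmod (x n) \<le> ell2_norm x"
  by (rule power2_le_imp_le) (use ell2_partial_sum_le[of x "{n}"] ell2_norm_nonneg[of x] in auto)

lemma ell2I_bounded:
  assumes "\<And>N. (\<Sum>n<N. (cmod (x n))\<^sup>2) \<le> B\<^sup>2" "0 \<le> B"
  shows "x \<in> ell2" "ell2_norm x \<le> B"
proof -
  show x: "x \<in> ell2"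
    unfolding ell2_def mem_Collect_eq by (rule summableI_nonneg_bounded[of _ "B\<^sup>2"]) (use assms in auto)
  have "(\<Sum>n. (cmod (x n))\<^sup>2) \<le> B\<^sup>2"
    by (rule suminf_le_const[OF ell2_summable[OF x]]) (rule assms)
  then show "ell2_norm x \<le> B"
    unfolding ell2_norm_def using assms(2) by (simp add: real_le_lsqrt suminf_nonneg ell2_summable[OF x])
qed

lemma ell2_add:
  assumes "x \<in> ell2" "y \<in> ell2"
  shows "(\<lambda>n. x n + y n) \<in> ell2" "ell2_norm (\<lambda>n. x n + y n) \<le> ell2_norm x + ell2_norm y"
proof -
  have *: "(\<Sum>n<N. (cmod (x n + y n))\<^sup>2) \<le> (ell2_norm x + ell2_norm y)\<^sup>2" for N
  proof -
    have "L2_set (\<lambda>n. cmod (x n + y n)) {..<N} \<le> L2_set (\<lambda>n. cmod (x n) + cmod (y n)) {..<N}"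
      by (rule L2_set_mono) (auto intro: norm_triangle_ineq)
    also have "\<dots> \<le> L2_set (\<lambda>n. cmod (x n)) {..<N} + L2_set (\<lambda>n. cmod (y n)) {..<N}"
      by (rule L2_set_triangle_ineq)
    also have "\<dots> \<le> ell2_norm x + ell2_norm y"
      using assms by (intro add_mono ell2_L2_set_le) auto
    finally show ?thesis
      unfolding L2_set_def by (rule sqrt_le_D)
  qed
  show "(\<lambda>n. x n + y n) \<in> ell2" "ell2_norm (\<lambda>n. x n + y n) \<le> ell2_norm x + ell2_norm y"
    using ell2I_bounded[OF *] ell2_norm_nonneg[OF assms(1)] ell2_norm_nonneg[OF assms(2)] by auto
qed

lemma ell2_scale:
  assumes "x \<in> ell2"
  shows "(\<lambda>n. c * x n) \<in> ell2" "ell2_norm (\<lambda>n. c * x n) = cmod c * ell2_norm x"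
proof -
  show "(\<lambda>n. c * x n) \<in> ell2"
    using ell2_summable[OF assms] by (auto simp: ell2_def norm_mult power_mult_distrib intro: summable_mult)
  have "(\<Sum>n. (cmod (c * x n))\<^sup>2) = (cmod c)\<^sup>2 * (\<Sum>n. (cmod (x n))\<^sup>2)"
    by (simp add: norm_mult power_mult_distrib suminf_mult ell2_summable[OF assms])
  then show "ell2_norm (\<lambda>n. c * x n) = cmod c * ell2_norm x"
    by (simp add: ell2_norm_def real_sqrt_mult)
qed

lemma ell2_uminus: "x \<in> ell2 \<Longrightarrow> (\<lambda>n. - x n) \<in> ell2" "x \<in> ell2 \<Longrightarrow> ell2_norm (\<lambda>n. - x n) = ell2_norm x"
  using ell2_scale[of x "-1"] by auto

lemma ell2_diff:
  assumes "x \<in> ell2" "y \<in> ell2"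
  shows "(\<lambda>n. x n - y n) \<in> ell2" "ell2_norm (\<lambda>n. x n - y n) \<le> ell2_norm x + ell2_norm y"
  using ell2_add[OF assms(1) ell2_uminus(1)[OF assms(2)]] ell2_uminus(2)[OF assms(2)] by auto

lemma ell2_finite_support:
  assumes "\<And>n. N \<le> n \<Longrightarrow> x n = 0"
  shows "x \<in> ell2"
  unfolding ell2_def mem_Collect_eq by (rule summable_finite[of "{..<N}"]) (use assms in \<open>auto simp: not_less\<close>)

lemma ell2_unit: "ell2_unit k \<in> ell2"
  by (rule ell2_finite_support[of "Suc k"]) (auto simp: ell2_unit_def)

lemma ell2_zero: "(\<lambda>n. 0) \<in> ell2" "ell2_norm (\<lambda>n. 0) = 0"
  by (auto simp: ell2_def ell2_norm_def)

lemma ell2_norm_eq_0: "x \<in> ell2 \<Longrightarrow> ell2_norm x = 0 \<Longrightarrow> x = (\<lambda>n. 0)"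
  using ell2_coord_le[of x] by (auto simp: fun_eq_iff)

lemma ell2_cauchy_schwarz_sum:
  assumes "x \<in> ell2" "y \<in> ell2" "finite I"
  shows "(\<Sum>n\<in>I. cmod (x n * cnj (y n))) \<le> ell2_norm x * ell2_norm y"
proof -
  have "(\<Sum>n\<in>I. cmod (x n * cnj (y n))) = (\<Sum>n\<in>I. \<bar>cmod (x n)\<bar> * \<bar>cmod (y n)\<bar>)"
    by (simp add: norm_mult)
  also have "\<dots> \<le> L2_set (\<lambda>n. cmod (x n)) I * L2_set (\<lambda>n. cmod (y n)) I"
    by (rule L2_set_mult_ineq)
  also have "\<dots> \<le> ell2_norm x * ell2_norm y"
    using assms by (intro mult_mono ell2_L2_set_le) (auto simp: L2_set_nonneg ell2_norm_nonneg)
  finally show ?thesis .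
qed

lemma ell2_inner_abs_summable:
  assumes "x \<in> ell2" "y \<in> ell2"
  shows "summable (\<lambda>n. cmod (x n * cnj (y n)))"
  by (rule summableI_nonneg_bounded[of _ "ell2_norm x * ell2_norm y"])
    (use ell2_cauchy_schwarz_sum[OF assms] in auto)

lemma ell2_inner_summable: "x \<in> ell2 \<Longrightarrow> y \<in> ell2 \<Longrightarrow> summable (\<lambda>n. x n * cnj (y n))"
  by (rule summable_norm_cancel[OF ell2_inner_abs_summable])

lemma ell2_cauchy_schwarz:
  assumes "x \<in> ell2" "y \<in> ell2"
  shows "cmod (ell2_inner x y) \<le> ell2_norm x * ell2_norm y"
proof -
  have "cmod (ell2_inner x y) \<le> (\<Sum>n. cmod (x n * cnj (y n)))"
    unfolding ell2_inner_def by (rule summable_norm[OF ell2_inner_abs_summable[OF assms]])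
  also have "\<dots> \<le> ell2_norm x * ell2_norm y"
    by (rule suminf_le_const[OF ell2_inner_abs_summable[OF assms]])
      (use ell2_cauchy_schwarz_sum[OF assms] in auto)
  finally show ?thesis .
qed

lemma ell2_inner_add_left:
  "x \<in> ell2 \<Longrightarrow> y \<in> ell2 \<Longrightarrow> z \<in> ell2 \<Longrightarrow> ell2_inner (\<lambda>n. x n + y n) z = ell2_inner x z + ell2_inner y z"
  unfolding ell2_inner_def by (subst suminf_add) (auto simp: ell2_inner_summable algebra_simps)

lemma ell2_inner_add_right:
  "x \<in> ell2 \<Longrightarrow> y \<in> ell2 \<Longrightarrow> z \<in> ell2 \<Longrightarrow> ell2_inner z (\<lambda>n. x n + y n) = ell2_inner z x + ell2_inner z y"
  unfolding ell2_inner_def by (subst suminf_add) (auto simp: ell2_inner_summable algebra_simps)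

lemma ell2_inner_diff_left:
  "x \<in> ell2 \<Longrightarrow> y \<in> ell2 \<Longrightarrow> z \<in> ell2 \<Longrightarrow> ell2_inner (\<lambda>n. x n - y n) z = ell2_inner x z - ell2_inner y z"
  unfolding ell2_inner_def by (subst suminf_diff) (auto simp: ell2_inner_summable algebra_simps)

lemma ell2_inner_diff_right:
  "x \<in> ell2 \<Longrightarrow> y \<in> ell2 \<Longrightarrow> z \<in> ell2 \<Longrightarrow> ell2_inner z (\<lambda>n. x n - y n) = ell2_inner z x - ell2_inner z y"
  unfolding ell2_inner_def by (subst suminf_diff) (auto simp: ell2_inner_summable algebra_simps)

lemma ell2_inner_scale_left:
  "x \<in> ell2 \<Longrightarrow> y \<in> ell2 \<Longrightarrow> ell2_inner (\<lambda>n. c * x n) y = c * ell2_inner x y"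
  unfolding ell2_inner_def by (simp add: suminf_mult[OF ell2_inner_summable, symmetric] mult.assoc)

lemma ell2_inner_scale_right:
  "x \<in> ell2 \<Longrightarrow> y \<in> ell2 \<Longrightarrow> ell2_inner x (\<lambda>n. c * y n) = cnj c * ell2_inner x y"
  unfolding ell2_inner_def by (simp add: suminf_mult[OF ell2_inner_summable, symmetric] algebra_simps)

lemma ell2_inner_cnj:
  assumes "x \<in> ell2" "y \<in> ell2"
  shows "cnj (ell2_inner x y) = ell2_inner y x"
proof -
  have "(\<lambda>n. x n * cnj (y n)) sums ell2_inner x y"
    unfolding ell2_inner_def by (rule summable_sums[OF ell2_inner_summable[OF assms]])
  then have "(\<lambda>n. cnj (x n * cnj (y n))) sums cnj (ell2_inner x y)"
    by (subst sums_cnj)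
  then show ?thesis by (simp add: ell2_inner_def sums_iff mult.commute)
qed

lemma ell2_inner_self:
  assumes "x \<in> ell2"
  shows "ell2_inner x x = complex_of_real ((ell2_norm x)\<^sup>2)"
  unfolding ell2_norm_sq[OF assms] suminf_of_real[OF ell2_summable[OF assms]]
  by (simp add: ell2_inner_def complex_norm_square[symmetric])

lemma ell2_norm_add_sq:
  assumes "x \<in> ell2" "y \<in> ell2"
  shows "(ell2_norm (\<lambda>n. x n + y n))\<^sup>2 = (ell2_norm x)\<^sup>2 + 2 * Re (ell2_inner x y) + (ell2_norm y)\<^sup>2"
proof -
  have "complex_of_real ((ell2_norm (\<lambda>n. x n + y n))\<^sup>2) =
      ell2_inner x x + ell2_inner x y + (cnj (ell2_inner x y) + ell2_inner y y)"
    using assms by (simp add: ell2_inner_self[symmetric] ell2_add ell2_inner_add_left ell2_inner_add_right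
       ell2_inner_cnj del: of_real_power)
  from arg_cong[OF this, of Re] show ?thesis
    using assms by (simp add: ell2_inner_self)
qed

lemma ell2_inner_unit_right: "ell2_inner x (ell2_unit k) = x k"
proof -
  have "ell2_inner x (ell2_unit k) = (\<Sum>n\<in>{k}. x n * cnj (ell2_unit k n))"
    unfolding ell2_inner_def by (rule suminf_finite) (auto simp: ell2_unit_def)
  then show ?thesis by (simp add: ell2_unit_def)
qed

lemma ell2_inner_unit_left: "ell2_inner (ell2_unit k) x = cnj (x k)"
proof -
  have "ell2_inner (ell2_unit k) x = (\<Sum>n\<in>{k}. ell2_unit k n * cnj (x n))"
    unfolding ell2_inner_def by (rule suminf_finite) (auto simp: ell2_unit_def)
  then show ?thesis by (simp add: ell2_unit_def)
qed

lemma ell2_norm_unit: "ell2_norm (ell2_unit k) = 1"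
proof -
  have "complex_of_real ((ell2_norm (ell2_unit k))\<^sup>2) = 1"
    by (simp add: ell2_inner_self[OF ell2_unit, symmetric] ell2_inner_unit_right del: of_real_power)
       (simp add: ell2_unit_def)
  then have "(ell2_norm (ell2_unit k))\<^sup>2 = 1" by (simp only: of_real_eq_1_iff)
  then show ?thesis using ell2_norm_nonneg[OF ell2_unit[of k]] by (simp add: power2_eq_1_iff)
qed

text \<open>Truncations serve as the dense subspace throughout: a linear operator maps a truncation
  to a finite combination of its columns, and continuity does the rest.\<close>

definition ell2_trunc :: "nat \<Rightarrow> (nat \<Rightarrow> complex) \<Rightarrow> nat \<Rightarrow> complex" where
  "ell2_trunc N x = (\<lambda>n. if n < N then x n else 0)"

lemma ell2_trunc: "ell2_trunc N x \<in> ell2"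
  by (rule ell2_finite_support[of N]) (auto simp: ell2_trunc_def)

lemma ell2_trunc_tendsto:
  assumes "x \<in> ell2"
  shows "(\<lambda>N. ell2_norm (\<lambda>n. x n - ell2_trunc N x n)) \<longlonglongrightarrow> 0"
proof -
  let ?f = "\<lambda>n. (cmod (x n))\<^sup>2"
  note s = ell2_summable[OF assms]
  have "(\<lambda>N. \<Sum>n. ?f (n + N)) \<longlonglongrightarrow> 0"
    using suminf_exist_split2[OF s] by simp
  moreover have "(\<Sum>n. ?f (n + N)) = (\<Sum>n. (cmod (x n - ell2_trunc N x n))\<^sup>2)" for N
  proof -
    have "summable (\<lambda>n. (cmod (x n - ell2_trunc N x n))\<^sup>2)"
      using ell2_diff(1)[OF assms ell2_trunc] by (rule ell2_summable)
    from suminf_split_initial_segment[OF this, of N]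
    show ?thesis by (simp add: ell2_trunc_def)
  qed
  ultimately have "(\<lambda>N. sqrt (\<Sum>n. (cmod (x n - ell2_trunc N x n))\<^sup>2)) \<longlonglongrightarrow> sqrt 0"
    by (intro tendsto_real_sqrt) simp
  then show ?thesis by (simp add: ell2_norm_def)
qed

lemma ell2_norm_trunc_le: "x \<in> ell2 \<Longrightarrow> ell2_norm (ell2_trunc N x) \<le> ell2_norm x"
proof (rule ell2I_bounded)
  fix M assume x: "x \<in> ell2"
  have "(\<Sum>n<M. (cmod (ell2_trunc N x n))\<^sup>2) \<le> (\<Sum>n<M. (cmod (x n))\<^sup>2)"
    by (rule sum_mono) (auto simp: ell2_trunc_def)
  also have "\<dots> \<le> (ell2_norm x)\<^sup>2" by (rule ell2_partial_sum_le[OF x]) simp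
  finally show "(\<Sum>n<M. (cmod (ell2_trunc N x n))\<^sup>2) \<le> (ell2_norm x)\<^sup>2" .
qed (use ell2_norm_nonneg in blast)

lemma ell2_bounded_operatorD:
  assumes "ell2_bounded_operator A" "x \<in> ell2"
  shows "A x \<in> ell2" "y \<in> ell2 \<Longrightarrow> A (\<lambda>n. x n + y n) = (\<lambda>n. A x n + A y n)"
    "A (\<lambda>n. c * x n) = (\<lambda>n. c * A x n)" "y \<in> ell2 \<Longrightarrow> A (\<lambda>n. x n - y n) = (\<lambda>n. A x n - A y n)"
    "A (\<lambda>n. 0) = (\<lambda>n. 0)"
proof -
  have add: "\<And>x y. x \<in> ell2 \<Longrightarrow> y \<in> ell2 \<Longrightarrow> A (\<lambda>n. x n + y n) = (\<lambda>n. A x n + A y n)"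
    and sc: "\<And>x c. x \<in> ell2 \<Longrightarrow> A (\<lambda>n. c * x n) = (\<lambda>n. c * A x n)"
    using assms unfolding ell2_bounded_operator_def by auto
  show "A x \<in> ell2" "y \<in> ell2 \<Longrightarrow> A (\<lambda>n. x n + y n) = (\<lambda>n. A x n + A y n)"
    "A (\<lambda>n. c * x n) = (\<lambda>n. c * A x n)"
    using assms add sc unfolding ell2_bounded_operator_def by auto
  show "A (\<lambda>n. x n - y n) = (\<lambda>n. A x n - A y n)" if "y \<in> ell2"
    using add[OF assms(2) ell2_uminus(1)[OF that]] sc[OF that, of "-1"] by simp
  show "A (\<lambda>n. 0) = (\<lambda>n. 0)" using sc[OF assms(2), of 0] by simp
qed

lemma ell2_bounded_operator_bound:
  assumes "ell2_bounded_operator A"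
  obtains C where "C \<ge> 0" "\<And>x. x \<in> ell2 \<Longrightarrow> ell2_norm (A x) \<le> C * ell2_norm x"
proof -
  obtain C where C: "\<And>x. x \<in> ell2 \<Longrightarrow> ell2_norm (A x) \<le> C * ell2_norm x"
    using assms unfolding ell2_bounded_operator_def by blast
  show thesis
  proof (rule that[of "\<bar>C\<bar>"])
    fix x :: "nat \<Rightarrow> complex" assume "x \<in> ell2"
    then show "ell2_norm (A x) \<le> \<bar>C\<bar> * ell2_norm x"
      using C[of x] mult_right_mono[of C "\<bar>C\<bar>" "ell2_norm x"] ell2_norm_nonneg[of x]
      by (meson abs_ge_self order_trans)
  qed simp
qed

lemma ell2_bounded_operator_trunc:
  assumes "ell2_bounded_operator A"
  shows "A (ell2_trunc N x) = (\<lambda>i. \<Sum>k<N. x k * A (ell2_unit k) i)"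
proof (induction N)
  case 0
  have "ell2_trunc 0 x = (\<lambda>n. 0)" by (auto simp: ell2_trunc_def)
  then show ?case using ell2_bounded_operatorD(5)[OF assms ell2_zero(1)] by simp
next
  case (Suc N)
  have "ell2_trunc (Suc N) x = (\<lambda>n. ell2_trunc N x n + x N * ell2_unit N n)"
    by (auto simp: ell2_trunc_def ell2_unit_def fun_eq_iff less_Suc_eq)
  then show ?case
    using Suc ell2_bounded_operatorD(2)[OF assms ell2_trunc[of N x] ell2_scale(1)[OF ell2_unit[of N], of "x N"]]
      ell2_bounded_operatorD(3)[OF assms ell2_unit[of N], of "x N"] by simp
qed

lemma ell2_operator_tendsto:
  assumes A: "ell2_bounded_operator A" and x: "x \<in> ell2" "\<And>N. X N \<in> ell2"
    and lim: "((\<lambda>N. ell2_norm (\<lambda>n. x n - X N n)) \<longlongrightarrow> 0) F"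
  shows "((\<lambda>N. ell2_norm (\<lambda>n. A x n - A (X N) n)) \<longlongrightarrow> 0) F"
proof -
  obtain C where C: "C \<ge> 0" "\<And>x. x \<in> ell2 \<Longrightarrow> ell2_norm (A x) \<le> C * ell2_norm x"
    using ell2_bounded_operator_bound[OF A] by blast
  have "((\<lambda>N. C * ell2_norm (\<lambda>n. x n - X N n)) \<longlongrightarrow> C * 0) F"
    by (intro tendsto_mult_left lim)
  then have lim': "((\<lambda>N. C * ell2_norm (\<lambda>n. x n - X N n)) \<longlongrightarrow> 0) F" by simp
  show ?thesis
  proof (rule Lim_null_comparison[OF _ lim'], rule always_eventually, rule allI)
    fix N
    have "(\<lambda>n. A x n - A (X N) n) = A (\<lambda>n. x n - X N n)"
      using ell2_bounded_operatorD(4)[OF A x(1) x(2)[of N]] by simp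
    then show "norm (ell2_norm (\<lambda>n. A x n - A (X N) n)) \<le> C * ell2_norm (\<lambda>n. x n - X N n)"
      using C(2)[OF ell2_diff(1)[OF x(1) x(2)[of N]]] by (simp add: ell2_norm_nonneg ell2_diff x ell2_bounded_operatorD(1)[OF A])
  qed
qed

lemma ell2_tendsto_coord:
  assumes "x \<in> ell2" "\<And>N. X N \<in> ell2" "((\<lambda>N. ell2_norm (\<lambda>n. x n - X N n)) \<longlongrightarrow> 0) F"
  shows "((\<lambda>N. X N n) \<longlongrightarrow> x n) F"
proof -
  have "((\<lambda>N. x n - X N n) \<longlongrightarrow> 0) F"
    by (rule Lim_null_comparison[OF _ assms(3)], rule always_eventually)
      (use ell2_coord_le[OF ell2_diff(1)[OF assms(1,2)]] in auto)
  from tendsto_diff[OF tendsto_const[of "x n"] this] show ?thesis by simp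
qed

lemma ell2_inner_tendsto:
  assumes "x \<in> ell2" "\<And>N. X N \<in> ell2" "((\<lambda>N. ell2_norm (\<lambda>n. x n - X N n)) \<longlongrightarrow> 0) F" "y \<in> ell2"
  shows "((\<lambda>N. ell2_inner (X N) y) \<longlongrightarrow> ell2_inner x y) F"
proof -
  have lim: "((\<lambda>N. ell2_norm (\<lambda>n. x n - X N n) * ell2_norm y) \<longlongrightarrow> 0) F"
    using tendsto_mult_right[OF assms(3), of "ell2_norm y"] by simp
  have "((\<lambda>N. ell2_inner x y - ell2_inner (X N) y) \<longlongrightarrow> 0) F"
  proof (rule Lim_null_comparison[OF _ lim], rule always_eventually, rule allI)
    fix N
    show "norm (ell2_inner x y - ell2_inner (X N) y) \<le> ell2_norm (\<lambda>n. x n - X N n) * ell2_norm y"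
      using ell2_cauchy_schwarz[OF ell2_diff(1)[OF assms(1,2)] assms(4)]
        ell2_inner_diff_left[OF assms(1,2,4)] by simp
  qed
  from tendsto_diff[OF tendsto_const[of "ell2_inner x y"] this] show ?thesis by simp
qed

text \<open>Matrix entries decide adjointness. For a unit vector on the left the right argument is
  approximated by truncations; with this known for every \<open>y\<close>, the left argument is
  approximated in turn.\<close>

lemma ell2_operator_inner_ext:
  assumes A: "ell2_bounded_operator A" and B: "ell2_bounded_operator B"
    and eq: "\<And>j k. A (ell2_unit j) k = cnj (B (ell2_unit k) j)"
    and x: "x \<in> ell2" and y: "y \<in> ell2"
  shows "ell2_inner (A x) y = ell2_inner x (B y)"
proof -
  have unit_left: "ell2_inner (A (ell2_unit j)) y = ell2_inner (ell2_unit j) (B y)" if "y \<in> ell2" for j y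
  proof -
    have 1: "(\<lambda>N. ell2_inner (ell2_trunc N y) (A (ell2_unit j))) \<longlonglongrightarrow> ell2_inner y (A (ell2_unit j))"
      by (rule ell2_inner_tendsto[OF that ell2_trunc ell2_trunc_tendsto[OF that]
          ell2_bounded_operatorD(1)[OF A ell2_unit]])
    have 2: "(\<lambda>N. ell2_inner (B (ell2_trunc N y)) (ell2_unit j)) \<longlonglongrightarrow> ell2_inner (B y) (ell2_unit j)"
      by (rule ell2_inner_tendsto[OF ell2_bounded_operatorD(1)[OF B that] ell2_bounded_operatorD(1)[OF B ell2_trunc]
          ell2_operator_tendsto[OF B that ell2_trunc ell2_trunc_tendsto[OF that]] ell2_unit])
    have "ell2_inner (ell2_trunc N y) (A (ell2_unit j)) = ell2_inner (B (ell2_trunc N y)) (ell2_unit j)" for N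
    proof -
      have "ell2_inner (ell2_trunc N y) (A (ell2_unit j)) = (\<Sum>n<N. y n * cnj (A (ell2_unit j) n))"
        unfolding ell2_inner_def
        by (subst suminf_finite[of "{..<N}"]) (auto simp: ell2_trunc_def)
      then show ?thesis
        by (simp add: ell2_inner_unit_right ell2_bounded_operator_trunc[OF B] eq)
    qed
    with 1 2 have "ell2_inner y (A (ell2_unit j)) = ell2_inner (B y) (ell2_unit j)"
      by (simp add: LIMSEQ_unique)
    from arg_cong[OF this, of cnj] show ?thesis
      using that by (simp add: ell2_inner_cnj ell2_unit ell2_bounded_operatorD(1)[OF A] ell2_bounded_operatorD(1)[OF B])
  qed
  have 1: "(\<lambda>N. ell2_inner (ell2_trunc N x) (B y)) \<longlonglongrightarrow> ell2_inner x (B y)"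
    by (rule ell2_inner_tendsto[OF x ell2_trunc ell2_trunc_tendsto[OF x] ell2_bounded_operatorD(1)[OF B y]])
  have 2: "(\<lambda>N. ell2_inner (A (ell2_trunc N x)) y) \<longlonglongrightarrow> ell2_inner (A x) y"
    by (rule ell2_inner_tendsto[OF ell2_bounded_operatorD(1)[OF A x] ell2_bounded_operatorD(1)[OF A ell2_trunc]
          ell2_operator_tendsto[OF A x ell2_trunc ell2_trunc_tendsto[OF x]] y])
  have "ell2_inner (A (ell2_trunc N x)) y = ell2_inner (ell2_trunc N x) (B y)" for N
  proof (induction N)
    case 0
    have "ell2_trunc 0 x = (\<lambda>n. 0)" by (auto simp: ell2_trunc_def)
    then show ?case using ell2_bounded_operatorD(5)[OF A ell2_zero(1)] by (simp add: ell2_inner_def)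
  next
    case (Suc N)
    have t: "ell2_trunc (Suc N) x = (\<lambda>n. ell2_trunc N x n + x N * ell2_unit N n)"
      by (auto simp: ell2_trunc_def ell2_unit_def fun_eq_iff less_Suc_eq)
    have "A (ell2_trunc (Suc N) x) = (\<lambda>n. A (ell2_trunc N x) n + x N * A (ell2_unit N) n)"
      unfolding t ell2_bounded_operatorD(2)[OF A ell2_trunc ell2_scale(1)[OF ell2_unit]]
        ell2_bounded_operatorD(3)[OF A ell2_unit] ..
    then show ?case
      unfolding t using y Suc unit_left[OF y, of N]
      by (simp add: ell2_inner_add_left ell2_inner_scale_left ell2_trunc ell2_unit ell2_scale
          ell2_bounded_operatorD(1)[OF A] ell2_bounded_operatorD(1)[OF B])
  qed
  with 1 2 show ?thesis by (simp add: LIMSEQ_unique)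
qed

lemma ell2_operator_eqI:
  assumes A: "ell2_bounded_operator A" and B: "ell2_bounded_operator B"
    and eq: "\<And>k. A (ell2_unit k) = B (ell2_unit k)" and x: "x \<in> ell2"
  shows "A x = B x"
proof
  fix n
  have lim: "(\<lambda>N. C (ell2_trunc N x) n) \<longlonglongrightarrow> C x n" if C: "ell2_bounded_operator C" for C
    by (rule ell2_tendsto_coord[OF ell2_bounded_operatorD(1)[OF C x] ell2_bounded_operatorD(1)[OF C ell2_trunc]
          ell2_operator_tendsto[OF C x ell2_trunc ell2_trunc_tendsto[OF x]]])
  have "A (ell2_trunc N x) = B (ell2_trunc N x)" for N
    by (simp add: ell2_bounded_operator_trunc[OF A] ell2_bounded_operator_trunc[OF B] eq)
  then show "A x n = B x n" using lim[OF A] lim[OF B] by (simp add: LIMSEQ_unique)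
qed

lemma ell2_bounded_operator_compose:
  assumes "ell2_bounded_operator A" "ell2_bounded_operator B"
  shows "ell2_bounded_operator (\<lambda>x. A (B x))"
proof -
  obtain C where C: "C \<ge> 0" "\<And>x. x \<in> ell2 \<Longrightarrow> ell2_norm (A x) \<le> C * ell2_norm x"
    using ell2_bounded_operator_bound[OF assms(1)] by blast
  obtain D where D: "D \<ge> 0" "\<And>x. x \<in> ell2 \<Longrightarrow> ell2_norm (B x) \<le> D * ell2_norm x"
    using ell2_bounded_operator_bound[OF assms(2)] by blast
  note [simp] = ell2_bounded_operatorD[OF assms(1)] ell2_bounded_operatorD[OF assms(2)]
  have "ell2_norm (A (B x)) \<le> C * D * ell2_norm x" if "x \<in> ell2" for x
  proof -
    have "ell2_norm (A (B x)) \<le> C * ell2_norm (B x)" using that by (intro C) simp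
    also have "\<dots> \<le> C * (D * ell2_norm x)" using that C(1) D by (intro mult_left_mono) auto
    finally show ?thesis by (simp add: mult.assoc)
  qed
  then show ?thesis unfolding ell2_bounded_operator_def by auto
qed

section \<open>Uniqueness of the spectral measure\<close>

locale ell2_resolution =
  fixes E :: "real \<Rightarrow> (nat \<Rightarrow> complex) \<Rightarrow> nat \<Rightarrow> complex"
  assumes res: "resolution_of_identity E"
begin

lemma bounded_op: "ell2_bounded_operator (E l)"
  and sym: "x \<in> ell2 \<Longrightarrow> y \<in> ell2 \<Longrightarrow> ell2_inner (E l x) y = ell2_inner x (E l y)"
  and idem: "x \<in> ell2 \<Longrightarrow> E l (E l x) = E l x"
  and min: "x \<in> ell2 \<Longrightarrow> E l (E m x) = E (min l m) x"
  using res unfolding resolution_of_identity_def ell2_orthogonal_projection_def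
    ell2_bounded_selfadjoint_def by blast+

lemma right_cont: "x \<in> ell2 \<Longrightarrow> ((\<lambda>l. ell2_norm (\<lambda>n. E l x n - E m x n)) \<longlongrightarrow> 0) (at_right m)"
  and at_bot: "x \<in> ell2 \<Longrightarrow> ((\<lambda>l. ell2_norm (E l x)) \<longlongrightarrow> 0) at_bot"
  and at_top: "x \<in> ell2 \<Longrightarrow> ((\<lambda>l. ell2_norm (\<lambda>n. E l x n - x n)) \<longlongrightarrow> 0) at_top"
  using res unfolding resolution_of_identity_def by blast+

lemma in_ell2 [simp]: "x \<in> ell2 \<Longrightarrow> E l x \<in> ell2"
  using ell2_bounded_operatorD(1)[OF bounded_op] .

lemma op_add: "x \<in> ell2 \<Longrightarrow> y \<in> ell2 \<Longrightarrow> E l (\<lambda>n. x n + y n) = (\<lambda>n. E l x n + E l y n)"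
  and op_diff: "x \<in> ell2 \<Longrightarrow> y \<in> ell2 \<Longrightarrow> E l (\<lambda>n. x n - y n) = (\<lambda>n. E l x n - E l y n)"
  and op_scale: "x \<in> ell2 \<Longrightarrow> E l (\<lambda>n. c * x n) = (\<lambda>n. c * E l x n)"
  using ell2_bounded_operatorD[OF bounded_op] by blast+

definition F where "F x l = Re (ell2_inner (E l x) x)"

lemma inner_eq: "x \<in> ell2 \<Longrightarrow> ell2_inner (E l x) x = complex_of_real ((ell2_norm (E l x))\<^sup>2)"
  using sym[of "E l x" x l] idem[of x l] by (simp add: ell2_inner_self del: of_real_power)

lemma F_eq: "x \<in> ell2 \<Longrightarrow> F x l = (ell2_norm (E l x))\<^sup>2"
  by (simp add: F_def inner_eq del: of_real_power)

lemma contraction: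
  assumes x: "x \<in> ell2"
  shows "ell2_norm (E l x) \<le> ell2_norm x"
proof -
  have "(ell2_norm (E l x))\<^sup>2 = cmod (ell2_inner (E l x) x)"
    using x by (simp add: inner_eq norm_of_real del: of_real_power)
  also have "\<dots> \<le> ell2_norm (E l x) * ell2_norm x"
    using x by (intro ell2_cauchy_schwarz) auto
  finally have "ell2_norm (E l x) * ell2_norm (E l x) \<le> ell2_norm (E l x) * ell2_norm x"
    by (simp add: power2_eq_square)
  then show ?thesis
    using ell2_norm_nonneg[of "E l x"] ell2_norm_nonneg[of x] x
    by (cases "ell2_norm (E l x) = 0") auto
qed

lemma F_mono:
  assumes "x \<in> ell2" "l \<le> m"
  shows "F x l \<le> F x m"
proof -
  have "ell2_norm (E l x) = ell2_norm (E l (E m x))"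
    using min[OF assms(1), of l m] assms(2) by (simp add: min_def)
  also have "\<dots> \<le> ell2_norm (E m x)" by (rule contraction) (use assms in simp)
  finally show ?thesis
    using assms by (simp add: F_eq power_mono ell2_norm_nonneg)
qed

lemma norm_tendsto:
  assumes "\<And>l. X l \<in> ell2" "y \<in> ell2" "((\<lambda>l. ell2_norm (\<lambda>n. X l n - y n)) \<longlongrightarrow> 0) G"
  shows "((\<lambda>l. ell2_norm (X l)) \<longlongrightarrow> ell2_norm y) G"
proof -
  have "((\<lambda>l. ell2_norm (X l) - ell2_norm y) \<longlongrightarrow> 0) G"
  proof (rule Lim_null_comparison[OF _ assms(3)], rule always_eventually, rule allI)
    fix l
    have d: "(\<lambda>n. X l n - y n) \<in> ell2" by (rule ell2_diff) (use assms in auto)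
    have "ell2_norm (X l) \<le> ell2_norm (\<lambda>n. X l n - y n) + ell2_norm y"
      using ell2_add(2)[OF d assms(2)] by simp
    moreover have "ell2_norm y \<le> ell2_norm (X l) + ell2_norm (\<lambda>n. X l n - y n)"
      using ell2_diff(2)[OF assms(1)[of l] d] by simp
    ultimately show "norm (ell2_norm (X l) - ell2_norm y) \<le> ell2_norm (\<lambda>n. X l n - y n)"
      by simp
  qed
  then show ?thesis by (simp add: LIM_zero_iff)
qed

lemma F_right_cont:
  assumes "x \<in> ell2"
  shows "continuous (at_right m) (F x)"
proof -
  have "((\<lambda>l. (ell2_norm (E l x))\<^sup>2) \<longlongrightarrow> (ell2_norm (E m x))\<^sup>2) (at_right m)"
    by (intro tendsto_power norm_tendsto right_cont) (use assms in auto)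
  moreover have "F x = (\<lambda>l. (ell2_norm (E l x))\<^sup>2)"
    using F_eq[OF assms] by (simp add: fun_eq_iff)
  ultimately show ?thesis by (simp add: continuous_within)
qed

lemma F_at_bot:
  assumes "x \<in> ell2"
  shows "(F x \<longlongrightarrow> 0) at_bot"
proof -
  have "((\<lambda>l. (ell2_norm (E l x))\<^sup>2) \<longlongrightarrow> 0\<^sup>2) at_bot"
    by (intro tendsto_power at_bot) (use assms in auto)
  moreover have "F x = (\<lambda>l. (ell2_norm (E l x))\<^sup>2)"
    using F_eq[OF assms] by (simp add: fun_eq_iff)
  ultimately show ?thesis by simp
qed

lemma F_at_top:
  assumes "x \<in> ell2"
  shows "(F x \<longlongrightarrow> (ell2_norm x)\<^sup>2) at_top"
proof -
  have "((\<lambda>l. (ell2_norm (E l x))\<^sup>2) \<longlongrightarrow> (ell2_norm x)\<^sup>2) at_top"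
    by (intro tendsto_power norm_tendsto at_top) (use assms in auto)
  moreover have "F x = (\<lambda>l. (ell2_norm (E l x))\<^sup>2)"
    using F_eq[OF assms] by (simp add: fun_eq_iff)
  ultimately show ?thesis by simp
qed

abbreviation \<mu> where "\<mu> x \<equiv> stieltjes_measure E x"

lemma \<mu>_eq: "\<mu> x = interval_measure (F x)"
  by (simp add: stieltjes_measure_def F_def[abs_def])

lemma sets_\<mu> [measurable_cong, simp]: "sets (\<mu> x) = sets borel"
  by (simp add: \<mu>_eq)

lemma space_\<mu> [simp]: "space (\<mu> x) = UNIV"
  by (simp add: \<mu>_eq)

lemma finite_\<mu>:
  assumes "x \<in> ell2"
  shows "finite_borel_measure (\<mu> x)" "emeasure (\<mu> x) UNIV = (ell2_norm x)\<^sup>2"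
proof -
  note * = F_mono[OF assms] F_right_cont[OF assms] F_at_bot[OF assms] F_at_top[OF assms]
  show "finite_borel_measure (\<mu> x)"
    unfolding \<mu>_eq by (rule finite_borel_measure_interval_measure[OF * ]) (auto intro: zero_le_power2)
  show "emeasure (\<mu> x) UNIV = (ell2_norm x)\<^sup>2"
    unfolding \<mu>_eq by (rule interval_measure_UNIV[OF * ]) (auto intro: zero_le_power2)
qed

lemma emeasure_\<mu>_Iic:
  assumes "x \<in> ell2"
  shows "emeasure (\<mu> x) {..l} = F x l"
  unfolding \<mu>_eq
  by (rule emeasure_interval_measure_Iic[OF F_mono[OF assms] F_right_cont[OF assms] F_at_bot[OF assms]]) auto

lemma emeasure_\<mu>_Ioc:
  assumes "x \<in> ell2"
  shows "emeasure (\<mu> x) {l<..m} = (if l \<le> m then F x m - F x l else 0)"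
  unfolding \<mu>_eq
  by (rule emeasure_interval_measure_Ioc_eq[OF F_mono[OF assms] F_right_cont[OF assms]])

lemma emeasure_\<mu>_Ioi:
  assumes "x \<in> ell2"
  shows "emeasure (\<mu> x) {l<..} = (ell2_norm x)\<^sup>2 - F x l"
proof -
  interpret finite_borel_measure "\<mu> x" by (rule finite_\<mu>[OF assms])
  have "emeasure (\<mu> x) (UNIV - {..l}) = emeasure (\<mu> x) UNIV - emeasure (\<mu> x) {..l}"
    by (rule emeasure_Diff) auto
  moreover have "UNIV - {..l} = {l<..}" by auto
  moreover have "0 \<le> F x l" using F_eq[OF assms] by simp
  ultimately show ?thesis
    by (simp add: finite_\<mu>(2)[OF assms] emeasure_\<mu>_Iic[OF assms] ennreal_minus)
qed

lemma in_ell2_diff [simp]: "x \<in> ell2 \<Longrightarrow> (\<lambda>n. x n - E l x n) \<in> ell2"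
  by (intro ell2_diff(1)) auto

text \<open>Since \<open>E m (E l x) = E (min m l) x\<close>, the distribution function of the
  projected vector stops growing at \<open>l\<close>: projecting the vector cuts the measure off.
  Comparing masses of the rays beyond each point is enough.\<close>

lemma \<mu>_E:
  assumes x: "x \<in> ell2"
  shows "\<mu> (E l x) = density (\<mu> x) (indicator {..l})"
proof (rule measure_eqI_lessThan)
  fix m
  have "emeasure (\<mu> (E l x)) {m<..} = F x l - F x (min m l)"
    using x by (simp add: emeasure_\<mu>_Ioi F_eq min)
  also have "\<dots> = emeasure (\<mu> x) {m<..l}"
    unfolding emeasure_\<mu>_Ioc[OF x] by (simp add: min_def)
  also have "\<dots> = emeasure (density (\<mu> x) (indicator {..l})) {m<..}"
    by (subst emeasure_density) (auto simp: indicator_inter_arith[symmetric] greaterThanAtMost_def Int_commute)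
  finally show "emeasure (\<mu> (E l x)) {m<..} = emeasure (density (\<mu> x) (indicator {..l})) {m<..}" .
  show "emeasure (\<mu> (E l x)) {m<..} < \<infinity>"
    using x by (simp add: emeasure_\<mu>_Ioi)
qed auto

lemma norm_diff_sq:
  assumes x: "x \<in> ell2" and "l \<le> m"
  shows "(ell2_norm (\<lambda>n. E m x n - E l x n))\<^sup>2 = F x m - F x l"
proof -
  let ?d = "\<lambda>n. E m x n - E l x n"
  have d: "?d \<in> ell2" using x by (intro ell2_diff) auto
  have z: "E l ?d = (\<lambda>n. 0)"
    using x assms(2) by (simp add: op_diff min min_def fun_eq_iff)
  have "ell2_inner ?d (E l x) = ell2_inner (E l ?d) x"
    using d x by (simp add: sym)
  then have "ell2_inner ?d (E l x) = 0" by (simp add: z) (simp add: ell2_inner_def)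
  moreover have "(\<lambda>n. ?d n + E l x n) = E m x" by simp
  ultimately have "(ell2_norm (E m x))\<^sup>2 = (ell2_norm ?d)\<^sup>2 + (ell2_norm (E l x))\<^sup>2"
    using ell2_norm_add_sq[OF d, of "E l x"] x by simp
  then show ?thesis using x by (simp add: F_eq)
qed

lemma norm_compl_sq:
  assumes x: "x \<in> ell2"
  shows "(ell2_norm (\<lambda>n. x n - E l x n))\<^sup>2 = (ell2_norm x)\<^sup>2 - F x l"
proof -
  let ?d = "\<lambda>n. x n - E l x n"
  have "E l ?d = (\<lambda>n. 0)"
    using x by (simp add: op_diff idem fun_eq_iff)
  moreover have "ell2_inner ?d (E l x) = ell2_inner (E l ?d) x"
    using x by (simp add: sym)
  ultimately have "ell2_inner ?d (E l x) = 0" by (simp) (simp add: ell2_inner_def)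
  moreover have "(\<lambda>n. ?d n + E l x n) = x" by simp
  ultimately have "(ell2_norm x)\<^sup>2 = (ell2_norm ?d)\<^sup>2 + (ell2_norm (E l x))\<^sup>2"
    using ell2_norm_add_sq[of ?d "E l x"] x by simp
  then show ?thesis using x by (simp add: F_eq)
qed

text \<open>The complementary cut-off. Here the distribution function of the difference is computed
  from \<open>norm_diff_sq\<close>, which holds because \<open>E l\<close> annihilates the increment
  beyond \<open>l\<close>.\<close>

lemma \<mu>_compl:
  assumes x: "x \<in> ell2"
  shows "\<mu> (\<lambda>n. x n - E l x n) = density (\<mu> x) (indicator {l<..})"
proof (rule measure_eqI_lessThan)
  fix m
  let ?d = "\<lambda>n. x n - E l x n"
  have F: "F ?d m = F x m - F x (min m l)"
  proof -
    have "E m ?d = (\<lambda>n. E m x n - E (min m l) x n)" using x by (simp add: op_diff min)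
    then show ?thesis using x norm_diff_sq[OF x, of "min m l" m] by (simp add: F_eq[of ?d])
  qed
  have "emeasure (\<mu> ?d) {m<..} = (ell2_norm x)\<^sup>2 - F x (max m l)"
    using x by (simp add: emeasure_\<mu>_Ioi norm_compl_sq F) (simp add: min_def max_def)
  also have "\<dots> = emeasure (\<mu> x) {max m l<..}"
    using x by (simp add: emeasure_\<mu>_Ioi)
  also have "{max m l<..} = {m<..} \<inter> {l<..}" by auto
  also have "emeasure (\<mu> x) ({m<..} \<inter> {l<..}) = emeasure (density (\<mu> x) (indicator {l<..})) {m<..}"
    by (subst emeasure_density) (auto simp: indicator_inter_arith[symmetric] Int_commute)
  finally show "emeasure (\<mu> ?d) {m<..} = emeasure (density (\<mu> x) (indicator {l<..})) {m<..}" .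
  show "emeasure (\<mu> ?d) {m<..} < \<infinity>"
    using x by (simp add: emeasure_\<mu>_Ioi)
qed auto

end

text \<open>The only link between \<open>A\<close> and \<open>E\<close> is the weak integral for the
  quadratic form. That \<open>A\<close> commutes with \<open>E l\<close> is not part of the
  definition and is derived in this locale.\<close>

locale ell2_spectral = ell2_resolution E for E +
  fixes A :: "(nat \<Rightarrow> complex) \<Rightarrow> nat \<Rightarrow> complex"
  assumes sa: "ell2_bounded_selfadjoint A"
    and A_E: "resolution_of_identity_of A E"
begin

lemma A_bounded: "ell2_bounded_operator A"
  and A_sym: "x \<in> ell2 \<Longrightarrow> y \<in> ell2 \<Longrightarrow> ell2_inner (A x) y = ell2_inner x (A y)"
  using sa unfolding ell2_bounded_selfadjoint_def by blast+

lemma A_in [simp]: "x \<in> ell2 \<Longrightarrow> A x \<in> ell2"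
  using ell2_bounded_operatorD(1)[OF A_bounded] .

lemma integrable_\<mu>: "x \<in> ell2 \<Longrightarrow> integrable (\<mu> x) (\<lambda>l. l)"
  and A_form: "x \<in> ell2 \<Longrightarrow> Re (ell2_inner (A x) x) = (\<integral>l. l \<partial>\<mu> x)"
  using A_E unfolding resolution_of_identity_of_def by auto

lemma form_E:
  assumes x: "x \<in> ell2"
  shows "Re (ell2_inner (A (E l x)) (E l x)) = (\<integral>s. indicator {..l} s * s \<partial>\<mu> x)"
proof -
  have "Re (ell2_inner (A (E l x)) (E l x)) = (\<integral>s. s \<partial>\<mu> (E l x))" using x by (simp add: A_form)
  also have "\<mu> (E l x) = density (\<mu> x) (\<lambda>s. ennreal (indicator {..l} s))"
    unfolding \<mu>_E[OF x] ennreal_indicator ..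
  also have "(\<integral>s. s \<partial>density (\<mu> x) (\<lambda>s. ennreal (indicator {..l} s))) = (\<integral>s. indicator {..l} s * s \<partial>\<mu> x)"
    by (subst integral_density) auto
  finally show ?thesis .
qed

lemma form_compl:
  assumes x: "x \<in> ell2"
  shows "Re (ell2_inner (A (\<lambda>n. x n - E l x n)) (\<lambda>n. x n - E l x n)) = (\<integral>s. indicator {l<..} s * s \<partial>\<mu> x)"
proof -
  let ?d = "\<lambda>n. x n - E l x n"
  have "Re (ell2_inner (A ?d) ?d) = (\<integral>s. s \<partial>\<mu> ?d)" using x by (simp add: A_form)
  also have "\<mu> ?d = density (\<mu> x) (\<lambda>s. ennreal (indicator {l<..} s))"
    unfolding \<mu>_compl[OF x] ennreal_indicator ..
  also have "(\<integral>s. s \<partial>density (\<mu> x) (\<lambda>s. ennreal (indicator {l<..} s))) = (\<integral>s. indicator {l<..} s * s \<partial>\<mu> x)"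
    by (subst integral_density) auto
  finally show ?thesis .
qed

lemma integrable_restrict:
  assumes x: "x \<in> ell2" and [measurable]: "B \<in> sets borel"
  shows "integrable (\<mu> x) (\<lambda>s. indicator B s * s)"
  by (rule Bochner_Integration.integrable_bound[OF integrable_\<mu>[OF x]]) (auto simp: indicator_def)

text \<open>The two cut-off measures add up to the full one, so the form of \<open>A\<close> has no
  cross term between the range of \<open>E l\<close> and its complement, although commutation is
  still unknown.\<close>

lemma form_split:
  assumes x: "x \<in> ell2"
  shows "Re (ell2_inner (A x) x) = Re (ell2_inner (A (E l x)) (E l x))
     + Re (ell2_inner (A (\<lambda>n. x n - E l x n)) (\<lambda>n. x n - E l x n))"
proof -
  have "(\<integral>s. s \<partial>\<mu> x) = (\<integral>s. indicator {..l} s * s + indicator {l<..} s * s \<partial>\<mu> x)"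
    by (rule Bochner_Integration.integral_cong) (auto simp: indicator_def)
  also have "\<dots> = (\<integral>s. indicator {..l} s * s \<partial>\<mu> x) + (\<integral>s. indicator {l<..} s * s \<partial>\<mu> x)"
    by (rule Bochner_Integration.integral_add) (auto intro: integrable_restrict[OF x])
  finally show ?thesis using x by (simp add: A_form[symmetric] form_E form_compl)
qed

lemma form_E_le:
  assumes x: "x \<in> ell2" "E l x = x"
  shows "Re (ell2_inner (A x) x) \<le> l * (ell2_norm x)\<^sup>2"
proof -
  interpret finite_borel_measure "\<mu> x" by (rule finite_\<mu>[OF x(1)])
  have "Re (ell2_inner (A x) x) = (\<integral>s. indicator {..l} s * s \<partial>\<mu> x)"
    using form_E[OF x(1), of l] x(2) by simp
  also have "\<dots> \<le> (\<integral>s. l * indicator {..l} s \<partial>\<mu> x)"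
    by (intro integral_mono integrable_restrict[OF x(1)] integrable_mult_right integrable_real_indicator)
      (auto simp: indicator_def less_top[symmetric])
  also have "\<dots> = l * measure (\<mu> x) {..l}" by simp
  also have "measure (\<mu> x) {..l} = (ell2_norm x)\<^sup>2"
    using emeasure_\<mu>_Iic[OF x(1), of l] x by (simp add: F_eq measure_def)
  finally show ?thesis .
qed

lemma form_compl_ge:
  assumes x: "x \<in> ell2" "E l x = (\<lambda>n. 0)"
  shows "l * (ell2_norm x)\<^sup>2 \<le> Re (ell2_inner (A x) x)"
proof -
  interpret finite_borel_measure "\<mu> x" by (rule finite_\<mu>[OF x(1)])
  have m: "measure (\<mu> x) {l<..} = (ell2_norm x)\<^sup>2"
    using emeasure_\<mu>_Ioi[OF x(1), of l] x by (simp add: F_eq measure_def ell2_zero)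
  have "l * (ell2_norm x)\<^sup>2 = (\<integral>s. l * indicator {l<..} s \<partial>\<mu> x)" by (simp add: m)
  also have "\<dots> \<le> (\<integral>s. indicator {l<..} s * s \<partial>\<mu> x)"
    by (intro integral_mono integrable_restrict[OF x(1)] integrable_mult_right integrable_real_indicator)
      (auto simp: indicator_def less_top[symmetric])
  also have "\<dots> = Re (ell2_inner (A x) x)"
    using form_compl[OF x(1), of l] x(2) by simp
  finally show ?thesis .
qed

text \<open>Apply \<open>form_split\<close> to \<open>u + v\<close>: the real part of the cross term
  must vanish. Replacing \<open>u\<close> by \<open>\<i> u\<close> disposes of the imaginary
  part.\<close>

lemma cross_zero:
  assumes u: "u \<in> ell2" "E l u = u" and v: "v \<in> ell2" "E l v = (\<lambda>n. 0)"
  shows "ell2_inner (A u) v = 0"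
proof -
  have Re0: "Re (ell2_inner (A u) v) = 0" if u: "u \<in> ell2" "E l u = u" for u
  proof -
    let ?x = "\<lambda>n. u n + v n"
    have x: "?x \<in> ell2" using u v by (simp add: ell2_add)
    have "E l ?x = u" using u v by (simp add: op_add)
    moreover have "A ?x = (\<lambda>n. A u n + A v n)" using u v by (simp add: ell2_bounded_operatorD(2)[OF A_bounded])
    ultimately have "Re (ell2_inner (A u) v) + Re (ell2_inner (A v) u) = 0"
      using form_split[OF x, of l] u v
      by (simp add: ell2_inner_add_left ell2_inner_add_right ell2_add)
    moreover have "Re (ell2_inner (A v) u) = Re (ell2_inner (A u) v)"
      using A_sym[OF v(1) u(1)] ell2_inner_cnj[of "A u" v] u v by (metis complex_cnj A_in cnj.simps(1))
    ultimately show ?thesis by simp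
  qed
  have iu: "(\<lambda>n. \<i> * u n) \<in> ell2" "E l (\<lambda>n. \<i> * u n) = (\<lambda>n. \<i> * u n)"
    using u by (simp_all add: ell2_scale op_scale)
  have "ell2_inner (A (\<lambda>n. \<i> * u n)) v = \<i> * ell2_inner (A u) v"
    using u v by (simp add: ell2_bounded_operatorD(3)[OF A_bounded] ell2_inner_scale_left)
  then have "Im (ell2_inner (A u) v) = 0" using Re0[OF iu] by simp
  then show ?thesis using Re0[OF u] by (simp add: complex_eq_iff)
qed

text \<open>The part of \<open>A u\<close> outside the range of \<open>E l\<close> is orthogonal to
  \<open>A u\<close> and to its projection, hence to itself.\<close>

lemma A_range:
  assumes u: "u \<in> ell2" "E l u = u"
  shows "E l (A u) = A u"
proof -
  let ?w = "\<lambda>n. A u n - E l (A u) n"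
  have w: "?w \<in> ell2" "E l ?w = (\<lambda>n. 0)" using u by (simp_all add: op_diff idem)
  have "ell2_inner (A u) ?w = 0" by (rule cross_zero[OF u w])
  moreover have "ell2_inner (E l (A u)) ?w = 0"
    using w u by (simp add: sym) (simp add: ell2_inner_def)
  ultimately have "ell2_inner ?w ?w = 0"
    using u w by (subst ell2_inner_diff_left) auto
  then have "ell2_norm ?w = 0" using w by (simp add: ell2_inner_self)
  from ell2_norm_eq_0[OF w(1) this] show ?thesis by (simp add: fun_eq_iff)
qed

lemma A_kernel:
  assumes v: "v \<in> ell2" "E l v = (\<lambda>n. 0)"
  shows "E l (A v) = (\<lambda>n. 0)"
proof -
  let ?z = "E l (A v)"
  have z: "?z \<in> ell2" "E l ?z = ?z" using v by (simp_all add: idem)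
  have "ell2_inner ?z ?z = ell2_inner (A v) ?z" using z v by (simp add: sym)
  also have "\<dots> = cnj (ell2_inner (A ?z) v)" using z v by (simp add: A_sym ell2_inner_cnj)
  also have "\<dots> = 0" using cross_zero[OF z v] by simp
  finally have "ell2_norm ?z = 0" using z by (simp add: ell2_inner_self)
  from ell2_norm_eq_0[OF z(1) this] show ?thesis .
qed

text \<open>Range and kernel of \<open>E l\<close> are both invariant under
  \<open>A\<close>.\<close>

lemma A_commute:
  assumes x: "x \<in> ell2"
  shows "E l (A x) = A (E l x)"
proof -
  have 1: "E l (A (E l x)) = A (E l x)" using x by (intro A_range) (auto simp: idem)
  have 2: "E l (A (\<lambda>n. x n - E l x n)) = (\<lambda>n. 0)" using x by (intro A_kernel) (auto simp: op_diff idem)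
  have "A (\<lambda>n. x n - E l x n) = (\<lambda>n. A x n - A (E l x) n)"
    using x by (simp add: ell2_bounded_operatorD(4)[OF A_bounded])
  with 2 1 x show ?thesis by (simp add: op_diff fun_eq_iff)
qed

end

section \<open>Comparison of two resolutions of the identity\<close>

text \<open>If \<open>0 \<le> B \<le> q\<close> on an invariant subspace, then \<open>B\<close> has norm at most \<open>q\<close> there:
  expand \<open>0 \<le> (B z, z)\<close> for \<open>z = x - B x / q\<close>.\<close>

lemma ell2_positive_form_norm_le:
  assumes B: "ell2_bounded_selfadjoint B" and q: "0 < q"
    and nn: "\<And>z. z \<in> ell2 \<Longrightarrow> 0 \<le> Re (ell2_inner (B z) z)"
    and x: "x \<in> ell2" and le: "Re (ell2_inner (B x) x) \<le> q * (ell2_norm x)\<^sup>2"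
      "Re (ell2_inner (B (B x)) (B x)) \<le> q * (ell2_norm (B x))\<^sup>2"
  shows "ell2_norm (B x) \<le> q * ell2_norm x"
proof -
  have bo: "ell2_bounded_operator B" using B by (simp add: ell2_bounded_selfadjoint_def)
  have sym: "\<And>x y. x \<in> ell2 \<Longrightarrow> y \<in> ell2 \<Longrightarrow> ell2_inner (B x) y = ell2_inner x (B y)"
    using B by (simp add: ell2_bounded_selfadjoint_def)
  have i: "\<And>x. x \<in> ell2 \<Longrightarrow> B x \<in> ell2" using ell2_bounded_operatorD(1)[OF bo] .
  let ?y = "\<lambda>n. complex_of_real (1 / q) * B x n"
  let ?z = "\<lambda>n. x n - ?y n"
  have y: "?y \<in> ell2" using x by (intro ell2_scale i)
  have z: "?z \<in> ell2" using x y by (intro ell2_diff)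
  have Bz: "B ?z = (\<lambda>n. B x n - complex_of_real (1 / q) * B (B x) n)"
    using ell2_bounded_operatorD(4)[OF bo x y] ell2_bounded_operatorD(3)[OF bo i[OF x], of "complex_of_real (1/q)"]
    by simp
  have s: "(\<lambda>n. complex_of_real (1 / q) * B (B x) n) \<in> ell2" using x by (intro ell2_scale i)
  have a: "ell2_inner (B x) (B x) = complex_of_real ((ell2_norm (B x))\<^sup>2)"
    "ell2_inner (B (B x)) x = complex_of_real ((ell2_norm (B x))\<^sup>2)"
    using x i by (simp_all add: ell2_inner_self sym)
  have "ell2_inner (B ?z) ?z = ell2_inner (B x) x - complex_of_real (1 / q) * ell2_inner (B x) (B x)
     - complex_of_real (1 / q) * (ell2_inner (B (B x)) x - complex_of_real (1 / q) * ell2_inner (B (B x)) (B x))"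
    unfolding Bz using x y s i
    by (simp add: ell2_inner_diff_left ell2_inner_diff_right ell2_diff ell2_inner_scale_left ell2_inner_scale_right
       ell2_scale right_diff_distrib del: of_real_divide)
  from arg_cong[OF this, of Re]
  have "Re (ell2_inner (B ?z) ?z) = Re (ell2_inner (B x) x) - (1 / q) * (ell2_norm (B x))\<^sup>2
     - (1 / q) * ((ell2_norm (B x))\<^sup>2 - (1 / q) * Re (ell2_inner (B (B x)) (B x)))"
    unfolding a by (simp del: of_real_divide of_real_power)
  also have "\<dots> \<le> q * (ell2_norm x)\<^sup>2 - (1 / q) * (ell2_norm (B x))\<^sup>2
     - (1 / q) * ((ell2_norm (B x))\<^sup>2 - (1 / q) * (q * (ell2_norm (B x))\<^sup>2))"
    using le q by (intro diff_mono order_refl mult_left_mono) auto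
  also have "\<dots> = q * (ell2_norm x)\<^sup>2 - (ell2_norm (B x))\<^sup>2 / q"
    using q by (simp add: field_simps)
  finally have "(ell2_norm (B x))\<^sup>2 / q \<le> q * (ell2_norm x)\<^sup>2"
    using nn[OF z] by simp
  then have "(ell2_norm (B x))\<^sup>2 \<le> (q * ell2_norm x)\<^sup>2"
    using q by (simp add: field_simps power2_eq_square)
  then show ?thesis
    by (rule power2_le_imp_le) (use q x in \<open>simp add: ell2_norm_nonneg\<close>)
qed

text \<open>Let \<open>B = A + C\<close> be shifted to a nonnegative form, \<open>u = E l x\<close>,
  and let \<open>z\<close> be the part of \<open>u\<close> beyond \<open>m\<close> with respect to
  \<open>E'\<close>. The powers \<open>B^n u\<close> grow at most like \<open>q^n\<close>, while
  \<open>B^n z\<close> grows at least like \<open>r^n\<close> with \<open>r > q\<close>. Because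
  \<open>B\<close> commutes with \<open>E'\<close>, the vector \<open>B^n z\<close> is the
  projection of \<open>B^n u\<close> beyond \<open>m\<close>, so the norm of \<open>z\<close> is at
  most \<open>2 (q / r)^n\<close> times that of \<open>u\<close>, for every \<open>n\<close>. No
  relation between \<open>E\<close> and \<open>E'\<close> is assumed.\<close>

lemma spectral_projection_le:
  assumes "ell2_spectral E A" "ell2_spectral E' A" and x: "x \<in> ell2" and "l < m"
  shows "E' m (E l x) = E l x"
proof -
  interpret S: ell2_spectral E A by fact
  interpret S': ell2_spectral E' A by fact
  obtain C where C: "C \<ge> 0" "\<And>x. x \<in> ell2 \<Longrightarrow> ell2_norm (A x) \<le> C * ell2_norm x"
    using ell2_bounded_operator_bound[OF S.A_bounded] by blast
  define B where "B x = (\<lambda>n. A x n + complex_of_real C * x n)" for x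
  have B_in: "x \<in> ell2 \<Longrightarrow> B x \<in> ell2" for x
    unfolding B_def by (intro ell2_add ell2_scale S.A_in)
  have B_inner: "ell2_inner (B x) y = ell2_inner (A x) y + complex_of_real C * ell2_inner x y"
    if "x \<in> ell2" "y \<in> ell2" for x y
    unfolding B_def using that by (simp add: ell2_inner_add_left ell2_inner_scale_left ell2_scale)
  have B_form: "Re (ell2_inner (B x) x) = Re (ell2_inner (A x) x) + C * (ell2_norm x)\<^sup>2" if "x \<in> ell2" for x
    using that by (simp add: B_inner ell2_inner_self del: of_real_power)
  have B_sa: "ell2_bounded_selfadjoint B"
    unfolding ell2_bounded_selfadjoint_def ell2_bounded_operator_def
  proof (intro conjI ballI allI)
    show "\<exists>D. \<forall>x\<in>ell2. ell2_norm (B x) \<le> D * ell2_norm x"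
    proof (intro exI[of _ "2 * C"] ballI)
      fix x :: "nat \<Rightarrow> complex" assume x: "x \<in> ell2"
      have "ell2_norm (B x) \<le> ell2_norm (A x) + cmod (complex_of_real C) * ell2_norm x"
        unfolding B_def using ell2_add(2)[OF S.A_in[OF x] ell2_scale(1)[OF x, of C]] ell2_scale(2)[OF x, of C] by simp
      also have "\<dots> \<le> 2 * C * ell2_norm x" using C(2)[OF x] C(1) by simp
      finally show "ell2_norm (B x) \<le> 2 * C * ell2_norm x" .
    qed
    show "ell2_inner (B x) y = ell2_inner x (B y)" if "x \<in> ell2" "y \<in> ell2" for x y
    proof -
      have "ell2_inner x (B y) = cnj (ell2_inner (B y) x)" using that by (simp add: ell2_inner_cnj B_in)
      also have "\<dots> = cnj (ell2_inner (A y) x) + complex_of_real C * cnj (ell2_inner y x)"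
        using that by (simp add: B_inner)
      also have "\<dots> = ell2_inner x (A y) + complex_of_real C * ell2_inner x y"
        using that by (simp add: ell2_inner_cnj)
      finally show ?thesis using that by (simp add: B_inner S.A_sym)
    qed
    show "B (\<lambda>n. x n + y n) = (\<lambda>n. B x n + B y n)" if "x \<in> ell2" "y \<in> ell2" for x y
      using that by (simp add: B_def ell2_bounded_operatorD(2)[OF S.A_bounded] algebra_simps)
    show "B (\<lambda>n. c * x n) = (\<lambda>n. c * B x n)" if "x \<in> ell2" for x c
      using that by (simp add: B_def ell2_bounded_operatorD(3)[OF S.A_bounded] algebra_simps)
  qed (rule B_in)
  have B_nn: "0 \<le> Re (ell2_inner (B z) z)" if "z \<in> ell2" for z
  proof -
    have "\<bar>Re (ell2_inner (A z) z)\<bar> \<le> cmod (ell2_inner (A z) z)" by (rule abs_Re_le_cmod)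
    also have "\<dots> \<le> ell2_norm (A z) * ell2_norm z" using that by (intro ell2_cauchy_schwarz) auto
    also have "\<dots> \<le> (C * ell2_norm z) * ell2_norm z"
      using C(2)[OF that] that by (intro mult_right_mono) (auto simp: ell2_norm_nonneg)
    finally show ?thesis using that by (simp add: B_form power2_eq_square)
  qed
  define u where "u = E l x"
  have u: "u \<in> ell2" "E l u = u" using x by (simp_all add: u_def S.idem)
  define z where "z = (\<lambda>n. u n - E' m u n)"
  have z: "z \<in> ell2" "E' m z = (\<lambda>n. 0)" using u by (simp_all add: z_def S'.op_diff S'.idem)
  \<comment> \<open>The midpoint of \<open>l\<close> and \<open>m\<close> keeps \<open>q\<close>
    below \<open>r\<close> and makes it strictly positive: nonnegativity of the form at a nonzero
    \<open>u\<close> only gives \<open>l + C \<ge> 0\<close>, and the norm estimate divides by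
    \<open>q\<close>.\<close>
  define q r where "q = (l + m) / 2 + C" and "r = m + C"
  have qr: "q < r" using \<open>l < m\<close> by (simp add: q_def r_def)
  have "ell2_norm z = 0"
  proof (cases "ell2_norm u = 0")
    case True
    then have "u = (\<lambda>n. 0)" using ell2_norm_eq_0 u by blast
    then have "z = (\<lambda>n. 0)" using ell2_bounded_operatorD(5)[OF S'.bounded_op ell2_zero(1)] by (simp add: z_def)
    then show ?thesis by (simp add: ell2_zero)
  next
    case False
    then have nu: "ell2_norm u > 0" using ell2_norm_nonneg[OF u(1)] by simp
    have le: "Re (ell2_inner (B y) y) \<le> q * (ell2_norm y)\<^sup>2" if "y \<in> ell2" "E l y = y" for y
    proof -
      have "Re (ell2_inner (B y) y) \<le> (l + C) * (ell2_norm y)\<^sup>2"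
        using S.form_E_le[OF that] that by (simp add: B_form algebra_simps)
      also have "\<dots> \<le> q * (ell2_norm y)\<^sup>2" using \<open>l < m\<close> by (intro mult_right_mono) (auto simp: q_def)
      finally show ?thesis .
    qed
    have "0 \<le> (l + C) * (ell2_norm u)\<^sup>2"
      using S.form_E_le[OF u] B_nn[OF u(1)] u by (simp add: B_form algebra_simps)
    then have "0 \<le> l + C" using nu by (simp add: zero_le_mult_iff)
    also have "l + C < q" using \<open>l < m\<close> by (simp add: q_def)
    finally have q: "0 < q" .
    have up: "(B ^^ n) u \<in> ell2 \<and> E l ((B ^^ n) u) = (B ^^ n) u \<and> ell2_norm ((B ^^ n) u) \<le> q ^ n * ell2_norm u" for n
    proof (induction n)
      case (Suc n)
      let ?y = "(B ^^ n) u"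
      have y: "?y \<in> ell2" "E l ?y = ?y" using Suc by auto
      have By: "B ?y \<in> ell2" "E l (B ?y) = B ?y"
        using y S.A_range[OF y] unfolding B_def
        by (simp_all add: ell2_add ell2_scale S.op_add S.op_scale)
      have "ell2_norm (B ?y) \<le> q * ell2_norm ?y"
        by (rule ell2_positive_form_norm_le[OF B_sa q B_nn y(1) le[OF y] le[OF By]])
      also have "\<dots> \<le> q * (q ^ n * ell2_norm u)" using Suc q by (intro mult_left_mono) auto
      finally show ?case using By by (simp add: mult.assoc)
    qed (use u in auto)
    have low: "(B ^^ n) z \<in> ell2 \<and> (B ^^ n) z = (\<lambda>k. (B ^^ n) u k - E' m ((B ^^ n) u) k) \<and> r ^ n * ell2_norm z \<le> ell2_norm ((B ^^ n) z)" for n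
    proof (induction n)
      case (Suc n)
      let ?y = "(B ^^ n) z" and ?u = "(B ^^ n) u"
      have u': "?u \<in> ell2" using up by simp
      have y: "?y \<in> ell2" "?y = (\<lambda>k. ?u k - E' m ?u k)" using Suc by auto
      have Ey: "E' m ?y = (\<lambda>n. 0)" unfolding y(2) using u' by (simp add: S'.op_diff S'.idem)
      have "B ?y = (\<lambda>k. B ?u k - B (E' m ?u) k)"
        unfolding y(2) using u' by (simp add: B_def ell2_bounded_operatorD(4)[OF S.A_bounded] algebra_simps)
      also have "B (E' m ?u) = E' m (B ?u)"
        using u' by (simp add: B_def S'.op_add S'.op_scale S'.A_commute ell2_scale)
      finally have By: "B ?y = (\<lambda>k. B ?u k - E' m (B ?u) k)" .
      have "r * (ell2_norm ?y)\<^sup>2 \<le> Re (ell2_inner (B ?y) ?y)"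
        using S'.form_compl_ge[OF y(1) Ey] y(1) by (simp add: B_form r_def algebra_simps)
      also have "\<dots> \<le> cmod (ell2_inner (B ?y) ?y)" by (rule complex_Re_le_cmod)
      also have "\<dots> \<le> ell2_norm (B ?y) * ell2_norm ?y" using y by (intro ell2_cauchy_schwarz B_in) auto
      finally have "r * ell2_norm ?y \<le> ell2_norm (B ?y)"
        using ell2_norm_nonneg[OF y(1)] ell2_norm_nonneg[OF B_in[OF y(1)]]
        by (cases "ell2_norm ?y = 0") (auto simp: power2_eq_square mult.assoc[symmetric])
      moreover have "r * (r ^ n * ell2_norm z) \<le> r * ell2_norm ?y"
        using Suc q qr by (intro mult_left_mono) auto
      ultimately show ?case using By B_in[OF y(1)] by (simp add: mult.assoc)
    qed (use z in \<open>auto simp: z_def\<close>)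
    have main: "ell2_norm z \<le> 2 * (q / r) ^ n * ell2_norm u" for n
    proof -
      have un: "(B ^^ n) u \<in> ell2" using up by simp
      have "r ^ n * ell2_norm z \<le> ell2_norm (\<lambda>k. (B ^^ n) u k - E' m ((B ^^ n) u) k)" using low[of n] by metis
      also have "\<dots> \<le> ell2_norm ((B ^^ n) u) + ell2_norm (E' m ((B ^^ n) u))"
        using un by (intro ell2_diff(2)) auto
      also have "\<dots> \<le> 2 * ell2_norm ((B ^^ n) u)" using S'.contraction[OF un] by simp
      also have "\<dots> \<le> 2 * (q ^ n * ell2_norm u)" using up by simp
      finally show ?thesis using q qr by (simp add: power_divide field_simps)
    qed
    have "(\<lambda>n. 2 * (q / r) ^ n * ell2_norm u) \<longlonglongrightarrow> 2 * 0 * ell2_norm u"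
      using q qr by (intro tendsto_mult_right tendsto_mult_left LIMSEQ_power_zero) auto
    then have "ell2_norm z \<le> 0"
      using main by (intro LIMSEQ_le_const[where X = "\<lambda>n. 2 * (q / r) ^ n * ell2_norm u"]) auto
    then show ?thesis using ell2_norm_nonneg[OF z(1)] by simp
  qed
  from ell2_norm_eq_0[OF z(1) this] show ?thesis by (simp add: z_def u_def fun_eq_iff)
qed

text \<open>Right-continuity lets \<open>m\<close> decrease to \<open>l\<close>: the norm in
  question does not depend on \<open>m > l\<close>, so its limit is its value.\<close>

lemma spectral_projection_absorb:
  assumes S: "ell2_spectral E A" "ell2_spectral E' A" and x: "x \<in> ell2"
  shows "E' l (E l x) = E l x"
proof -
  interpret S: ell2_spectral E A by fact
  interpret S': ell2_spectral E' A by fact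
  let ?u = "E l x"
  have u: "?u \<in> ell2" using x by simp
  have "((\<lambda>m. ell2_norm (\<lambda>n. E' m ?u n - E' l ?u n)) \<longlongrightarrow> 0) (at_right l)"
    by (rule S'.right_cont[OF u])
  moreover have "\<forall>\<^sub>F m in at_right l. ell2_norm (\<lambda>n. E' m ?u n - E' l ?u n) = ell2_norm (\<lambda>n. ?u n - E' l ?u n)"
    using spectral_projection_le[OF S x, of l]
    by (intro eventually_at_right_less[THEN eventually_mono]) auto
  ultimately have "((\<lambda>m. ell2_norm (\<lambda>n. ?u n - E' l ?u n)) \<longlongrightarrow> 0) (at_right l)"
    by (rule Lim_transform_eventually)
  then have "ell2_norm (\<lambda>n. ?u n - E' l ?u n) = 0" by (simp add: tendsto_const_iff)
  from ell2_norm_eq_0[OF S'.in_ell2_diff[OF u] this] show ?thesis by (simp add: fun_eq_iff)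
qed

text \<open>Each family absorbs the other at every level. Taking adjoints in
  \<open>(E' E v, v)\<close> reverses the order of the factors, so the first reading gives
  \<open>(E v, v)\<close> and the second \<open>(E' v, v)\<close>.\<close>

theorem has_spectral_measure_unique:
  assumes "has_spectral_measure A v \<rho>" "has_spectral_measure A v \<rho>'" and v: "v \<in> ell2"
  shows "\<rho> = \<rho>'"
proof -
  obtain E E' where E: "ell2_bounded_selfadjoint A" "resolution_of_identity_of A E" "\<rho> = stieltjes_measure E v"
    and E': "resolution_of_identity_of A E'" "\<rho>' = stieltjes_measure E' v"
    using assms unfolding has_spectral_measure_def by blast
  have S: "ell2_spectral E A" "ell2_spectral E' A"
    using E E' by (unfold_locales; simp add: resolution_of_identity_of_def)+
  interpret S: ell2_spectral E A by (rule S)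
  interpret S': ell2_spectral E' A by (rule S)
  have "ell2_inner (E l v) v = ell2_inner (E' l v) v" for l
  proof -
    have "ell2_inner (E l v) v = ell2_inner (E' l (E l v)) v"
      using spectral_projection_absorb[OF S v] by simp
    also have "\<dots> = ell2_inner v (E l (E' l v))" using v by (simp add: S'.sym S.sym)
    also have "\<dots> = ell2_inner v (E' l v)" using spectral_projection_absorb[OF S(2,1) v] by simp
    also have "\<dots> = ell2_inner (E' l v) v" using v by (simp add: S'.sym)
    finally show ?thesis .
  qed
  then show ?thesis by (simp add: E E' stieltjes_measure_def)
qed

section \<open>Jacobi operators and Favard's theorem\<close>

lemma ell2_shift_left:
  assumes "x \<in> ell2"
  shows "(\<lambda>n. x (Suc n)) \<in> ell2" "ell2_norm (\<lambda>n. x (Suc n)) \<le> ell2_norm x"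
proof -
  have "(\<Sum>n<N. (cmod (x (Suc n)))\<^sup>2) \<le> (ell2_norm x)\<^sup>2" for N
  proof -
    have "(\<Sum>n<N. (cmod (x (Suc n)))\<^sup>2) \<le> (\<Sum>n<Suc N. (cmod (x n))\<^sup>2)"
      by (subst sum.lessThan_Suc_shift) simp
    also have "\<dots> \<le> (ell2_norm x)\<^sup>2" by (rule ell2_partial_sum_le[OF assms]) simp
    finally show ?thesis .
  qed
  from ell2I_bounded[OF this ell2_norm_nonneg[OF assms]]
  show "(\<lambda>n. x (Suc n)) \<in> ell2" "ell2_norm (\<lambda>n. x (Suc n)) \<le> ell2_norm x" by auto
qed

lemma ell2_shift_right:
  assumes "x \<in> ell2"
  shows "(\<lambda>n. if n = 0 then 0 else x (n - 1)) \<in> ell2"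
    "ell2_norm (\<lambda>n. if n = 0 then 0 else x (n - 1)) \<le> ell2_norm x"
proof -
  have "(\<Sum>n<N. (cmod (if n = 0 then 0 else x (n - 1)))\<^sup>2) \<le> (ell2_norm x)\<^sup>2" for N
  proof (cases N)
    case (Suc M)
    have "(\<Sum>n<N. (cmod (if n = 0 then 0 else x (n - 1)))\<^sup>2) = (\<Sum>n<M. (cmod (x n))\<^sup>2)"
      unfolding Suc by (subst sum.lessThan_Suc_shift) simp
    also have "\<dots> \<le> (ell2_norm x)\<^sup>2" by (rule ell2_partial_sum_le[OF assms]) simp
    finally show ?thesis .
  qed simp
  from ell2I_bounded[OF this ell2_norm_nonneg[OF assms]]
  show "(\<lambda>n. if n = 0 then 0 else x (n - 1)) \<in> ell2"
    "ell2_norm (\<lambda>n. if n = 0 then 0 else x (n - 1)) \<le> ell2_norm x" by auto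
qed

lemma ell2_diagonal:
  assumes "x \<in> ell2" and d: "\<And>n. cmod (d n) \<le> B"
  shows "(\<lambda>n. d n * x n) \<in> ell2" "ell2_norm (\<lambda>n. d n * x n) \<le> B * ell2_norm x"
proof -
  have B: "0 \<le> B" using d[of 0] norm_ge_zero[of "d 0"] by linarith
  have "(\<Sum>n<N. (cmod (d n * x n))\<^sup>2) \<le> (B * ell2_norm x)\<^sup>2" for N
  proof -
    have "(\<Sum>n<N. (cmod (d n * x n))\<^sup>2) \<le> (\<Sum>n<N. B\<^sup>2 * (cmod (x n))\<^sup>2)"
      unfolding norm_mult power_mult_distrib using d B
      by (intro sum_mono mult_right_mono power_mono) auto
    also have "\<dots> = B\<^sup>2 * (\<Sum>n<N. (cmod (x n))\<^sup>2)" by (simp add: sum_distrib_left)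
    also have "\<dots> \<le> B\<^sup>2 * (ell2_norm x)\<^sup>2"
      by (intro mult_left_mono ell2_partial_sum_le[OF assms(1)]) auto
    finally show ?thesis by (simp add: power_mult_distrib)
  qed
  from ell2I_bounded[OF this] show "(\<lambda>n. d n * x n) \<in> ell2" "ell2_norm (\<lambda>n. d n * x n) \<le> B * ell2_norm x"
    using B ell2_norm_nonneg[OF assms(1)] by auto
qed

lemma lax_operator_eq:
  "lax_operator a x i = complex_of_real (sqrt (a i)) * x (Suc i)
     + (if i = 0 then 0 else complex_of_real (sqrt (a (i - 1))) * x (i - 1))"
proof -
  have "lax_operator a x i = (\<Sum>j\<in>(if i = 0 then {Suc i} else {Suc i, i - 1}). complex_of_real (lax_matrix a i j) * x j)"
    unfolding lax_operator_def by (rule suminf_finite) (auto simp: lax_matrix_def split: if_splits)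
  then show ?thesis by (auto simp: lax_matrix_def)
qed

text \<open>A weighted left shift plus a weighted right shift, each of norm at most
  \<open>sqrt M\<close>.\<close>

lemma lax_operator_bounded:
  assumes M: "\<And>n. a n \<le> M" and pos: "\<And>n. 0 \<le> a n"
  shows "ell2_bounded_operator (lax_operator a)"
    "\<And>x. x \<in> ell2 \<Longrightarrow> ell2_norm (lax_operator a x) \<le> 2 * sqrt M * ell2_norm x"
proof -
  have b: "cmod (complex_of_real (sqrt (a n))) \<le> sqrt M" for n
    using M[of n] pos[of n] by simp
  have dec: "lax_operator a x = (\<lambda>n. complex_of_real (sqrt (a n)) * x (Suc n)
      + (if n = 0 then 0 else complex_of_real (sqrt (a (n - 1))) * x (n - 1)))" for x
    by (rule ext) (simp add: lax_operator_eq)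
  have 1: "(\<lambda>n. sqrt (a n) * x (Suc n)) \<in> ell2"
    "ell2_norm (\<lambda>n. sqrt (a n) * x (Suc n)) \<le> sqrt M * ell2_norm x" if "x \<in> ell2" for x :: "nat \<Rightarrow> complex"
  proof -
    note s = ell2_shift_left[OF that]
    note d = ell2_diagonal[where d = "\<lambda>n. complex_of_real (sqrt (a n))", OF s(1) b]
    show "(\<lambda>n. sqrt (a n) * x (Suc n)) \<in> ell2" by (rule d(1))
    have "sqrt M * ell2_norm (\<lambda>n. x (Suc n)) \<le> sqrt M * ell2_norm x"
      using s(2) order_trans[OF pos[of 0] M[of 0]] by (intro mult_left_mono) auto
    with d(2) show "ell2_norm (\<lambda>n. sqrt (a n) * x (Suc n)) \<le> sqrt M * ell2_norm x" by linarith
  qed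
  have 2: "(\<lambda>n. if n = 0 then 0 else complex_of_real (sqrt (a (n - 1))) * x (n - 1)) \<in> ell2"
    "ell2_norm (\<lambda>n. if n = 0 then 0 else complex_of_real (sqrt (a (n - 1))) * x (n - 1)) \<le> sqrt M * ell2_norm x"
    if "x \<in> ell2" for x :: "nat \<Rightarrow> complex"
    using ell2_shift_right[OF ell2_diagonal(1)[where d = "\<lambda>n. complex_of_real (sqrt (a n))", OF that b]]
      ell2_diagonal(2)[where d = "\<lambda>n. complex_of_real (sqrt (a n))", OF that b] by auto
  have bd: "lax_operator a x \<in> ell2 \<and> ell2_norm (lax_operator a x) \<le> 2 * sqrt M * ell2_norm x"
    if "x \<in> ell2" for x :: "nat \<Rightarrow> complex"
    unfolding dec[of x] using ell2_add[OF 1(1)[OF that] 2(1)[OF that]] 1(2)[OF that] 2(2)[OF that] by auto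
  then show "ell2_norm (lax_operator a x) \<le> 2 * sqrt M * ell2_norm x" if "x \<in> ell2" for x using that by simp
  show "ell2_bounded_operator (lax_operator a)"
    unfolding ell2_bounded_operator_def
  proof (intro conjI ballI allI exI[of _ "2 * sqrt M"])
    show "lax_operator a (\<lambda>n. x n + y n) = (\<lambda>n. lax_operator a x n + lax_operator a y n)" for x y
      by (rule ext) (simp add: lax_operator_eq distrib_left)
    show "lax_operator a (\<lambda>n. c * x n) = (\<lambda>n. c * lax_operator a x n)" for x c
      by (rule ext) (simp add: lax_operator_eq distrib_left mult.left_commute)
  qed (use bd in blast)+
qed

lemma lax_operator_unit:
  "lax_operator a (ell2_unit j) k = (if j = Suc k then sqrt (a k) else if k = Suc j then sqrt (a j) else 0)"
  by (auto simp: lax_operator_eq ell2_unit_def)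

lemma lax_operator_selfadjoint:
  assumes M: "\<And>n. a n \<le> M" and pos: "\<And>n. 0 \<le> a n"
  shows "ell2_bounded_selfadjoint (lax_operator a)"
  unfolding ell2_bounded_selfadjoint_def
  using lax_operator_bounded(1)[of a M, OF assms]
  by (auto intro!: ell2_operator_inner_ext simp: lax_operator_unit)

section \<open>From a bounded selfadjoint operator to a measure\<close>

lemma ell2_bounded_operator_funpow:
  "ell2_bounded_operator A \<Longrightarrow> ell2_bounded_operator (A ^^ n)"
proof (induction n)
  case 0
  show ?case by (auto simp: ell2_bounded_operator_def intro!: exI[of _ 1])
next
  case (Suc n)
  then show ?case using ell2_bounded_operator_compose[of A "A ^^ n"] by (simp add: o_def)
qed

text \<open>Pairs of equal factors are split between the two sides of the inner product, which
  lowers \<open>j\<close> or \<open>k\<close> by two and replaces \<open>x\<close> by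
  \<open>B x\<close> or \<open>C x\<close>. Only exponents 0 and 1 remain, and the mixed case
  follows from \<open>B C = B C (B + C) = B C B + C B C\<close>, a sum of two nonnegative forms. No
  square root of an operator enters.\<close>

lemma complementary_powers_nonneg:
  assumes B: "ell2_bounded_selfadjoint B" and C: "C = (\<lambda>x n. x n - B x n)"
    and nnB: "\<And>x. x \<in> ell2 \<Longrightarrow> 0 \<le> Re (ell2_inner (B x) x)"
    and nnC: "\<And>x. x \<in> ell2 \<Longrightarrow> 0 \<le> Re (ell2_inner (C x) x)"
    and x: "x \<in> ell2"
  shows "0 \<le> Re (ell2_inner ((B ^^ j) ((C ^^ k) x)) x)"
proof -
  have bo: "ell2_bounded_operator B" using B by (simp add: ell2_bounded_selfadjoint_def)
  have symB: "\<And>x y. x \<in> ell2 \<Longrightarrow> y \<in> ell2 \<Longrightarrow> ell2_inner (B x) y = ell2_inner x (B y)"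
    using B by (simp add: ell2_bounded_selfadjoint_def)
  have iB: "\<And>x. x \<in> ell2 \<Longrightarrow> B x \<in> ell2" using ell2_bounded_operatorD(1)[OF bo] .
  have iC: "\<And>x. x \<in> ell2 \<Longrightarrow> C x \<in> ell2" unfolding C by (intro ell2_diff iB)
  have symC: "\<And>x y. x \<in> ell2 \<Longrightarrow> y \<in> ell2 \<Longrightarrow> ell2_inner (C x) y = ell2_inner x (C y)"
    unfolding C by (simp add: ell2_inner_diff_left ell2_inner_diff_right iB symB)
  have comm: "C (B x) = B (C x)" if "x \<in> ell2" for x
    unfolding C using ell2_bounded_operatorD(4)[OF bo that iB[OF that]] by simp
  have iBp: "(B ^^ n) x \<in> ell2" if "x \<in> ell2" for n x by (induction n) (auto simp: that iB)
  have iCp: "(C ^^ n) x \<in> ell2" if "x \<in> ell2" for n x by (induction n) (auto simp: that iC)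
  have BCp: "B ((C ^^ n) x) = (C ^^ n) (B x)" if "x \<in> ell2" for n x
    by (induction n) (auto simp: comm[symmetric] that iCp)
  have CBp: "C ((B ^^ n) x) = (B ^^ n) (C x)" if "x \<in> ell2" for n x
    by (induction n) (auto simp: comm that iBp)
  have BB: "ell2_inner ((B ^^ Suc (Suc j)) ((C ^^ k) x)) x = ell2_inner ((B ^^ j) ((C ^^ k) (B x))) (B x)"
    if x: "x \<in> ell2" for x j k
  proof -
    have "(B ^^ Suc (Suc j)) ((C ^^ k) x) = B ((B ^^ j) ((C ^^ k) (B x)))"
      using BCp[OF x, of k] by (simp add: funpow_swap1)
    then show ?thesis using x by (simp only: symB iBp iCp iB)
  qed
  have CC: "ell2_inner ((B ^^ j) ((C ^^ Suc (Suc k)) x)) x = ell2_inner ((B ^^ j) ((C ^^ k) (C x))) (C x)"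
    if x: "x \<in> ell2" for x j k
  proof -
    have "(B ^^ j) ((C ^^ Suc (Suc k)) x) = C ((B ^^ j) ((C ^^ k) (C x)))"
    proof -
      have w: "(C ^^ k) (C x) \<in> ell2" by (intro iCp iC x)
      have "(C ^^ Suc (Suc k)) x = C ((C ^^ k) (C x))" by (simp add: funpow_swap1)
      then show ?thesis by (simp only: CBp[OF w])
    qed
    then show ?thesis using x by (simp only: symC iBp iCp iC)
  qed
  have BC1: "0 \<le> Re (ell2_inner (B (C x)) x)" if x: "x \<in> ell2" for x
  proof -
    have "B (C x) = B (C (\<lambda>n. B x n + C x n))" by (simp add: C)
    also have "\<dots> = (\<lambda>n. B (C (B x)) n + B (C (C x)) n)"
    proof -
      have "C (\<lambda>n. y n + z n) = (\<lambda>n. C y n + C z n)" if "y \<in> ell2" "z \<in> ell2" for y z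
        using ell2_bounded_operatorD(2)[OF bo that] by (simp add: C fun_eq_iff)
      then show ?thesis
        by (simp only: iB iC x ell2_bounded_operatorD(2)[OF bo iC[OF iB[OF x]] iC[OF iC[OF x]]])
    qed
    finally have e: "B (C x) = (\<lambda>n. B (C (B x)) n + B (C (C x)) n)" .
    have "ell2_inner (B (C x)) x = ell2_inner (C (B x)) (B x) + ell2_inner (B (C x)) (C x)"
    proof -
      have "ell2_inner (B (C (B x))) x = ell2_inner (C (B x)) (B x)" by (intro symB iB iC x)
      moreover have "ell2_inner (B (C (C x))) x = ell2_inner (B (C x)) (C x)"
        unfolding comm[OF iC[OF x], symmetric] by (intro symC iB iC x)
      ultimately show ?thesis by (subst e) (simp only: ell2_inner_add_left iB iC x)
    qed
    then show ?thesis using nnC[OF iB[OF x]] nnB[OF iC[OF x]] by simp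
  qed
  show ?thesis using x
  proof (induction "j + k" arbitrary: j k x rule: less_induct)
    case less
    consider j' where "j = Suc (Suc j')" | k' where "k = Suc (Suc k')" | "j \<le> 1" "k \<le> 1"
      by (metis One_nat_def not_less_eq_eq le_0_eq nat.exhaust le_Suc_eq)
    then show ?case
    proof cases
      case 1
      have "0 \<le> Re (ell2_inner ((B ^^ j') ((C ^^ k) (B x))) (B x))"
        by (rule less.hyps) (auto simp: 1 iB less.prems)
      then show ?thesis unfolding 1 BB[OF less.prems] .
    next
      case 2
      have "0 \<le> Re (ell2_inner ((B ^^ j) ((C ^^ k') (C x))) (C x))"
        by (rule less.hyps) (auto simp: 2 iC less.prems)
      then show ?thesis unfolding 2 CC[OF less.prems] .
    next
      case 3
      then show ?thesis
        using nnB[OF less.prems] nnC[OF less.prems] BC1[OF less.prems] less.prems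
        by (auto simp: le_Suc_eq ell2_inner_self)
    qed
  qed
qed

theorem selfadjoint_moment_measure:
  assumes A: "ell2_bounded_selfadjoint A" and R: "0 < R"
    and form: "\<And>x. x \<in> ell2 \<Longrightarrow> \<bar>Re (ell2_inner (A x) x)\<bar> \<le> R * (ell2_norm x)\<^sup>2"
    and v: "v \<in> ell2" "ell2_norm v = 1"
  obtains \<rho> where "real_distribution \<rho>" "AE x in \<rho>. \<bar>x\<bar> \<le> R"
    "\<And>k. (\<integral>x. x ^ k \<partial>\<rho>) = Re (ell2_inner ((A ^^ k) v) v)"
proof -
  have bo: "ell2_bounded_operator A" using A by (simp add: ell2_bounded_selfadjoint_def)
  have symA: "\<And>x y. x \<in> ell2 \<Longrightarrow> y \<in> ell2 \<Longrightarrow> ell2_inner (A x) y = ell2_inner x (A y)"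
    using A by (simp add: ell2_bounded_selfadjoint_def)
  have iA: "\<And>x. x \<in> ell2 \<Longrightarrow> A x \<in> ell2" using ell2_bounded_operatorD(1)[OF bo] .
  define h where "h = complex_of_real (1 / (2 * R))"
  define B where "B = (\<lambda>x n. h * A x n + (1 / 2) * x n)"
  define C where "C = (\<lambda>x n. x n - B x n)"
  have iB: "\<And>x. x \<in> ell2 \<Longrightarrow> B x \<in> ell2" unfolding B_def by (intro ell2_add ell2_scale iA)
  have Binner: "ell2_inner (B x) y = h * ell2_inner (A x) y + (1 / 2) * ell2_inner x y"
    if "x \<in> ell2" "y \<in> ell2" for x y
    unfolding B_def using that
    by (simp only: ell2_inner_add_left ell2_inner_scale_left ell2_scale iA)
  have Bform: "Re (ell2_inner (B x) x) = Re (ell2_inner (A x) x) / (2 * R) + (ell2_norm x)\<^sup>2 / 2"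
    if "x \<in> ell2" for x
    using that by (simp add: Binner ell2_inner_self h_def Re_divide_of_real del: of_real_power)
  have B: "ell2_bounded_selfadjoint B"
    unfolding ell2_bounded_selfadjoint_def ell2_bounded_operator_def
  proof (intro conjI ballI allI)
    obtain D where D: "D \<ge> 0" "\<And>x. x \<in> ell2 \<Longrightarrow> ell2_norm (A x) \<le> D * ell2_norm x"
      using ell2_bounded_operator_bound[OF bo] by blast
    show "\<exists>D. \<forall>x\<in>ell2. ell2_norm (B x) \<le> D * ell2_norm x"
    proof (intro exI[of _ "cmod h * D + 1 / 2"] ballI)
      fix x :: "nat \<Rightarrow> complex" assume x: "x \<in> ell2"
      have "ell2_norm (B x) \<le> ell2_norm (\<lambda>n. h * A x n) + ell2_norm (\<lambda>n. (1 / 2) * x n)"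
        unfolding B_def by (intro ell2_add ell2_scale iA x)
      also have "\<dots> = cmod h * ell2_norm (A x) + 1 / 2 * ell2_norm x"
        by (simp only: ell2_scale iA x) simp
      also have "\<dots> \<le> cmod h * (D * ell2_norm x) + 1 / 2 * ell2_norm x"
        using D(2)[OF x] by (intro add_mono mult_left_mono) auto
      finally show "ell2_norm (B x) \<le> (cmod h * D + 1 / 2) * ell2_norm x" by (simp add: algebra_simps)
    qed
    show "ell2_inner (B x) y = ell2_inner x (B y)" if "x \<in> ell2" "y \<in> ell2" for x y
    proof -
      have "ell2_inner x (B y) = cnj (ell2_inner (B y) x)" using that by (simp add: ell2_inner_cnj iB)
      also have "\<dots> = h * cnj (ell2_inner (A y) x) + (1 / 2) * cnj (ell2_inner y x)"
        using that by (simp add: Binner h_def)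
      also have "\<dots> = h * ell2_inner x (A y) + (1 / 2) * ell2_inner x y"
        using that by (simp only: ell2_inner_cnj iA)
      finally show ?thesis using that by (simp add: Binner symA)
    qed
    show "B (\<lambda>n. x n + y n) = (\<lambda>n. B x n + B y n)" if "x \<in> ell2" "y \<in> ell2" for x y
      using that by (simp add: B_def ell2_bounded_operatorD(2)[OF bo] algebra_simps add_divide_distrib)
    show "B (\<lambda>n. c * x n) = (\<lambda>n. c * B x n)" if "x \<in> ell2" for x c
      using that by (simp add: B_def ell2_bounded_operatorD(3)[OF bo] algebra_simps)
  qed (rule iB)
  have boB: "ell2_bounded_operator B" using B by (simp add: ell2_bounded_selfadjoint_def)
  have nn: "0 \<le> Re (ell2_inner (B x) x)" "0 \<le> Re (ell2_inner (C x) x)" if x: "x \<in> ell2" for x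
  proof -
    have "\<bar>Re (ell2_inner (A x) x) / (2 * R)\<bar> \<le> R * (ell2_norm x)\<^sup>2 / (2 * R)"
    proof -
      have "\<bar>Re (ell2_inner (A x) x)\<bar> / (2 * R) \<le> R * (ell2_norm x)\<^sup>2 / (2 * R)"
        by (rule divide_right_mono[OF form[OF x]]) (use R in simp)
      then show ?thesis using R by (simp only: abs_divide)
    qed
    then have *: "\<bar>Re (ell2_inner (A x) x) / (2 * R)\<bar> \<le> (ell2_norm x)\<^sup>2 / 2"
      using R by simp
    then show "0 \<le> Re (ell2_inner (B x) x)" unfolding Bform[OF x] by linarith
    have "Re (ell2_inner (C x) x) = (ell2_norm x)\<^sup>2 - Re (ell2_inner (B x) x)"
      using x by (simp add: C_def ell2_inner_diff_left iB ell2_inner_self del: of_real_power)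
    then show "0 \<le> Re (ell2_inner (C x) x)" using * unfolding Bform[OF x] by linarith
  qed
  define c where "c j k = Re (ell2_inner ((B ^^ j) ((C ^^ k) v)) v)" for j k
  have iBp: "(B ^^ n) x \<in> ell2" if "x \<in> ell2" for n x by (induction n) (auto simp: that iB)
  have iC: "\<And>x. x \<in> ell2 \<Longrightarrow> C x \<in> ell2" unfolding C_def by (intro ell2_diff iB)
  have iCp: "(C ^^ n) x \<in> ell2" if "x \<in> ell2" for n x by (induction n) (auto simp: that iC)
  have c_nn: "0 \<le> c j k" for j k
    unfolding c_def by (rule complementary_powers_nonneg[OF B C_def nn v(1)])
  have c_split: "c j k = c (Suc j) k + c j (Suc k)" for j k
  proof -
    let ?w = "(C ^^ k) v"
    have w: "?w \<in> ell2" using v iCp by simp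
    have "(B ^^ j) (C ?w) = (\<lambda>n. (B ^^ j) ?w n - (B ^^ j) (B ?w) n)"
      unfolding C_def[abs_def] using ell2_bounded_operatorD(4)[OF ell2_bounded_operator_funpow[OF boB] w iB[OF w]]
      by (simp add: C_def)
    then show ?thesis unfolding c_def
      using v w by (simp add: funpow_swap1 ell2_inner_diff_left iB iBp)
  qed
  have c_one: "c 0 0 = 1" unfolding c_def using v by (simp add: ell2_inner_self)
  obtain \<nu> where \<nu>: "real_distribution \<nu>" "AE x in \<nu>. 0 \<le> x \<and> x \<le> 1" "\<And>j. (\<integral>x. x ^ j \<partial>\<nu>) = c j 0"
    using hausdorff_moment_problem[OF c_nn c_split c_one] by blast
  interpret \<nu>: real_distribution \<nu> by (rule \<nu>(1))
  \<comment> \<open>The inverse of the affine map that took \<open>A\<close> to \<open>B\<close>: it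
    carries [0, 1] back to [-R, R].\<close>
  define g where "g y = R * (2 * y - 1)" for y :: real
  have g [measurable]: "g \<in> borel_measurable borel" unfolding g_def[abs_def] by simp
  have int: "integrable \<nu> (\<lambda>y. g y ^ k * y ^ j)" for k j
  proof (rule \<nu>.integrable_const_bound[where B = "R ^ k"])
    show "AE y in \<nu>. norm (g y ^ k * y ^ j) \<le> R ^ k"
      using \<nu>(2)
    proof eventually_elim
      case (elim y)
      have "\<bar>g y\<bar> \<le> R"
        unfolding g_def abs_mult using R elim mult_left_mono[of "\<bar>2 * y - 1\<bar>" 1 R] by auto
      then have "\<bar>g y\<bar> ^ k * \<bar>y\<bar> ^ j \<le> R ^ k * 1"
        using elim R by (intro mult_mono power_mono power_le_one) auto
      then show ?case by (simp add: abs_mult power_abs)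
    qed
  qed simp
  \<comment> \<open>The extra power of \<open>y\<close> makes the induction go through:
    \<open>A = 2 R B - R\<close> trades one factor of \<open>A\<close> for one of \<open>B\<close>,
    exactly as \<open>g\<close> trades for \<open>y\<close>.\<close>
  have mom: "(\<integral>y. g y ^ k * y ^ j \<partial>\<nu>) = Re (ell2_inner ((A ^^ k) ((B ^^ j) v)) v)" for k j
  proof (induction k arbitrary: j)
    case 0
    then show ?case using \<nu>(3)[of j] by (simp add: c_def)
  next
    case (Suc k)
    let ?w = "(B ^^ j) v"
    have w: "?w \<in> ell2" using v iBp by simp
    have Ap: "ell2_bounded_operator (A ^^ k)" by (rule ell2_bounded_operator_funpow[OF bo])
    have i: "(A ^^ k) (B ?w) \<in> ell2" "(A ^^ k) ?w \<in> ell2"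
      using ell2_bounded_operatorD(1)[OF Ap] w iB by auto
    let ?r = "complex_of_real R"
    have "A ?w = (\<lambda>n. (2 * ?r) * B ?w n - ?r * ?w n)"
      using R by (auto simp: B_def h_def fun_eq_iff field_simps)
    then have "(A ^^ k) (A ?w) = (\<lambda>n. (2 * ?r) * (A ^^ k) (B ?w) n - ?r * (A ^^ k) ?w n)"
      using ell2_bounded_operatorD(4)[OF Ap ell2_scale(1)[OF iB[OF w]] ell2_scale(1)[OF w], of "2 * ?r" ?r]
        ell2_bounded_operatorD(3)[OF Ap iB[OF w], of "2 * ?r"] ell2_bounded_operatorD(3)[OF Ap w, of ?r]
      by simp
    then have "ell2_inner ((A ^^ Suc k) ?w) v = (2 * ?r) * ell2_inner ((A ^^ k) (B ?w)) v - ?r * ell2_inner ((A ^^ k) ?w) v"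
      using v i by (simp only: funpow_Suc_right o_apply ell2_inner_diff_left ell2_inner_scale_left ell2_scale)
    then have "Re (ell2_inner ((A ^^ Suc k) ?w) v)
        = 2 * R * Re (ell2_inner ((A ^^ k) ((B ^^ Suc j) v)) v) - R * Re (ell2_inner ((A ^^ k) ?w) v)"
      by simp
    also have "\<dots> = 2 * R * (\<integral>y. g y ^ k * y ^ Suc j \<partial>\<nu>) - R * (\<integral>y. g y ^ k * y ^ j \<partial>\<nu>)"
      by (simp only: Suc.IH)
    also have "\<dots> = (\<integral>y. 2 * R * (g y ^ k * y ^ Suc j) - R * (g y ^ k * y ^ j) \<partial>\<nu>)"
      by (subst Bochner_Integration.integral_diff) (use int in \<open>auto simp del: power_Suc\<close>)
    also have "\<dots> = (\<integral>y. g y ^ Suc k * y ^ j \<partial>\<nu>)"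
      by (rule Bochner_Integration.integral_cong) (auto simp: g_def algebra_simps)
    finally show ?case by simp
  qed
  define \<rho> where "\<rho> = distr \<nu> borel g"
  show thesis
  proof (rule that[of \<rho>])
    show "real_distribution \<rho>" unfolding \<rho>_def by (rule \<nu>.real_distribution_distr) simp
    show "AE x in \<rho>. \<bar>x\<bar> \<le> R"
      unfolding \<rho>_def
    proof (subst AE_distr_iff)
      show "AE y in \<nu>. \<bar>g y\<bar> \<le> R"
        using \<nu>(2)
      proof eventually_elim
        case (elim y)
        then show ?case
          unfolding g_def abs_mult using R mult_left_mono[of "\<bar>2 * y - 1\<bar>" 1 R] by auto
      qed
    qed auto
    show "(\<integral>x. x ^ k \<partial>\<rho>) = Re (ell2_inner ((A ^^ k) v) v)" for k
      unfolding \<rho>_def using mom[of k 0] by (subst integral_distr) auto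
  qed
qed

text \<open>The square root converts the orthonormal basis of the symmetric matrix into the monic
  normalization of \<open>jacobi_moment\<close>; at \<open>n = 0\<close> it is 1, so the moments
  themselves agree.\<close>

lemma lax_power_unit:
  assumes "\<And>n. 0 \<le> a n"
  shows "((lax_operator a ^^ k) (ell2_unit 0)) n * complex_of_real (sqrt (\<Prod>j<n. a j))
    = complex_of_real (jacobi_moment a n k)"
proof (induction k arbitrary: n)
  case 0
  then show ?case by (simp add: ell2_unit_def)
next
  case (Suc k)
  define y where "y = (lax_operator a ^^ k) (ell2_unit 0)"
  define h where "h n = complex_of_real (sqrt (\<Prod>j<n. a j))" for n
  define s where "s n = complex_of_real (sqrt (a n))" for n
  have h: "h (Suc n) = h n * s n" for n
    by (simp add: real_sqrt_mult h_def s_def)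
  have sq: "s n * s n = complex_of_real (a n)" for n
    using assms[of n] by (simp add: s_def flip: of_real_mult)
  have IH: "y n * h n = complex_of_real (jacobi_moment a n k)" for n
    using Suc.IH[of n] by (simp only: y_def h_def)
  have step: "((lax_operator a ^^ Suc k) (ell2_unit 0)) n = s n * y (Suc n) + (if n = 0 then 0 else s (n - 1) * y (n - 1))"
    by (simp only: funpow.simps o_apply y_def[symmetric] lax_operator_eq s_def)
  have 1: "s n * y (Suc n) * h n = complex_of_real (jacobi_moment a (Suc n) k)"
    using IH[of "Suc n"] unfolding h by (simp only: mult_ac)
  have "((lax_operator a ^^ Suc k) (ell2_unit 0)) n * h n = complex_of_real (jacobi_moment a n (Suc k))"
  proof (cases n)
    case 0
    then show ?thesis using 1 unfolding step by simp
  next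
    case (Suc m)
    have "s m * y m * h n = (s m * s m) * (y m * h m)"
      unfolding Suc h by (simp only: mult_ac)
    then have "s m * y m * h n = complex_of_real (a m * jacobi_moment a m k)"
      by (simp only: sq IH of_real_mult)
    then show ?thesis using 1 unfolding step by (simp add: Suc distrib_right)
  qed
  then show ?case by (simp only: h_def)
qed

theorem favard:
  assumes pos: "\<And>n. 0 < a n" and M: "\<And>n. a n \<le> M"
  obtains \<rho> where "real_distribution \<rho>" "AE x in \<rho>. \<bar>x\<bar> \<le> 2 * sqrt M" "moment \<rho> = jacobi_moment a 0"
proof -
  have nn: "0 \<le> a n" for n using pos[of n] by simp
  have M0: "0 < M" using pos[of 0] M[of 0] by linarith
  have form: "\<bar>Re (ell2_inner (lax_operator a x) x)\<bar> \<le> (2 * sqrt M) * (ell2_norm x)\<^sup>2" if x: "x \<in> ell2" for x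
  proof -
    note b = lax_operator_bounded[of a M, OF M nn]
    have "\<bar>Re (ell2_inner (lax_operator a x) x)\<bar> \<le> cmod (ell2_inner (lax_operator a x) x)"
      by (rule abs_Re_le_cmod)
    also have "\<dots> \<le> ell2_norm (lax_operator a x) * ell2_norm x"
      using x by (intro ell2_cauchy_schwarz ell2_bounded_operatorD(1)[OF b(1)])
    also have "\<dots> \<le> (2 * sqrt M * ell2_norm x) * ell2_norm x"
      using b(2)[OF x] ell2_norm_nonneg[OF x] by (rule mult_right_mono)
    finally show ?thesis by (simp add: power2_eq_square)
  qed
  obtain \<rho> where \<rho>: "real_distribution \<rho>" "AE x in \<rho>. \<bar>x\<bar> \<le> 2 * sqrt M"
    "\<And>k. (\<integral>x. x ^ k \<partial>\<rho>) = Re (ell2_inner ((lax_operator a ^^ k) (ell2_unit 0)) (ell2_unit 0))"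
    using selfadjoint_moment_measure[OF lax_operator_selfadjoint[of a M, OF M nn] _ form ell2_unit ell2_norm_unit, of 0] M0
    by auto
  have "moment \<rho> k = jacobi_moment a 0 k" for k
  proof -
    have "(lax_operator a ^^ k) (ell2_unit 0) 0 = complex_of_real (jacobi_moment a 0 k)"
      using lax_power_unit[of a k 0, OF nn] by simp
    then show ?thesis unfolding moment_def \<rho>(3) ell2_inner_unit_right by simp
  qed
  with \<rho> that show thesis by blast
qed

section \<open>Orthonormal polynomials and Parseval's identity\<close>

fun orthonormal_poly :: "(nat \<Rightarrow> real) \<Rightarrow> nat \<Rightarrow> real \<Rightarrow> real" where
  "orthonormal_poly a 0 x = 1"
| "orthonormal_poly a (Suc 0) x = x / sqrt (a 0)"
| "orthonormal_poly a (Suc (Suc n)) x =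
     (x * orthonormal_poly a (Suc n) x - sqrt (a n) * orthonormal_poly a n x) / sqrt (a (Suc n))"

lemma orthonormal_poly_recurrence:
  assumes "\<And>n. 0 < a n"
  shows "x * orthonormal_poly a n x = sqrt (a n) * orthonormal_poly a (Suc n) x
    + (if n = 0 then 0 else sqrt (a (n - 1)) * orthonormal_poly a (n - 1) x)"
proof (cases n)
  case 0
  then show ?thesis using assms[of 0] by simp
next
  case (Suc m)
  then show ?thesis using assms[of n] by simp
qed

locale jacobi_measure = real_distribution \<rho> for \<rho> +
  fixes a :: "nat \<Rightarrow> real" and R :: real
  assumes pos: "\<And>n. 0 < a n" and supp: "AE x in \<rho>. \<bar>x\<bar> \<le> R"
    and mom: "moment \<rho> = jacobi_moment a 0"
begin

abbreviation b where "b n \<equiv> sqrt (a n)"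
abbreviation p where "p \<equiv> orthonormal_poly a"

lemma b_pos: "0 < b n" using pos[of n] by simp

text \<open>Polynomials are bounded on the support but not on the line. Essential boundedness is a
  class closed under sums and products that contains them and the indicators, so integrability never
  has to be argued separately.\<close>

definition bdd :: "(real \<Rightarrow> real) \<Rightarrow> bool" where
  "bdd f \<longleftrightarrow> f \<in> borel_measurable borel \<and> (\<exists>K. AE x in \<rho>. \<bar>f x\<bar> \<le> K)"

lemma bdd_measurable [measurable_dest]: "bdd f \<Longrightarrow> f \<in> borel_measurable borel"
  by (simp add: bdd_def)

lemma bddE:
  assumes "bdd f"
  obtains K where "0 < K" "AE x in \<rho>. \<bar>f x\<bar> \<le> K"
proof -
  obtain K where "AE x in \<rho>. \<bar>f x\<bar> \<le> K" using assms by (auto simp: bdd_def)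
  then have "AE x in \<rho>. \<bar>f x\<bar> \<le> max 1 K" by eventually_elim auto
  then show thesis by (intro that[of "max 1 K"]) auto
qed

lemma bdd_integrable [simp, intro]: "bdd f \<Longrightarrow> integrable \<rho> f"
  unfolding bdd_def by (elim conjE exE, rule integrable_const_bound) auto

lemma bdd_add [simp, intro]:
  assumes "bdd f" "bdd g" shows "bdd (\<lambda>x. f x + g x)"
proof -
  obtain K where K: "AE x in \<rho>. \<bar>f x\<bar> \<le> K" using assms(1) by (auto simp: bdd_def)
  obtain L where L: "AE x in \<rho>. \<bar>g x\<bar> \<le> L" using assms(2) by (auto simp: bdd_def)
  have "AE x in \<rho>. \<bar>f x + g x\<bar> \<le> K + L" using K L by eventually_elim auto
  then show ?thesis using assms unfolding bdd_def by auto
qed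

lemma bdd_mult [simp, intro]:
  assumes "bdd f" "bdd g" shows "bdd (\<lambda>x. f x * g x)"
proof -
  obtain K where K: "0 < K" "AE x in \<rho>. \<bar>f x\<bar> \<le> K" using assms(1) by (rule bddE)
  obtain L where L: "0 < L" "AE x in \<rho>. \<bar>g x\<bar> \<le> L" using assms(2) by (rule bddE)
  have "AE x in \<rho>. \<bar>f x * g x\<bar> \<le> K * L"
    using K(2) L(2) by eventually_elim (use K(1) in \<open>auto simp: abs_mult intro!: mult_mono\<close>)
  then show ?thesis using assms unfolding bdd_def by auto
qed

lemma bdd_const [simp, intro]: "bdd (\<lambda>x. c)"
  unfolding bdd_def by auto

lemma bdd_diff [simp, intro]: "bdd f \<Longrightarrow> bdd g \<Longrightarrow> bdd (\<lambda>x. f x - g x)"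
  using bdd_add[of f "\<lambda>x. - 1 * g x"] bdd_mult[OF bdd_const[of "-1"], of g] by simp

lemma bdd_power [simp, intro]: "bdd f \<Longrightarrow> bdd (\<lambda>x. f x ^ n)"
  by (induction n) auto

lemma bdd_sum [simp, intro]: "(\<And>i. i \<in> I \<Longrightarrow> bdd (f i)) \<Longrightarrow> bdd (\<lambda>x. \<Sum>i\<in>I. f i x)"
  by (induction I rule: infinite_finite_induct) auto

lemma bdd_id [simp, intro]: "bdd (\<lambda>x. x)"
  using supp unfolding bdd_def by auto

lemma bdd_indicator [simp, intro]: "B \<in> sets borel \<Longrightarrow> bdd (indicator B)"
  unfolding bdd_def by (auto intro!: exI[of _ 1] simp: indicator_def)

lemma bdd_p [simp, intro]: "bdd (p n)"
proof (induction n rule: less_induct)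
  case (less n)
  consider "n = 0" | "n = Suc 0" | m where "n = Suc (Suc m)" by (metis nat.exhaust)
  then show ?case
  proof cases
    case (3 m)
    have "p n = (\<lambda>x. (1 / b (Suc m)) * (x * p (Suc m) x - b m * p m x))" by (auto simp: 3)
    moreover have "bdd (p (Suc m))" "bdd (p m)" using less 3 by auto
    ultimately show ?thesis by (simp only:) (intro bdd_mult bdd_diff bdd_const bdd_id; assumption)
  next
    case 2
    have "p n = (\<lambda>x. (1 / b 0) * x)" by (auto simp: 2)
    then show ?thesis by (simp only:) (intro bdd_mult bdd_const bdd_id)
  next
    case 1
    have "p n = (\<lambda>x. 1)" by (auto simp: 1)
    then show ?thesis by (simp only: bdd_const)
  qed
qed

lemma p_measurable [measurable]: "p n \<in> borel_measurable borel"
  using bdd_p bdd_measurable by blast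

lemma p_rec: "x * p n x = b n * p (Suc n) x + (if n = 0 then 0 else b (n - 1) * p (n - 1) x)"
  by (rule orthonormal_poly_recurrence[OF pos])

text \<open>The recurrence solved for the highest polynomial is, after rescaling by the square root,
  the identity \<open>jacobi_moment_Suc_left\<close>. This gives \<open>jacobi_moment\<close> its
  meaning as an integral.\<close>

lemma moment_p: "(\<integral>x. x ^ k * p n x \<partial>\<rho>) * sqrt (\<Prod>j<n. a j) = jacobi_moment a n k"
proof (induction n arbitrary: k rule: less_induct)
  case (less n)
  show ?case
  proof (cases n)
    case 0
    then show ?thesis using fun_cong[OF mom, of k] by (simp add: moment_def)
  next
    case (Suc m)
    have "(\<integral>x. x ^ Suc k * p m x \<partial>\<rho>) = (\<integral>x. b m * (x ^ k * p n x)
        + (if m = 0 then 0 else b (m - 1)) * (x ^ k * p (m - 1) x) \<partial>\<rho>)"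
    proof (rule Bochner_Integration.integral_cong[OF refl])
      fix x
      have "x ^ Suc k * p m x = x ^ k * (x * p m x)" by simp
      also have "\<dots> = b m * (x ^ k * p n x) + (if m = 0 then 0 else b (m - 1)) * (x ^ k * p (m - 1) x)"
        unfolding p_rec by (simp add: Suc algebra_simps)
      finally show "x ^ Suc k * p m x = b m * (x ^ k * p n x) + (if m = 0 then 0 else b (m - 1)) * (x ^ k * p (m - 1) x)" .
    qed
    also have "\<dots> = b m * (\<integral>x. x ^ k * p n x \<partial>\<rho>)
        + (if m = 0 then 0 else b (m - 1)) * (\<integral>x. x ^ k * p (m - 1) x \<partial>\<rho>)"
      by (subst Bochner_Integration.integral_add) auto
    finally have e: "b m * (\<integral>x. x ^ k * p n x \<partial>\<rho>) = (\<integral>x. x ^ Suc k * p m x \<partial>\<rho>)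
        - (if m = 0 then 0 else b (m - 1)) * (\<integral>x. x ^ k * p (m - 1) x \<partial>\<rho>)" by simp
    have h: "sqrt (\<Prod>j<n. a j) = b m * sqrt (\<Prod>j<m. a j)" by (simp add: Suc real_sqrt_mult)
    have "(\<integral>x. x ^ k * p n x \<partial>\<rho>) * sqrt (\<Prod>j<n. a j)
      = (b m * (\<integral>x. x ^ k * p n x \<partial>\<rho>)) * sqrt (\<Prod>j<m. a j)" unfolding h by simp
    also have "\<dots> = (\<integral>x. x ^ Suc k * p m x \<partial>\<rho>) * sqrt (\<Prod>j<m. a j)
        - (if m = 0 then 0 else b (m - 1)) * (\<integral>x. x ^ k * p (m - 1) x \<partial>\<rho>) * sqrt (\<Prod>j<m. a j)"
      unfolding e by (simp add: left_diff_distrib)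
    also have "(if m = 0 then 0 else b (m - 1)) * (\<integral>x. x ^ k * p (m - 1) x \<partial>\<rho>) * sqrt (\<Prod>j<m. a j)
       = (if m = 0 then 0 else a (m - 1) * jacobi_moment a (m - 1) k)"
    proof (cases m)
      case (Suc l)
      have "b l * (\<integral>x. x ^ k * p l x \<partial>\<rho>) * sqrt (\<Prod>j<m. a j)
         = (b l * b l) * ((\<integral>x. x ^ k * p l x \<partial>\<rho>) * sqrt (\<Prod>j<l. a j))"
        unfolding Suc by (simp add: real_sqrt_mult)
      also have "\<dots> = a l * jacobi_moment a l k"
        using less.IH[of l k] pos[of l] \<open>n = Suc m\<close> Suc by simp
      finally show ?thesis by (simp add: Suc)
    qed simp
    also have "(\<integral>x. x ^ Suc k * p m x \<partial>\<rho>) * sqrt (\<Prod>j<m. a j) = jacobi_moment a m (Suc k)"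
      using less.IH[of m "Suc k"] Suc by blast
    finally show ?thesis unfolding Suc jacobi_moment_Suc_left .
  qed
qed

lemma integral_p: "(\<integral>x. p n x \<partial>\<rho>) = (if n = 0 then 1 else 0)"
proof (cases "n = 0")
  case True
  then show ?thesis using moment_p[of 0 0] by simp
next
  case False
  have "sqrt (\<Prod>j<n. a j) > 0" by (simp add: prod_pos pos)
  then show ?thesis using moment_p[of 0 n] False by (simp del: prod_zero_iff)
qed

lemma integral_x_p:
  assumes f: "bdd f"
  shows "(\<integral>x. f x * (x * p n x) \<partial>\<rho>) = b n * (\<integral>x. f x * p (Suc n) x \<partial>\<rho>)
    + (if n = 0 then 0 else b (n - 1) * (\<integral>x. f x * p (n - 1) x \<partial>\<rho>))"
proof -
  have "(\<integral>x. f x * (x * p n x) \<partial>\<rho>) = (\<integral>x. b n * (f x * p (Suc n) x)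
     + (if n = 0 then 0 else b (n - 1)) * (f x * p (n - 1) x) \<partial>\<rho>)"
    unfolding p_rec by (rule Bochner_Integration.integral_cong) (auto simp: algebra_simps)
  also have "\<dots> = b n * (\<integral>x. f x * p (Suc n) x \<partial>\<rho>)
     + (if n = 0 then 0 else b (n - 1)) * (\<integral>x. f x * p (n - 1) x \<partial>\<rho>)"
    using f by (subst Bochner_Integration.integral_add) auto
  finally show ?thesis by auto
qed

text \<open>A factor \<open>x\<close> is moved from one polynomial to the other, so that the second
  index can be lowered while the first varies; the induction ends at \<open>p 0 = 1\<close>, where
  the integral is a level-zero-power moment.\<close>

lemma orthonormal: "(\<integral>x. p n x * p m x \<partial>\<rho>) = (if n = m then 1 else 0)"
proof (induction m arbitrary: n rule: less_induct)
  case (less m)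
  consider "m = 0" | l where "m = Suc l" by (cases m) auto
  then show ?case
  proof cases
    case 1
    then show ?thesis by (simp add: integral_p)
  next
    case (2 l)
    have "b l * (\<integral>x. p n x * p m x \<partial>\<rho>) = (\<integral>x. p n x * (x * p l x) \<partial>\<rho>)
       - (if l = 0 then 0 else b (l - 1) * (\<integral>x. p n x * p (l - 1) x \<partial>\<rho>))"
      using integral_x_p[OF bdd_p, of n l] 2 by simp
    also have "(\<integral>x. p n x * (x * p l x) \<partial>\<rho>) = (\<integral>x. p l x * (x * p n x) \<partial>\<rho>)"
      by (rule Bochner_Integration.integral_cong) auto
    also have "\<dots> = b n * (\<integral>x. p (Suc n) x * p l x \<partial>\<rho>)
       + (if n = 0 then 0 else b (n - 1) * (\<integral>x. p (n - 1) x * p l x \<partial>\<rho>))"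
      using integral_x_p[OF bdd_p, of l n] by (simp add: mult.commute)
    moreover have I: "(\<integral>x. p n x * p l x \<partial>\<rho>) = (if n = l then 1 else 0)" for n
      using less.IH[of l] 2 by simp
    moreover have "(if l = 0 then 0 else b (l - 1) * (\<integral>x. p n x * p (l - 1) x \<partial>\<rho>))
       = (if l = 0 then 0 else b (l - 1) * (if n = l - 1 then 1 else 0))"
      using less.IH[of "l - 1"] 2 by simp
    ultimately have "b l * (\<integral>x. p n x * p m x \<partial>\<rho>) = b n * (if Suc n = l then 1 else 0)
       + (if n = 0 then 0 else b (n - 1) * (if n - 1 = l then 1 else 0))
       - (if l = 0 then 0 else b (l - 1) * (if n = l - 1 then 1 else 0))"
      by (simp only: I)
    also have "\<dots> = b l * (if n = m then 1 else 0)"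
      using 2 by auto
    finally show ?thesis using b_pos[of l] by simp
  qed
qed

text \<open>These are all polynomials, presented as the span of the \<open>p n\<close> so that
  expansion coefficients are at hand.\<close>

definition S :: "(real \<Rightarrow> real) set" where
  "S = {f. \<exists>N d. f = (\<lambda>x. \<Sum>n<N. d n * p n x)}"

lemma S_add:
  assumes "f \<in> S" "g \<in> S" shows "(\<lambda>x. f x + g x) \<in> S"
proof -
  obtain N d M e where f: "f = (\<lambda>x. \<Sum>n<N. d n * p n x)" and g: "g = (\<lambda>x. \<Sum>n<M. e n * p n x)"
    using assms by (auto simp: S_def)
  have "f x + g x = (\<Sum>n<N + M. ((if n < N then d n else 0) + (if n < M then e n else 0)) * p n x)" for x
  proof -
    have "(\<Sum>n<N. d n * p n x) = (\<Sum>n<N + M. (if n < N then d n else 0) * p n x)"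
      by (rule sum.mono_neutral_cong_left) auto
    moreover have "(\<Sum>n<M. e n * p n x) = (\<Sum>n<N + M. (if n < M then e n else 0) * p n x)"
      by (rule sum.mono_neutral_cong_left) auto
    ultimately show ?thesis by (simp only: f g distrib_right sum.distrib)
  qed
  then show ?thesis unfolding S_def mem_Collect_eq by (intro exI ext)
qed

lemma S_scale:
  assumes "f \<in> S" shows "(\<lambda>x. c * f x) \<in> S"
proof -
  obtain N d where f: "f = (\<lambda>x. \<Sum>n<N. d n * p n x)"
    using assms by (auto simp: S_def)
  have "c * f x = (\<Sum>n<N. (c * d n) * p n x)" for x by (simp add: f sum_distrib_left mult.assoc)
  then show ?thesis unfolding S_def mem_Collect_eq by (intro exI ext)
qed

lemma S_p: "p n \<in> S"
proof -
  have "p n x = (\<Sum>k<Suc n. (if k = n then 1 else 0) * p k x)" for x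
    by simp
  then show ?thesis unfolding S_def mem_Collect_eq by (intro exI ext)
qed

lemma S_zero: "(\<lambda>x. 0) \<in> S"
  using S_scale[OF S_p[of 0], of 0] by simp

lemma S_sum: "(\<And>i. i \<in> I \<Longrightarrow> f i \<in> S) \<Longrightarrow> (\<lambda>x. \<Sum>i\<in>I. f i x) \<in> S"
  by (induction I rule: infinite_finite_induct) (auto intro: S_add S_zero)

lemma S_mult_x:
  assumes "f \<in> S" shows "(\<lambda>x. x * f x) \<in> S"
proof -
  obtain N d where f: "f = (\<lambda>x. \<Sum>n<N. d n * p n x)" using assms by (auto simp: S_def)
  have "(\<lambda>x. x * p n x) \<in> S" for n
    unfolding p_rec by (cases "n = 0") (auto intro!: S_add S_scale S_p S_zero simp del: orthonormal_poly.simps)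
  then have "(\<lambda>x. \<Sum>n<N. d n * (x * p n x)) \<in> S"
    by (intro S_sum S_scale)
  then show ?thesis by (simp add: f sum_distrib_left algebra_simps)
qed

lemma S_power: "(\<lambda>x. x ^ k) \<in> S"
proof (induction k)
  case 0
  have "p 0 = (\<lambda>x. x ^ 0)" by (rule ext) simp
  then show ?case using S_p[of 0] by (simp only:)
next
  case (Suc k)
  then show ?case using S_mult_x[of "\<lambda>x. x ^ k"] by simp
qed

lemma S_mult_p:
  assumes "f \<in> S" shows "(\<lambda>x. p n x * f x) \<in> S"
proof (induction n rule: less_induct)
  case (less n)
  consider "n = 0" | "n = Suc 0" | m where "n = Suc (Suc m)" by (metis nat.exhaust)
  then show ?case
  proof cases
    case (3 m)
    have "(\<lambda>x. p n x * f x) = (\<lambda>x. (1 / b (Suc m)) * (x * (p (Suc m) x * f x) + (- b m) * (p m x * f x)))"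
      by (auto simp: 3 field_simps)
    moreover have "(\<lambda>x. p (Suc m) x * f x) \<in> S" "(\<lambda>x. p m x * f x) \<in> S" using less 3 by auto
    ultimately show ?thesis by (simp only:) (intro S_scale S_add S_mult_x)
  next
    case 2
    have "(\<lambda>x. p n x * f x) = (\<lambda>x. (1 / b 0) * (x * f x))" by (auto simp: 2)
    then show ?thesis using assms by (simp only:) (intro S_scale S_mult_x)
  next
    case 1
    then show ?thesis using assms by simp
  qed
qed

lemma bdd_S: "f \<in> S \<Longrightarrow> bdd f"
  by (auto simp: S_def)

text \<open>Membership in the mean-square closure of the polynomials, restricted to essentially
  bounded functions. Completeness of the \<open>p n\<close> is proved in this form, up to indicators
  of Borel sets.\<close>

definition approximable :: "(real \<Rightarrow> real) \<Rightarrow> bool" where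
  "approximable f \<longleftrightarrow> bdd f \<and> (\<forall>e>0. \<exists>g\<in>S. (\<integral>x. (f x - g x)\<^sup>2 \<partial>\<rho>) < e)"

lemma approximable_S: "f \<in> S \<Longrightarrow> approximable f"
  unfolding approximable_def by (auto intro!: bdd_S bexI[of _ f])

lemma integral_sq_triangle:
  assumes "bdd f" "bdd g" "bdd h"
  shows "(\<integral>x. (f x - h x)\<^sup>2 \<partial>\<rho>) \<le> 2 * (\<integral>x. (f x - g x)\<^sup>2 \<partial>\<rho>) + 2 * (\<integral>x. (g x - h x)\<^sup>2 \<partial>\<rho>)"
proof -
  have "(\<integral>x. (f x - h x)\<^sup>2 \<partial>\<rho>) \<le> (\<integral>x. 2 * (f x - g x)\<^sup>2 + 2 * (g x - h x)\<^sup>2 \<partial>\<rho>)"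
  proof (rule integral_mono)
    fix x
    have "2 * (f x - g x)\<^sup>2 + 2 * (g x - h x)\<^sup>2 - (f x - h x)\<^sup>2 = ((f x - g x) - (g x - h x))\<^sup>2"
      by (simp add: power2_eq_square algebra_simps)
    then show "(f x - h x)\<^sup>2 \<le> 2 * (f x - g x)\<^sup>2 + 2 * (g x - h x)\<^sup>2"
      using zero_le_power2[of "(f x - g x) - (g x - h x)"] by linarith
  qed (use assms in auto)
  also have "\<dots> = 2 * (\<integral>x. (f x - g x)\<^sup>2 \<partial>\<rho>) + 2 * (\<integral>x. (g x - h x)\<^sup>2 \<partial>\<rho>)"
    using assms by (subst Bochner_Integration.integral_add) auto
  finally show ?thesis .
qed

lemma approximable_limit:
  assumes "bdd f" and "\<And>e. e > 0 \<Longrightarrow> \<exists>g. approximable g \<and> (\<integral>x. (f x - g x)\<^sup>2 \<partial>\<rho>) < e"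
  shows "approximable f"
  unfolding approximable_def
proof (intro conjI allI impI)
  fix e :: real assume e: "e > 0"
  obtain g where g: "approximable g" "(\<integral>x. (f x - g x)\<^sup>2 \<partial>\<rho>) < e / 4" using assms(2)[of "e / 4"] e by auto
  obtain h where h: "h \<in> S" "(\<integral>x. (g x - h x)\<^sup>2 \<partial>\<rho>) < e / 4" using g(1) e unfolding approximable_def
    by (meson zero_less_divide_iff zero_less_numeral)
  have "(\<integral>x. (f x - h x)\<^sup>2 \<partial>\<rho>) < e"
    using integral_sq_triangle[OF assms(1) _ bdd_S[OF h(1)], of g] g h by (auto simp: approximable_def)
  then show "\<exists>g\<in>S. (\<integral>x. (f x - g x)\<^sup>2 \<partial>\<rho>) < e" using h by blast
qed (rule assms(1))

lemma approximable_add: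
  assumes "approximable f" "approximable g" shows "approximable (\<lambda>x. f x + g x)"
  unfolding approximable_def
proof (intro conjI allI impI)
  show "bdd (\<lambda>x. f x + g x)" using assms by (auto simp: approximable_def)
  fix e :: real assume e: "e > 0"
  obtain h where h: "h \<in> S" "(\<integral>x. (f x - h x)\<^sup>2 \<partial>\<rho>) < e / 4"
    using assms(1) e unfolding approximable_def by (meson zero_less_divide_iff zero_less_numeral)
  obtain k where k: "k \<in> S" "(\<integral>x. (g x - k x)\<^sup>2 \<partial>\<rho>) < e / 4"
    using assms(2) e unfolding approximable_def by (meson zero_less_divide_iff zero_less_numeral)
  have bd: "bdd f" "bdd g" "bdd h" "bdd k" using assms h k bdd_S by (auto simp: approximable_def)
  have "(\<integral>x. ((f x + g x) - (h x + k x))\<^sup>2 \<partial>\<rho>)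
      \<le> 2 * (\<integral>x. ((f x + g x) - (h x + g x))\<^sup>2 \<partial>\<rho>) + 2 * (\<integral>x. ((h x + g x) - (h x + k x))\<^sup>2 \<partial>\<rho>)"
    using bd by (intro integral_sq_triangle) auto
  also have "\<dots> < e" using h k by simp
  finally show "\<exists>q\<in>S. (\<integral>x. ((f x + g x) - q x)\<^sup>2 \<partial>\<rho>) < e" using S_add[OF h(1) k(1)]
    by (intro bexI[of _ "\<lambda>x. h x + k x"]) auto
qed

lemma approximable_mult:
  assumes "approximable f" "q \<in> S" and SS: "\<And>g. g \<in> S \<Longrightarrow> (\<lambda>x. q x * g x) \<in> S"
  shows "approximable (\<lambda>x. q x * f x)"
  unfolding approximable_def
proof (intro conjI allI impI)
  have bq: "bdd q" "bdd f" using assms bdd_S by (auto simp: approximable_def)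
  then show "bdd (\<lambda>x. q x * f x)" by auto
  obtain K where K: "0 < K" "AE x in \<rho>. \<bar>q x\<bar> \<le> K" using bq(1) by (rule bddE)
  fix e :: real assume e: "e > 0"
  have "e / K\<^sup>2 > 0" using e K by simp
  then obtain g where g: "g \<in> S" "(\<integral>x. (f x - g x)\<^sup>2 \<partial>\<rho>) < e / K\<^sup>2"
    using assms(1) unfolding approximable_def by blast
  have bg: "bdd g" using g bdd_S by simp
  have "(\<integral>x. (q x * f x - q x * g x)\<^sup>2 \<partial>\<rho>) \<le> (\<integral>x. K\<^sup>2 * (f x - g x)\<^sup>2 \<partial>\<rho>)"
  proof (rule integral_mono_AE)
    show "AE x in \<rho>. (q x * f x - q x * g x)\<^sup>2 \<le> K\<^sup>2 * (f x - g x)\<^sup>2"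
      using K(2)
    proof eventually_elim
      case (elim x)
      have "(q x)\<^sup>2 \<le> K\<^sup>2" using elim K(1) by (simp add: abs_le_square_iff[symmetric])
      then have "(q x)\<^sup>2 * (f x - g x)\<^sup>2 \<le> K\<^sup>2 * (f x - g x)\<^sup>2" by (rule mult_right_mono) simp
      then show ?case by (simp add: right_diff_distrib[symmetric] power_mult_distrib)
    qed
  qed (use bq bg in auto)
  also have "\<dots> = K\<^sup>2 * (\<integral>x. (f x - g x)\<^sup>2 \<partial>\<rho>)" by simp
  also have "\<dots> < e" using g(2) K(1) by (simp add: field_simps)
  finally show "\<exists>h\<in>S. (\<integral>x. (q x * f x - h x)\<^sup>2 \<partial>\<rho>) < e" using SS[OF g(1)]
    by (intro bexI[of _ "\<lambda>x. q x * g x"]) auto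
qed

lemma approximable_scale: "approximable f \<Longrightarrow> approximable (\<lambda>x. c * f x)"
  using approximable_mult[of f "\<lambda>x. c"] S_scale S_scale[OF S_p[of 0], of c] by simp

lemma approximable_x: "approximable f \<Longrightarrow> approximable (\<lambda>x. x * f x)"
  using approximable_mult[of f "\<lambda>x. x"] S_mult_x S_power[of 1] by simp

lemma approximable_p: "approximable f \<Longrightarrow> approximable (\<lambda>x. p n x * f x)"
  by (rule approximable_mult) (auto intro: S_p S_mult_p)

lemma approximable_diff: "approximable f \<Longrightarrow> approximable g \<Longrightarrow> approximable (\<lambda>x. f x - g x)"
  using approximable_add[OF _ approximable_scale[of g "-1"], of f] by simp

lemma approximable_continuous:
  fixes f :: "real \<Rightarrow> real"
  assumes f: "continuous_on UNIV f"
  shows "approximable f"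
  unfolding approximable_def
proof (intro conjI allI impI)
  have meas: "f \<in> borel_measurable borel" by (rule borel_measurable_continuous_onI[OF f])
  have "compact (f ` {-R..R})"
    by (rule compact_continuous_image) (auto intro: continuous_on_subset[OF f])
  then obtain K where K: "\<forall>x\<in>{-R..R}. \<bar>f x\<bar> \<le> K"
    using compact_imp_bounded[of "f ` {-R..R}"] by (auto simp: bounded_iff)
  have "AE x in \<rho>. \<bar>f x\<bar> \<le> K" using supp by eventually_elim (use K in \<open>auto simp: abs_le_iff\<close>)
  then show bf: "bdd f" using meas by (auto simp: bdd_def)
  fix e :: real assume e: "e > 0"
  \<comment> \<open>With \<open>d \<le> 1\<close> a uniform error \<open>d\<close> has square at
    most \<open>d\<close>, and \<open>d < e\<close> finishes the estimate.\<close>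
  define d where "d = min 1 (e / 2)"
  have d: "0 < d" "d \<le> 1" "d < e" using e by (auto simp: d_def)
  obtain g where g: "real_polynomial_function g" "\<And>x. x \<in> {-R..R} \<Longrightarrow> \<bar>f x - g x\<bar> < d"
    using Stone_Weierstrass_real_polynomial_function[OF compact_Icc continuous_on_subset[OF f] d(1), of "-R" R]
    by auto
  obtain c n where gc: "g = (\<lambda>x. \<Sum>i\<le>n. c i * x ^ i)"
    using g(1) unfolding real_polynomial_function_iff_sum by blast
  have gS: "g \<in> S" unfolding gc by (intro S_sum S_scale S_power)
  have "(\<integral>x. (f x - g x)\<^sup>2 \<partial>\<rho>) \<le> (\<integral>x. d \<partial>\<rho>)"
  proof (rule integral_mono_AE)
    show "AE x in \<rho>. (f x - g x)\<^sup>2 \<le> d"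
      using supp
    proof eventually_elim
      case (elim x)
      have "\<bar>f x - g x\<bar> < d" using elim by (intro g(2)) auto
      then have "\<bar>f x - g x\<bar> * \<bar>f x - g x\<bar> \<le> d * 1" using d by (intro mult_mono) auto
      then show ?case by (simp add: power2_eq_square flip: abs_mult)
    qed
  qed (use bf bdd_S[OF gS] in auto)
  also have "\<dots> < e" using d prob_space by simp
  finally show "\<exists>g\<in>S. (\<integral>x. (f x - g x)\<^sup>2 \<partial>\<rho>) < e" using gS by blast
qed

text \<open>Dominated convergence: two functions bounded by 1 differ by at most 2, so the squares
  are dominated by 4.\<close>

lemma approximable_pointwise:
  assumes f: "f \<in> borel_measurable borel" and g: "\<And>n. approximable (g n)"
    and bd: "\<And>x. \<bar>f x\<bar> \<le> 1" "\<And>n x. \<bar>g n x\<bar> \<le> 1" and lim: "\<And>x. (\<lambda>n. g n x) \<longlonglongrightarrow> f x"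
  shows "approximable f"
proof (rule approximable_limit)
  show "bdd f" using f bd unfolding bdd_def by auto
  have [measurable]: "f \<in> borel_measurable borel" "\<And>n. g n \<in> borel_measurable borel"
    using f g by (auto simp: approximable_def bdd_def)
  have "(\<lambda>n. \<integral>x. (f x - g n x)\<^sup>2 \<partial>\<rho>) \<longlonglongrightarrow> (\<integral>x. 0 \<partial>\<rho>)"
  proof (rule integral_dominated_convergence[where w = "\<lambda>x. 4"])
    show "AE x in \<rho>. (\<lambda>n. (f x - g n x)\<^sup>2) \<longlonglongrightarrow> 0"
    proof (rule AE_I2)
      fix x
      have "(\<lambda>n. (f x - g n x)\<^sup>2) \<longlonglongrightarrow> (f x - f x)\<^sup>2" by (intro tendsto_intros lim)
      then show "(\<lambda>n. (f x - g n x)\<^sup>2) \<longlonglongrightarrow> 0" by simp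
    qed
    show "AE x in \<rho>. norm ((f x - g n x)\<^sup>2) \<le> 4" for n
    proof (rule AE_I2)
      fix x
      have "\<bar>f x - g n x\<bar> \<le> 2" using bd(1)[of x] bd(2)[of n x] by linarith
      then have "\<bar>f x - g n x\<bar> * \<bar>f x - g n x\<bar> \<le> 2 * 2" by (intro mult_mono) auto
      then show "norm ((f x - g n x)\<^sup>2) \<le> 4" by (simp add: power2_eq_square abs_mult)
    qed
  qed auto
  then have "(\<lambda>n. \<integral>x. (f x - g n x)\<^sup>2 \<partial>\<rho>) \<longlonglongrightarrow> 0" by simp
  then have lim0: "(\<lambda>n. \<integral>x. (f x - g n x)\<^sup>2 \<partial>\<rho>) \<longlonglongrightarrow> 0" by simp
  show "\<exists>h. approximable h \<and> (\<integral>x. (f x - h x)\<^sup>2 \<partial>\<rho>) < e" if e: "e > 0" for e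
  proof -
    obtain N where "norm ((\<integral>x. (f x - g N x)\<^sup>2 \<partial>\<rho>) - 0) < e" using LIMSEQ_D[OF lim0 e] by blast
    then show ?thesis using g[of N] by (intro exI[of _ "g N"]) auto
  qed
qed

text \<open>Induction over the sigma-algebra generated by the left rays. A ray is a pointwise limit
  of continuous ramps; complements and disjoint unions are linear operations followed by a bounded
  pointwise limit.\<close>

lemma approximable_indicator:
  assumes "B \<in> sets borel"
  shows "approximable (indicator B)"
proof -
  have sets: "sets (borel :: real measure) = sigma_sets UNIV (range (\<lambda>x. {..x}))"
    unfolding borel_eq_atMost by (rule sets_measure_of) simp
  have one: "approximable (\<lambda>x. 1)" using approximable_S[OF S_power[of 0]] by simp
  have "Int_stable (range (\<lambda>x :: real. {..x}))"
    by (auto simp: Int_stable_def)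
  moreover have "range (\<lambda>x :: real. {..x}) \<subseteq> Pow UNIV" by simp
  moreover have "B \<in> sigma_sets UNIV (range (\<lambda>x. {..x}))" using assms sets by simp
  ultimately show ?thesis
  proof (induction rule: sigma_sets_induct_disjoint)
    case (basic A)
    then obtain l where A: "A = {..l}" by auto
    \<comment> \<open>Equal to 1 up to and including \<open>l\<close>, so the limit is the closed
      ray; the ramp reaches 0 at distance \<open>1 / n\<close>.\<close>
    define g where "g n x = max 0 (min 1 (1 - real n * (x - l)))" for n x
    show ?case unfolding A
    proof (rule approximable_pointwise)
      show "approximable (g n)" for n
        unfolding g_def[abs_def] by (intro approximable_continuous continuous_intros)
      show "(\<lambda>n. g n x) \<longlonglongrightarrow> indicator {..l} x" for x
      proof (cases "x \<le> l")
        case True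
        have "g n x = 1" for n
          using True mult_nonneg_nonpos[of "real n" "x - l"] by (auto simp: g_def)
        then show ?thesis using True by simp
      next
        case False
        then obtain N where N: "real N * (x - l) > 1" using reals_Archimedean3[of "x - l"] by auto
        have "g n x = 0" if "n \<ge> N" for n
        proof -
          have "real N * (x - l) \<le> real n * (x - l)" using that False by (intro mult_right_mono) auto
          then show ?thesis using N by (auto simp: g_def)
        qed
        then have "(\<lambda>n. g n x) \<longlonglongrightarrow> 0" by (intro tendsto_eventually) (auto simp: eventually_sequentially)
        then show ?thesis using False by simp
      qed
    qed (auto simp: g_def indicator_def)
  next
    case empty
    have "indicator {} = (\<lambda>x. 0 :: real)" by auto
    then show ?case using approximable_S[OF S_zero] by simp
  next
    case (compl A)
    have "indicator (UNIV - A) = (\<lambda>x. 1 - indicator A x :: real)" by (auto simp: indicator_def fun_eq_iff)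
    then show ?case using approximable_diff[OF one compl.IH] by simp
  next
    case (union A)
    have [measurable]: "A i \<in> sets borel" for i using union(2)[unfolded sets[symmetric]] by auto
    show ?case
    proof (rule approximable_pointwise)
      have "approximable (\<lambda>x. \<Sum>i<n. indicator (A i) x)" for n
      proof (induction n)
        case 0
        then show ?case using approximable_S[OF S_zero] by simp
      next
        case (Suc n)
        then show ?case using approximable_add union by simp
      qed
      moreover have "(\<lambda>x. \<Sum>i<n. indicator (A i) x :: real) = indicator (\<Union>i<n. A i)" for n
      proof
        fix x
        have "(indicator (\<Union>i<n. A i) x :: real) = (\<Sum>i<n. indicator (A i) x)"
          by (rule indicator_UN_disjoint) (use union(1) in \<open>auto simp: disjoint_family_on_def\<close>)
        then show "(\<Sum>i<n. indicator (A i) x :: real) = indicator (\<Union>i<n. A i) x" ..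
      qed
      ultimately show "approximable (indicator (\<Union>i<n. A i))" for n by metis
      show "(\<lambda>n. indicator (\<Union>i<n. A i) x :: real) \<longlonglongrightarrow> indicator (\<Union>i. A i) x" for x
        by (rule LIMSEQ_indicator_UN)
    qed (auto simp: indicator_def)
  qed
qed

definition coef :: "(real \<Rightarrow> real) \<Rightarrow> nat \<Rightarrow> real" where
  "coef f n = (\<integral>x. f x * p n x \<partial>\<rho>)"

text \<open>Completing the square. The choice \<open>d = coef f\<close> gives Bessel's inequality;
  any approximating polynomial gives, by dropping the last sum, an upper bound for the defect in
  Parseval's identity.\<close>

lemma integral_sq_diff_S:
  assumes f: "bdd f"
  shows "(\<integral>x. (f x - (\<Sum>n<N. d n * p n x))\<^sup>2 \<partial>\<rho>)
    = (\<integral>x. (f x)\<^sup>2 \<partial>\<rho>) - (\<Sum>n<N. (coef f n)\<^sup>2) + (\<Sum>n<N. (d n - coef f n)\<^sup>2)"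
proof -
  have "(\<integral>x. (f x - (\<Sum>n<N. d n * p n x))\<^sup>2 \<partial>\<rho>) =
     (\<integral>x. ((f x)\<^sup>2 - (\<Sum>n<N. 2 * d n * (f x * p n x))) + (\<Sum>n<N. \<Sum>m<N. d n * d m * (p n x * p m x)) \<partial>\<rho>)"
    by (rule Bochner_Integration.integral_cong)
      (auto simp: power2_eq_square algebra_simps sum_distrib_left sum_product)
  also have "\<dots> = (\<integral>x. (f x)\<^sup>2 \<partial>\<rho>) - (\<Sum>n<N. 2 * d n * coef f n)
     + (\<Sum>n<N. \<Sum>m<N. d n * d m * (\<integral>x. p n x * p m x \<partial>\<rho>))"
    using f by (subst Bochner_Integration.integral_add; (subst Bochner_Integration.integral_diff)?)
      (auto simp: Bochner_Integration.integral_sum bdd_integrable bdd_mult bdd_const bdd_p bdd_sum coef_def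
       intro!: bdd_integrable bdd_diff bdd_sum bdd_mult bdd_power)
  also have "(\<Sum>n<N. \<Sum>m<N. d n * d m * (\<integral>x. p n x * p m x \<partial>\<rho>)) = (\<Sum>n<N. d n * d n)"
    unfolding orthonormal by (simp add: if_distrib cong: if_cong)
  finally show ?thesis
    by (simp add: power2_eq_square algebra_simps sum.distrib sum_subtractf sum_distrib_left)
qed

theorem parseval:
  assumes f: "approximable f"
  shows "(\<lambda>n. (coef f n)\<^sup>2) sums (\<integral>x. (f x)\<^sup>2 \<partial>\<rho>)"
proof -
  have bf: "bdd f" using f by (simp add: approximable_def)
  have le: "(\<Sum>n<N. (coef f n)\<^sup>2) \<le> (\<integral>x. (f x)\<^sup>2 \<partial>\<rho>)" for N
    using integral_sq_diff_S[OF bf, where N = N and d = "coef f"]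
      Bochner_Integration.integral_nonneg[of \<rho> "\<lambda>x. (f x - (\<Sum>n<N. coef f n * p n x))\<^sup>2"] by auto
  show ?thesis
    unfolding sums_def
  proof (rule LIMSEQ_I)
    fix e :: real assume e: "e > 0"
    obtain g where g: "g \<in> S" "(\<integral>x. (f x - g x)\<^sup>2 \<partial>\<rho>) < e" using f e unfolding approximable_def by blast
    obtain N d where gd: "g = (\<lambda>x. \<Sum>n<N. d n * p n x)" using g(1) by (auto simp: S_def)
    have "0 \<le> (\<Sum>n<N. (d n - coef f n)\<^sup>2)" by (intro sum_nonneg) auto
    then have N: "(\<integral>x. (f x)\<^sup>2 \<partial>\<rho>) - (\<Sum>n<N. (coef f n)\<^sup>2) < e"
      using g(2) integral_sq_diff_S[OF bf, where N = N and d = d] unfolding gd by linarith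
    show "\<exists>no. \<forall>n\<ge>no. norm ((\<Sum>i<n. (coef f i)\<^sup>2) - (\<integral>x. (f x)\<^sup>2 \<partial>\<rho>)) < e"
    proof (intro exI[of _ N] allI impI)
      fix n assume "n \<ge> N"
      then have "(\<Sum>i<N. (coef f i)\<^sup>2) \<le> (\<Sum>i<n. (coef f i)\<^sup>2)" by (intro sum_mono2) auto
      then show "norm ((\<Sum>i<n. (coef f i)\<^sup>2) - (\<integral>x. (f x)\<^sup>2 \<partial>\<rho>)) < e"
        using N le[of n] by simp
    qed
  qed
qed

theorem parseval_bilinear:
  assumes f: "approximable f" and g: "approximable g"
  shows "(\<lambda>n. coef f n * coef g n) sums (\<integral>x. f x * g x \<partial>\<rho>)"
proof -
  have bd: "bdd f" "bdd g" using assms by (auto simp: approximable_def)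
  have c: "coef (\<lambda>x. f x + g x) n = coef f n + coef g n" "coef (\<lambda>x. f x - g x) n = coef f n - coef g n" for n
    unfolding coef_def using bd by (auto simp: distrib_right left_diff_distrib)
  have "(\<lambda>n. ((coef (\<lambda>x. f x + g x) n)\<^sup>2 - (coef (\<lambda>x. f x - g x) n)\<^sup>2) / 4) sums
     (((\<integral>x. (f x + g x)\<^sup>2 \<partial>\<rho>) - (\<integral>x. (f x - g x)\<^sup>2 \<partial>\<rho>)) / 4)"
    by (intro sums_divide sums_diff parseval approximable_add approximable_diff f g)
  moreover have "(\<integral>x. (f x + g x)\<^sup>2 \<partial>\<rho>) - (\<integral>x. (f x - g x)\<^sup>2 \<partial>\<rho>) = 4 * (\<integral>x. f x * g x \<partial>\<rho>)"
  proof -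
    have "(\<integral>x. (f x + g x)\<^sup>2 \<partial>\<rho>) - (\<integral>x. (f x - g x)\<^sup>2 \<partial>\<rho>) = (\<integral>x. (f x + g x)\<^sup>2 - (f x - g x)\<^sup>2 \<partial>\<rho>)"
      using bd by (subst Bochner_Integration.integral_diff) auto
    also have "\<dots> = (\<integral>x. 4 * (f x * g x) \<partial>\<rho>)"
      by (rule Bochner_Integration.integral_cong) (auto simp: power2_eq_square algebra_simps)
    finally show ?thesis by simp
  qed
  moreover have "((coef (\<lambda>x. f x + g x) n)\<^sup>2 - (coef (\<lambda>x. f x - g x) n)\<^sup>2) / 4 = coef f n * coef g n" for n
    unfolding c by (simp add: power2_eq_square algebra_simps)
  ultimately show ?thesis by simp
qed

end

section \<open>The resolution of the identity of a Jacobi operator\<close>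

text \<open>The row stands in an inner product so that continuity in \<open>x\<close> follows from
  Cauchy-Schwarz; conjugation has no effect on the real entries.\<close>

definition matrix_operator :: "(nat \<Rightarrow> nat \<Rightarrow> real) \<Rightarrow> (nat \<Rightarrow> complex) \<Rightarrow> nat \<Rightarrow> complex" where
  "matrix_operator K x i = ell2_inner x (\<lambda>j. complex_of_real (K i j))"

locale projection_matrix =
  fixes K :: "nat \<Rightarrow> nat \<Rightarrow> real"
  assumes sym: "K i j = K j i" and idem: "(\<lambda>j. K i j * K j k) sums K i k"
begin

abbreviation row where "row i \<equiv> (\<lambda>j. complex_of_real (K i j))"

text \<open>A diagonal entry of \<open>K K = K\<close> is the sum of squares along a row.\<close>

lemma row_in: "row i \<in> ell2"
proof -
  have "(\<lambda>j. (cmod (row i j))\<^sup>2) = (\<lambda>j. K i j * K j i)"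
    using sym[of i] by (simp add: power2_eq_square fun_eq_iff flip: abs_mult)
  then show ?thesis using sums_summable[OF idem[of i i]] by (simp add: ell2_def)
qed

lemma inner_row: "ell2_inner (row k) (row i) = complex_of_real (K i k)"
proof -
  have "(\<lambda>j. complex_of_real (K i j * K j k)) sums complex_of_real (K i k)"
    by (subst sums_of_real_iff) (rule idem)
  moreover have "(\<lambda>j. complex_of_real (K i j * K j k)) = (\<lambda>j. row k j * cnj (row i j))"
    using sym[of k] by (simp add: fun_eq_iff)
  ultimately show ?thesis by (simp add: ell2_inner_def sums_iff)
qed

lemma unit: "matrix_operator K (ell2_unit k) = row k"
  using sym[of k] by (simp add: matrix_operator_def ell2_inner_unit_left fun_eq_iff)

lemma apply_row: "matrix_operator K (row k) = row k"
proof (rule ext)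
  fix i
  have "matrix_operator K (row k) i = complex_of_real (K i k)"
    unfolding matrix_operator_def by (rule inner_row)
  also have "K i k = K k i" by (rule sym)
  finally show "matrix_operator K (row k) i = row k i" .
qed

lemma op_add: "x \<in> ell2 \<Longrightarrow> y \<in> ell2 \<Longrightarrow>
    matrix_operator K (\<lambda>n. x n + y n) = (\<lambda>n. matrix_operator K x n + matrix_operator K y n)"
  by (simp add: matrix_operator_def ell2_inner_add_left row_in fun_eq_iff)

lemma op_scale: "x \<in> ell2 \<Longrightarrow> matrix_operator K (\<lambda>n. c * x n) = (\<lambda>n. c * matrix_operator K x n)"
  by (simp add: matrix_operator_def ell2_inner_scale_left row_in fun_eq_iff)

text \<open>Boundedness is still unknown here. On truncations the operator only combines finitely
  many rows, so idempotence and symmetry follow by linearity; together they give the contraction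
  bound, which is then extended.\<close>

lemma trunc_props:
  "matrix_operator K (ell2_trunc N x) \<in> ell2 \<and>
   matrix_operator K (matrix_operator K (ell2_trunc N x)) = matrix_operator K (ell2_trunc N x) \<and>
   (\<forall>y\<in>ell2. ell2_inner (matrix_operator K (ell2_trunc N x)) y = ell2_inner (ell2_trunc N x) (matrix_operator K y))"
proof (induction N)
  case 0
  have t: "ell2_trunc 0 x = (\<lambda>n. 0)" by (auto simp: ell2_trunc_def)
  have z: "matrix_operator K (\<lambda>n. 0) = (\<lambda>n. 0)" by (simp add: matrix_operator_def ell2_inner_def fun_eq_iff)
  show ?case unfolding t z by (simp add: ell2_zero ell2_inner_def)
next
  case (Suc N)
  let ?u = "ell2_trunc N x" and ?s = "\<lambda>n. x N * ell2_unit N n"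
  have t: "ell2_trunc (Suc N) x = (\<lambda>n. ?u n + ?s n)"
    by (auto simp: ell2_trunc_def ell2_unit_def fun_eq_iff less_Suc_eq)
  have s: "?s \<in> ell2" "matrix_operator K ?s = (\<lambda>n. x N * row N n)"
    by (simp_all add: ell2_scale ell2_unit op_scale unit)
  have r: "(\<lambda>n. x N * row N n) \<in> ell2" "matrix_operator K (\<lambda>n. x N * row N n) = (\<lambda>n. x N * row N n)"
    by (simp_all add: ell2_scale row_in op_scale apply_row)
  have Ku: "matrix_operator K ?u \<in> ell2" "matrix_operator K (matrix_operator K ?u) = matrix_operator K ?u"
    using Suc by auto
  have e: "matrix_operator K (ell2_trunc (Suc N) x) = (\<lambda>n. matrix_operator K ?u n + x N * row N n)"
    unfolding t op_add[OF ell2_trunc s(1)] s(2) ..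
  have 1: "matrix_operator K (ell2_trunc (Suc N) x) \<in> ell2"
    unfolding e by (rule ell2_add(1)[OF Ku(1) r(1)])
  have 2: "matrix_operator K (matrix_operator K (ell2_trunc (Suc N) x)) = matrix_operator K (ell2_trunc (Suc N) x)"
    unfolding e op_add[OF Ku(1) r(1)] r(2) Ku(2) ..
  have 3: "ell2_inner (matrix_operator K (ell2_trunc (Suc N) x)) y = ell2_inner (ell2_trunc (Suc N) x) (matrix_operator K y)"
    if y: "y \<in> ell2" for y
  proof -
    have Ky: "ell2_inner (row N) y = cnj (matrix_operator K y N)"
      using y by (simp add: matrix_operator_def ell2_inner_cnj row_in)
    have "ell2_inner (matrix_operator K (ell2_trunc (Suc N) x)) y
        = ell2_inner ?u (matrix_operator K y) + x N * cnj (matrix_operator K y N)"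
      unfolding e using Suc y Ku r by (simp add: ell2_inner_add_left ell2_inner_scale_left row_in Ky)
    moreover have "ell2_inner (ell2_trunc (Suc N) x) (matrix_operator K y) = (\<Sum>n<Suc N. x n * cnj (matrix_operator K y n))"
      unfolding ell2_inner_def by (subst suminf_finite[of "{..<Suc N}"]) (auto simp: ell2_trunc_def)
    moreover have "ell2_inner ?u (matrix_operator K y) = (\<Sum>n<N. x n * cnj (matrix_operator K y n))"
      unfolding ell2_inner_def by (subst suminf_finite[of "{..<N}"]) (auto simp: ell2_trunc_def)
    ultimately show ?thesis by simp
  qed
  show ?case using 1 2 3 by blast
qed

lemma trunc_contraction: "ell2_norm (matrix_operator K (ell2_trunc N x)) \<le> ell2_norm (ell2_trunc N x)"
proof -
  let ?u = "ell2_trunc N x" and ?v = "matrix_operator K (ell2_trunc N x)"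
  have v: "?v \<in> ell2" using trunc_props by blast
  have "ell2_inner ?v ?v = ell2_inner ?u ?v" using trunc_props[of N x] v by metis
  then have "complex_of_real ((ell2_norm ?v)\<^sup>2) = ell2_inner ?u ?v" by (simp only: ell2_inner_self[OF v])
  then have "(ell2_norm ?v)\<^sup>2 = cmod (ell2_inner ?u ?v)"
    by (metis norm_of_real abs_of_nonneg zero_le_power2)
  also have "\<dots> \<le> ell2_norm ?u * ell2_norm ?v" by (rule ell2_cauchy_schwarz[OF ell2_trunc v])
  finally show ?thesis
    using ell2_norm_nonneg[OF v] ell2_norm_nonneg[OF ell2_trunc[of N x]]
    by (cases "ell2_norm ?v = 0") (auto simp: power2_eq_square)
qed

text \<open>Each coordinate of the image is continuous in \<open>x\<close> because the rows are
  square summable. Finite partial sums of squares therefore inherit the bound from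
  truncations.\<close>

lemma contraction:
  assumes x: "x \<in> ell2"
  shows "matrix_operator K x \<in> ell2" "ell2_norm (matrix_operator K x) \<le> ell2_norm x"
proof -
  have "(\<Sum>i<n. (cmod (matrix_operator K x i))\<^sup>2) \<le> (ell2_norm x)\<^sup>2" for n
  proof (rule LIMSEQ_le_const2)
    show "(\<lambda>N. \<Sum>i<n. (cmod (matrix_operator K (ell2_trunc N x) i))\<^sup>2) \<longlonglongrightarrow> (\<Sum>i<n. (cmod (matrix_operator K x i))\<^sup>2)"
      unfolding matrix_operator_def
      by (intro tendsto_sum tendsto_power tendsto_norm
        ell2_inner_tendsto[OF x ell2_trunc ell2_trunc_tendsto[OF x] row_in])
    show "\<exists>M. \<forall>N\<ge>M. (\<Sum>i<n. (cmod (matrix_operator K (ell2_trunc N x) i))\<^sup>2) \<le> (ell2_norm x)\<^sup>2"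
    proof (intro exI allI impI)
      fix N
      have "(\<Sum>i<n. (cmod (matrix_operator K (ell2_trunc N x) i))\<^sup>2) \<le> (ell2_norm (matrix_operator K (ell2_trunc N x)))\<^sup>2"
        by (rule ell2_partial_sum_le) (use trunc_props in auto)
      also have "\<dots> \<le> (ell2_norm x)\<^sup>2"
        using trunc_contraction[of N x] ell2_norm_trunc_le[OF x, of N] trunc_props
        by (intro power_mono) (auto intro: ell2_norm_nonneg)
      finally show "(\<Sum>i<n. (cmod (matrix_operator K (ell2_trunc N x) i))\<^sup>2) \<le> (ell2_norm x)\<^sup>2" .
    qed
  qed
  from ell2I_bounded[OF this ell2_norm_nonneg[OF x]]
  show "matrix_operator K x \<in> ell2" "ell2_norm (matrix_operator K x) \<le> ell2_norm x" by auto
qed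

lemma bounded: "ell2_bounded_operator (matrix_operator K)"
  unfolding ell2_bounded_operator_def using contraction op_add op_scale
  by (auto intro!: exI[of _ 1])

lemma projection: "ell2_orthogonal_projection (matrix_operator K)"
  unfolding ell2_orthogonal_projection_def ell2_bounded_selfadjoint_def
proof (intro conjI ballI bounded)
  show "ell2_inner (matrix_operator K x) y = ell2_inner x (matrix_operator K y)" if "x \<in> ell2" "y \<in> ell2" for x y
    by (rule ell2_operator_inner_ext[OF bounded bounded _ that]) (simp add: unit sym)
  show "matrix_operator K (matrix_operator K x) = matrix_operator K x" if "x \<in> ell2" for x
    by (rule ell2_operator_eqI[OF ell2_bounded_operator_compose[OF bounded bounded] bounded _ that])
      (simp add: unit apply_row)
qed

end

lemma ell2_bounded_operator_diff:
  assumes "ell2_bounded_operator A" "ell2_bounded_operator B"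
  shows "ell2_bounded_operator (\<lambda>x n. A x n - B x n)"
proof -
  obtain C where C: "C \<ge> 0" "\<And>x. x \<in> ell2 \<Longrightarrow> ell2_norm (A x) \<le> C * ell2_norm x"
    using ell2_bounded_operator_bound[OF assms(1)] by blast
  obtain D where D: "D \<ge> 0" "\<And>x. x \<in> ell2 \<Longrightarrow> ell2_norm (B x) \<le> D * ell2_norm x"
    using ell2_bounded_operator_bound[OF assms(2)] by blast
  show ?thesis unfolding ell2_bounded_operator_def
  proof (intro conjI ballI allI exI[of _ "C + D"])
    fix x y :: "nat \<Rightarrow> complex" and c :: complex
    assume x: "x \<in> ell2"
    note i = ell2_bounded_operatorD(1)[OF assms(1) x] ell2_bounded_operatorD(1)[OF assms(2) x]
    show "(\<lambda>n. A x n - B x n) \<in> ell2" by (rule ell2_diff(1)[OF i])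
    show "ell2_norm (\<lambda>n. A x n - B x n) \<le> (C + D) * ell2_norm x"
      using ell2_diff(2)[OF i] C(2)[OF x] D(2)[OF x] by (simp add: distrib_right)
    show "(\<lambda>n. A (\<lambda>n. c * x n) n - B (\<lambda>n. c * x n) n) = (\<lambda>n. c * (A x n - B x n))"
      unfolding ell2_bounded_operatorD(3)[OF assms(1) x] ell2_bounded_operatorD(3)[OF assms(2) x]
      by (simp add: right_diff_distrib)
    assume y: "y \<in> ell2"
    show "(\<lambda>n. A (\<lambda>n. x n + y n) n - B (\<lambda>n. x n + y n) n) = (\<lambda>n. A x n - B x n + (A y n - B y n))"
      unfolding ell2_bounded_operatorD(2)[OF assms(1) x y] ell2_bounded_operatorD(2)[OF assms(2) x y]
      by (simp add: fun_eq_iff)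
  qed
qed

lemma ell2_bounded_operator_id: "ell2_bounded_operator (\<lambda>x. x)"
  unfolding ell2_bounded_operator_def by (auto intro!: exI[of _ 1])

text \<open>The uniform bound controls the tail of \<open>x\<close>; the finite head is handled by
  the unit vectors.\<close>

lemma ell2_strong_limit:
  assumes G: "\<And>t. ell2_bounded_operator (G t)" "\<And>t x. x \<in> ell2 \<Longrightarrow> ell2_norm (G t x) \<le> C * ell2_norm x"
    and lim: "\<And>k. ((\<lambda>t. ell2_norm (G t (ell2_unit k))) \<longlongrightarrow> 0) F"
    and x: "x \<in> ell2"
  shows "((\<lambda>t. ell2_norm (G t x)) \<longlongrightarrow> 0) F"
proof (rule tendstoI)
  fix e :: real assume e: "e > 0"
  have in_ell2: "y \<in> ell2 \<Longrightarrow> G t y \<in> ell2" for t y using ell2_bounded_operatorD(1)[OF G(1)] .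
  have tr: "ell2_norm (G t (ell2_trunc N x)) \<le> (\<Sum>k<N. cmod (x k) * ell2_norm (G t (ell2_unit k)))" for N t
  proof (induction N)
    case 0
    have "ell2_trunc 0 x = (\<lambda>n. 0)" by (auto simp: ell2_trunc_def)
    then show ?case using ell2_bounded_operatorD(5)[OF G(1) ell2_zero(1)] by (simp add: ell2_zero)
  next
    case (Suc N)
    have "ell2_trunc (Suc N) x = (\<lambda>n. ell2_trunc N x n + x N * ell2_unit N n)"
      by (auto simp: ell2_trunc_def ell2_unit_def fun_eq_iff less_Suc_eq)
    then have "G t (ell2_trunc (Suc N) x) = (\<lambda>n. G t (ell2_trunc N x) n + x N * G t (ell2_unit N) n)"
      using ell2_bounded_operatorD(2)[OF G(1) ell2_trunc ell2_scale(1)[OF ell2_unit]]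
        ell2_bounded_operatorD(3)[OF G(1) ell2_unit] by metis
    then show ?case
      using ell2_add(2)[OF in_ell2[OF ell2_trunc] ell2_scale(1)[OF in_ell2[OF ell2_unit]], of t N x "x N" t N] Suc
        ell2_scale(2)[OF in_ell2[OF ell2_unit[of N]], of "x N" t]
      by simp
  qed
  have "(\<lambda>N. C * ell2_norm (\<lambda>n. x n - ell2_trunc N x n)) \<longlonglongrightarrow> C * 0"
    by (intro tendsto_mult_left ell2_trunc_tendsto[OF x])
  then have "\<forall>\<^sub>F N in sequentially. C * ell2_norm (\<lambda>n. x n - ell2_trunc N x n) < e / 2"
    using e by (intro order_tendstoD(2)) auto
  then obtain N where N: "C * ell2_norm (\<lambda>n. x n - ell2_trunc N x n) < e / 2"
    by (auto simp: eventually_sequentially)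
  have "((\<lambda>t. \<Sum>k<N. cmod (x k) * ell2_norm (G t (ell2_unit k))) \<longlongrightarrow> (\<Sum>k<N. cmod (x k) * 0)) F"
    by (intro tendsto_sum tendsto_mult_left lim)
  then have "\<forall>\<^sub>F t in F. (\<Sum>k<N. cmod (x k) * ell2_norm (G t (ell2_unit k))) < e / 2"
    using e by (intro order_tendstoD(2)) auto
  then show "\<forall>\<^sub>F t in F. dist (ell2_norm (G t x)) 0 < e"
  proof eventually_elim
    case (elim t)
    have d: "(\<lambda>n. x n - ell2_trunc N x n) \<in> ell2" by (rule ell2_diff(1)[OF x ell2_trunc])
    have "G t x = (\<lambda>n. G t (\<lambda>n. x n - ell2_trunc N x n) n + G t (ell2_trunc N x) n)"
      unfolding ell2_bounded_operatorD(4)[OF G(1) x ell2_trunc] by simp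
    then have "ell2_norm (G t x) \<le> ell2_norm (G t (\<lambda>n. x n - ell2_trunc N x n)) + ell2_norm (G t (ell2_trunc N x))"
      using ell2_add(2)[OF in_ell2[OF d] in_ell2[OF ell2_trunc], of t t N x] by simp
    also have "\<dots> < e" using G(2)[OF d, of t] N tr[of t N] elim by linarith
    finally show ?case using ell2_norm_nonneg[OF in_ell2[OF x]] by simp
  qed
qed

lemma ell2_form_trunc_tendsto:
  assumes A: "ell2_bounded_operator A" and x: "x \<in> ell2"
  shows "(\<lambda>N. ell2_inner (A (ell2_trunc N x)) (ell2_trunc N x)) \<longlonglongrightarrow> ell2_inner (A x) x"
proof -
  obtain C where C: "C \<ge> 0" "\<And>x. x \<in> ell2 \<Longrightarrow> ell2_norm (A x) \<le> C * ell2_norm x"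
    using ell2_bounded_operator_bound[OF A] by blast
  let ?u = "\<lambda>N. ell2_trunc N x" and ?d = "\<lambda>N n. x n - ell2_trunc N x n"
  have iA: "\<And>y. y \<in> ell2 \<Longrightarrow> A y \<in> ell2" using ell2_bounded_operatorD(1)[OF A] .
  have d: "?d N \<in> ell2" for N by (rule ell2_diff(1)[OF x ell2_trunc])
  have lim: "(\<lambda>N. C * ell2_norm x * ell2_norm (?d N)) \<longlonglongrightarrow> 0"
    using tendsto_mult_left[OF ell2_trunc_tendsto[OF x], of "C * ell2_norm x"] by simp
  have "(\<lambda>N. ell2_inner (A (?u N)) (?d N)) \<longlonglongrightarrow> 0"
  proof (rule Lim_null_comparison[OF _ lim], rule always_eventually, rule allI)
    fix N
    have "norm (ell2_inner (A (?u N)) (?d N)) \<le> ell2_norm (A (?u N)) * ell2_norm (?d N)"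
      by (rule ell2_cauchy_schwarz[OF iA[OF ell2_trunc] d])
    also have "ell2_norm (A (?u N)) \<le> C * ell2_norm x"
      using C(2)[OF ell2_trunc, of N x] mult_left_mono[OF ell2_norm_trunc_le[OF x, of N] C(1)] by linarith
    finally show "norm (ell2_inner (A (?u N)) (?d N)) \<le> C * ell2_norm x * ell2_norm (?d N)"
      using ell2_norm_nonneg[OF d] by (meson mult_right_mono order_trans)
  qed
  moreover have "(\<lambda>N. ell2_inner (A (?u N)) x) \<longlonglongrightarrow> ell2_inner (A x) x"
    by (rule ell2_inner_tendsto[OF iA[OF x] iA[OF ell2_trunc]
        ell2_operator_tendsto[OF A x ell2_trunc ell2_trunc_tendsto[OF x]] x])
  ultimately have "(\<lambda>N. ell2_inner (A (?u N)) x - ell2_inner (A (?u N)) (?d N)) \<longlonglongrightarrow> ell2_inner (A x) x - 0"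
    by (intro tendsto_diff)
  moreover have "ell2_inner (A (?u N)) x - ell2_inner (A (?u N)) (?d N) = ell2_inner (A (?u N)) (?u N)" for N
    using ell2_inner_diff_right[OF x ell2_trunc iA[OF ell2_trunc]] by simp
  ultimately show ?thesis by simp
qed

lemma ell2_form_trunc:
  assumes A: "ell2_bounded_operator A" and K: "\<And>j k. A (ell2_unit j) k = complex_of_real (K j k)"
  shows "Re (ell2_inner (A (ell2_trunc N x)) (ell2_trunc N x)) = (\<Sum>j<N. \<Sum>k<N. Re (x j * cnj (x k)) * K j k)"
proof -
  have "ell2_inner (A (ell2_trunc N x)) (ell2_trunc N x) = (\<Sum>k<N. A (ell2_trunc N x) k * cnj (x k))"
    unfolding ell2_inner_def by (subst suminf_finite[of "{..<N}"]) (auto simp: ell2_trunc_def)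
  also have "\<dots> = (\<Sum>k<N. \<Sum>j<N. complex_of_real (K j k) * (x j * cnj (x k)))"
    unfolding ell2_bounded_operator_trunc[OF A] K by (simp add: sum_distrib_left sum_distrib_right mult_ac)
  also have "\<dots> = (\<Sum>j<N. \<Sum>k<N. complex_of_real (K j k) * (x j * cnj (x k)))"
    by (rule sum.swap)
  finally show ?thesis by (simp add: mult.commute)
qed

context ell2_resolution
begin

lemma F_measurable:
  assumes "x \<in> ell2" shows "F x \<in> borel_measurable borel"
  using F_mono[OF assms] by (intro borel_measurable_mono) (auto simp: mono_def)

lemma F_bounds:
  assumes "x \<in> ell2" shows "0 \<le> F x l" "F x l \<le> (ell2_norm x)\<^sup>2"
  using assms contraction[OF assms, of l] by (auto simp: F_eq intro!: power_mono ell2_norm_nonneg)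

text \<open>Integration by parts for a distribution function supported in \<open>[-C, C]\<close>; this form is
  continuous in \<open>x\<close>.\<close>

lemma stieltjes_first_moment:
  assumes x: "x \<in> ell2" and low: "F x (- C) = 0" and high: "F x C = (ell2_norm x)\<^sup>2"
  shows "integrable (\<mu> x) (\<lambda>l. l)"
    "(\<integral>l. l \<partial>\<mu> x) = C * (ell2_norm x)\<^sup>2 - (\<integral>l. indicator {-C..C} l * F x l \<partial>lborel)"
proof -
  interpret finite_borel_measure "\<mu> x" by (rule finite_\<mu>[OF x])
  interpret P: pair_sigma_finite "\<mu> x" lborel ..
  note [measurable] = F_measurable[OF x]
  have "emeasure (\<mu> x) {..-C} = 0" using low by (simp add: emeasure_\<mu>_Iic[OF x])
  then have "AE s in \<mu> x. s \<notin> {..-C}" by (intro AE_not_in) auto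
  moreover have "emeasure (\<mu> x) {C<..} = 0" using high by (simp add: emeasure_\<mu>_Ioi[OF x])
  then have "AE s in \<mu> x. s \<notin> {C<..}" by (intro AE_not_in) auto
  ultimately have AE: "AE s in \<mu> x. - C < s \<and> s \<le> C" by eventually_elim auto
  show int: "integrable (\<mu> x) (\<lambda>l. l)"
  proof (rule integrable_const_bound[of _ C])
    show "AE s in \<mu> x. norm s \<le> C" using AE by eventually_elim auto
  qed simp
  have m: "measure (\<mu> x) UNIV = (ell2_norm x)\<^sup>2"
    using finite_\<mu>(2)[OF x] by (simp add: measure_def)
  \<comment> \<open>\<open>C - s\<close> is the length of the interval from \<open>s\<close> to
    \<open>C\<close>; exchanging the two integrations turns it into an integral of masses of left
    rays, that is, of \<open>F x\<close>.\<close>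
  have "(\<integral>\<^sup>+s. ennreal (C - s) \<partial>\<mu> x) = (\<integral>\<^sup>+s. (\<integral>\<^sup>+l. indicator {z. fst z \<le> snd z \<and> snd z \<le> C} (s, l) \<partial>lborel) \<partial>\<mu> x)"
  proof (rule nn_integral_cong_AE)
    show "AE s in \<mu> x. ennreal (C - s) = (\<integral>\<^sup>+l. indicator {z. fst z \<le> snd z \<and> snd z \<le> C} (s, l) \<partial>lborel)"
      using AE
    proof eventually_elim
      case (elim s)
      have "(\<integral>\<^sup>+l. indicator {z. fst z \<le> snd z \<and> snd z \<le> C} (s, l) \<partial>lborel) = (\<integral>\<^sup>+l. indicator {s..C} l \<partial>lborel)"
        by (rule nn_integral_cong) (auto simp: indicator_def)
      also have "\<dots> = ennreal (C - s)" using elim by simp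
      finally show ?case ..
    qed
  qed
  also have "\<dots> = (\<integral>\<^sup>+l. (\<integral>\<^sup>+s. indicator {z. fst z \<le> snd z \<and> snd z \<le> C} (s, l) \<partial>\<mu> x) \<partial>lborel)"
    by (rule P.Fubini[symmetric]) measurable
  also have "\<dots> = (\<integral>\<^sup>+l. ennreal (indicator {-C..C} l * F x l) \<partial>lborel)"
  proof (rule nn_integral_cong)
    fix l
    have "(\<integral>\<^sup>+s. indicator {z. fst z \<le> snd z \<and> snd z \<le> C} (s, l) \<partial>\<mu> x)
        = (\<integral>\<^sup>+s. indicator {..C} l * indicator {..l} s \<partial>\<mu> x)"
      by (rule nn_integral_cong) (auto simp: indicator_def)
    also have "\<dots> = indicator {..C} l * ennreal (F x l)"
      by (subst nn_integral_cmult) (auto simp: emeasure_\<mu>_Iic[OF x])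
    also have "\<dots> = ennreal (indicator {-C..C} l * F x l)"
    proof (cases "l < - C")
      case True
      then have "F x l = 0" using F_mono[OF x, of l "- C"] F_bounds[OF x, of l] low by simp
      then show ?thesis by simp
    qed (auto simp: indicator_def)
    finally show "(\<integral>\<^sup>+s. indicator {z. fst z \<le> snd z \<and> snd z \<le> C} (s, l) \<partial>\<mu> x) = ennreal (indicator {-C..C} l * F x l)" .
  qed
  finally have nn: "(\<integral>\<^sup>+s. ennreal (C - s) \<partial>\<mu> x) = (\<integral>\<^sup>+l. ennreal (indicator {-C..C} l * F x l) \<partial>lborel)" .
  have "(\<integral>s. C - s \<partial>\<mu> x) = enn2real (\<integral>\<^sup>+s. ennreal (C - s) \<partial>\<mu> x)"
  proof (rule integral_eq_nn_integral)
    show "AE s in \<mu> x. 0 \<le> C - s" using AE by eventually_elim auto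
  qed simp
  also have "\<dots> = (\<integral>l. indicator {-C..C} l * F x l \<partial>lborel)"
    unfolding nn by (rule integral_eq_nn_integral[symmetric]) (auto intro!: AE_I2 mult_nonneg_nonneg F_bounds x)
  finally have "(\<integral>s. C - s \<partial>\<mu> x) = (\<integral>l. indicator {-C..C} l * F x l \<partial>lborel)" .
  moreover have "(\<integral>s. C - s \<partial>\<mu> x) = C * (ell2_norm x)\<^sup>2 - (\<integral>s. s \<partial>\<mu> x)"
    using int by (subst Bochner_Integration.integral_diff) (auto simp: m)
  ultimately show "(\<integral>l. l \<partial>\<mu> x) = C * (ell2_norm x)\<^sup>2 - (\<integral>l. indicator {-C..C} l * F x l \<partial>lborel)" by simp
qed

end

section \<open>The spectral projections of the Jacobi matrix\<close>

context jacobi_measure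
begin

definition M :: "real \<Rightarrow> nat \<Rightarrow> nat \<Rightarrow> real" where
  "M l i j = (\<integral>s. indicator {..l} s * (p i s * p j s) \<partial>\<rho>)"

lemma M_coef: "M l i j = coef (\<lambda>s. p i s * indicator {..l} s) j"
  unfolding M_def coef_def by (rule Bochner_Integration.integral_cong) auto

lemma M_sym: "M l i j = M l j i"
  unfolding M_def by (simp add: mult.commute)

text \<open>Parseval for \<open>p i\<close> cut off at \<open>l\<close> and \<open>p k\<close> cut
  off at \<open>m\<close>: the product of the cut-offs is the cut-off at the minimum. Completeness
  of the polynomials thus makes the infinite matrices multiply like spectral projections.\<close>

lemma M_sums: "(\<lambda>j. M l i j * M m j k) sums M (min l m) i k"
proof -
  have "(\<lambda>j. coef (\<lambda>s. p i s * indicator {..l} s) j * coef (\<lambda>s. p k s * indicator {..m} s) j)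
     sums (\<integral>s. (p i s * indicator {..l} s) * (p k s * indicator {..m} s) \<partial>\<rho>)"
    by (intro parseval_bilinear approximable_p approximable_indicator) auto
  also have "(\<integral>s. (p i s * indicator {..l} s) * (p k s * indicator {..m} s) \<partial>\<rho>) = M (min l m) i k"
    unfolding M_def by (rule Bochner_Integration.integral_cong) (auto simp: indicator_def)
  finally show ?thesis by (simp add: M_coef[symmetric] M_sym[of m k])
qed

definition E :: "real \<Rightarrow> (nat \<Rightarrow> complex) \<Rightarrow> nat \<Rightarrow> complex" where
  "E l = matrix_operator (M l)"

lemma M_projection: "projection_matrix (M l)"
  using M_sym M_sums[of l _ l] by unfold_locales auto

lemma E_bounded: "ell2_bounded_operator (E l)"
  unfolding E_def by (rule projection_matrix.bounded[OF M_projection])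

lemma E_contraction: "x \<in> ell2 \<Longrightarrow> ell2_norm (E l x) \<le> ell2_norm x"
  unfolding E_def by (rule projection_matrix.contraction(2)[OF M_projection])

lemma E_in: "x \<in> ell2 \<Longrightarrow> E l x \<in> ell2"
  by (rule ell2_bounded_operatorD(1)[OF E_bounded])

lemma E_unit: "E l (ell2_unit k) = (\<lambda>j. complex_of_real (M l k j))"
  unfolding E_def by (rule projection_matrix.unit[OF M_projection])

lemma E_compose:
  assumes "x \<in> ell2" shows "E l (E m x) = E (min l m) x"
proof (rule ell2_operator_eqI[OF ell2_bounded_operator_compose[OF E_bounded E_bounded] E_bounded _ assms], rule ext)
  fix k i
  have "(\<lambda>j. complex_of_real (M m k j * M l j i)) sums complex_of_real (M (min l m) k i)"
    using M_sums[of m k l i] by (subst sums_of_real_iff) (simp add: min.commute)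
  then show "E l (E m (ell2_unit k)) i = E (min l m) (ell2_unit k) i"
    unfolding E_unit by (simp add: E_def matrix_operator_def ell2_inner_def sums_iff M_sym[of l i])
qed

lemma inner_E_unit: "ell2_inner (E l (ell2_unit k)) (E m (ell2_unit k)) = complex_of_real (M (min l m) k k)"
proof -
  have "ell2_inner (E l (ell2_unit k)) (E m (ell2_unit k)) = ell2_inner (ell2_unit k) (E l (E m (ell2_unit k)))"
    using projection_matrix.projection[OF M_projection, of l] E_in[OF ell2_unit]
    unfolding ell2_orthogonal_projection_def ell2_bounded_selfadjoint_def E_def[symmetric]
    by (simp add: ell2_unit)
  then show ?thesis
    unfolding E_compose[OF ell2_unit] by (simp only: E_unit ell2_inner_unit_left complex_cnj_complex_of_real)
qed

lemma norm_E_unit: "(ell2_norm (E l (ell2_unit k)))\<^sup>2 = M l k k"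
  using ell2_inner_self[OF E_in[OF ell2_unit], of l k] inner_E_unit[of l k l]
  by (simp del: of_real_power)

lemma norm_E_diff:
  assumes "m \<le> l"
  shows "(ell2_norm (\<lambda>n. E l (ell2_unit k) n - E m (ell2_unit k) n))\<^sup>2 = M l k k - M m k k"
proof -
  let ?u = "E l (ell2_unit k)" and ?v = "E m (ell2_unit k)"
  have i: "?u \<in> ell2" "?v \<in> ell2" by (simp_all add: E_in ell2_unit)
  have "complex_of_real ((ell2_norm (\<lambda>n. ?u n - ?v n))\<^sup>2) = complex_of_real (M l k k - M m k k)"
    using i assms by (simp add: ell2_inner_self[symmetric] ell2_diff ell2_inner_diff_left ell2_inner_diff_right
       inner_E_unit min_def del: of_real_power)
  then show ?thesis by (simp only: of_real_eq_iff)
qed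

text \<open>The diagonal entry is the distribution function of the probability measure with density
  \<open>(p k)^2\<close> relative to \<open>\<rho>\<close>. Right-continuity and the limits at both
  ends then come from general facts on distribution functions.\<close>

lemma M_diag_measure:
  obtains N where "finite_borel_measure N" "\<And>l. cdf N l = M l k k" "measure N (space N) = 1"
proof -
  define N where "N = density \<rho> (\<lambda>s. ennreal ((p k s)\<^sup>2))"
  have em: "emeasure N B = ennreal (\<integral>s. indicator B s * (p k s * p k s) \<partial>\<rho>)" if [measurable]: "B \<in> sets borel" for B
  proof -
    have "emeasure N B = (\<integral>\<^sup>+s. ennreal ((p k s)\<^sup>2) * indicator B s \<partial>\<rho>)"
      unfolding N_def by (rule emeasure_density) auto
    also have "\<dots> = (\<integral>\<^sup>+s. ennreal (indicator B s * (p k s * p k s)) \<partial>\<rho>)"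
      by (rule nn_integral_cong) (auto simp: indicator_def power2_eq_square)
    also have "\<dots> = ennreal (\<integral>s. indicator B s * (p k s * p k s) \<partial>\<rho>)"
      by (rule nn_integral_eq_integral) auto
    finally show ?thesis .
  qed
  have sp: "space N = UNIV" "sets N = sets borel" by (simp_all add: N_def)
  have one: "emeasure N UNIV = 1" using em[of UNIV] by (simp add: orthonormal)
  show thesis
  proof (rule that[of N])
    show "finite_borel_measure N"
      by (intro finite_borel_measure.intro finite_measureI finite_borel_measure_axioms.intro) (simp_all add: sp one)
    show "cdf N l = M l k k" for l
    proof -
      have "0 \<le> M l k k" unfolding M_def by (rule Bochner_Integration.integral_nonneg) simp
      then show ?thesis using em[of "{..l}"] by (simp add: cdf_def measure_def M_def)
    qed
    show "measure N (space N) = 1" using one by (simp add: measure_def sp)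
  qed
qed

lemma sqrt_tendsto_0:
  assumes "((\<lambda>t. (f t)\<^sup>2) \<longlongrightarrow> (0::real)) G" "\<And>t. 0 \<le> f t"
  shows "(f \<longlongrightarrow> 0) G"
  using tendsto_real_sqrt[OF assms(1)] assms(2) by simp

text \<open>The operators are uniformly bounded, so each limit needs checking on unit vectors only.
  There the squared norms are values or increments of the distribution functions
  \<open>M l k k\<close>.\<close>

lemma E_resolution: "resolution_of_identity E"
  unfolding resolution_of_identity_def
proof (intro conjI allI ballI)
  show "ell2_orthogonal_projection (E l)" for l
    unfolding E_def by (rule projection_matrix.projection[OF M_projection])
  show "E l (E m x) = E (min l m) x" if "x \<in> ell2" for l m x by (rule E_compose[OF that])
  fix x :: "nat \<Rightarrow> complex" assume x: "x \<in> ell2"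
  have nn: "0 \<le> ell2_norm (\<lambda>n. E l (ell2_unit k) n - E m (ell2_unit k) n)" for l m k
    by (intro ell2_norm_nonneg ell2_diff E_in ell2_unit)
  show "((\<lambda>l. ell2_norm (\<lambda>n. E l x n - E m x n)) \<longlongrightarrow> 0) (at_right m)" for m
  proof (rule ell2_strong_limit[where G = "\<lambda>l x n. E l x n - E m x n" and C = 2, OF _ _ _ x])
    show "ell2_bounded_operator (\<lambda>x n. E l x n - E m x n)" for l
      by (rule ell2_bounded_operator_diff[OF E_bounded E_bounded])
    show "ell2_norm (\<lambda>n. E l y n - E m y n) \<le> 2 * ell2_norm y" if "y \<in> ell2" for l y
      using ell2_diff(2)[OF E_in[OF that] E_in[OF that], of l m] E_contraction[OF that, of l]
        E_contraction[OF that, of m] by linarith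
    fix k
    obtain N where N: "finite_borel_measure N" "\<And>l. cdf N l = M l k k" using M_diag_measure by blast
    have "((\<lambda>l. M l k k) \<longlongrightarrow> M m k k) (at_right m)"
    proof -
      have "cdf N = (\<lambda>l. M l k k)" using N(2) by auto
      then show ?thesis
        using finite_borel_measure.cdf_is_right_cont[OF N(1), of m] by (simp add: continuous_within)
    qed
    then have "((\<lambda>l. M l k k - M m k k) \<longlongrightarrow> 0) (at_right m)" by (simp add: LIM_zero)
    then have "((\<lambda>l. (ell2_norm (\<lambda>n. E l (ell2_unit k) n - E m (ell2_unit k) n))\<^sup>2) \<longlongrightarrow> 0) (at_right m)"
    proof (rule Lim_transform_eventually)
      show "\<forall>\<^sub>F l in at_right m. M l k k - M m k k = (ell2_norm (\<lambda>n. E l (ell2_unit k) n - E m (ell2_unit k) n))\<^sup>2"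
        using eventually_at_right_less[of m] by eventually_elim (simp add: norm_E_diff)
    qed
    then show "((\<lambda>l. ell2_norm (\<lambda>n. E l (ell2_unit k) n - E m (ell2_unit k) n)) \<longlongrightarrow> 0) (at_right m)"
      by (rule sqrt_tendsto_0) (rule nn)
  qed
  show "((\<lambda>l. ell2_norm (E l x)) \<longlongrightarrow> 0) at_bot"
  proof (rule ell2_strong_limit[where G = E and C = 1, OF E_bounded _ _ x])
    fix k
    obtain N where N: "finite_borel_measure N" "\<And>l. cdf N l = M l k k" using M_diag_measure by blast
    have "cdf N = (\<lambda>l. M l k k)" using N(2) by auto
    then have "((\<lambda>l. M l k k) \<longlongrightarrow> 0) at_bot"
      using finite_borel_measure.cdf_lim_at_bot[OF N(1)] by simp
    then have "((\<lambda>l. (ell2_norm (E l (ell2_unit k)))\<^sup>2) \<longlongrightarrow> 0) at_bot"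
      by (simp only: norm_E_unit)
    then show "((\<lambda>l. ell2_norm (E l (ell2_unit k))) \<longlongrightarrow> 0) at_bot"
      by (rule sqrt_tendsto_0) (rule ell2_norm_nonneg[OF E_in[OF ell2_unit]])
  qed (simp add: E_contraction)
  show "((\<lambda>l. ell2_norm (\<lambda>n. E l x n - x n)) \<longlongrightarrow> 0) at_top"
  proof (rule ell2_strong_limit[where G = "\<lambda>l x n. E l x n - x n" and C = 2, OF _ _ _ x])
    show "ell2_bounded_operator (\<lambda>x n. E l x n - x n)" for l
      by (rule ell2_bounded_operator_diff[OF E_bounded ell2_bounded_operator_id])
    show "ell2_norm (\<lambda>n. E l y n - y n) \<le> 2 * ell2_norm y" if "y \<in> ell2" for l y
      using ell2_diff(2)[OF E_in[OF that] that, of l] E_contraction[OF that, of l] by linarith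
    fix k
    obtain N where N: "finite_borel_measure N" "\<And>l. cdf N l = M l k k" "measure N (space N) = 1"
      using M_diag_measure by blast
    have "cdf N = (\<lambda>l. M l k k)" using N(2) by auto
    then have "((\<lambda>l. M l k k) \<longlongrightarrow> 1) at_top"
      using finite_borel_measure.cdf_lim_at_top[OF N(1)] N(3) by simp
    then have "((\<lambda>l. 1 - M l k k) \<longlongrightarrow> 1 - 1) at_top" by (intro tendsto_intros)
    moreover have "(ell2_norm (\<lambda>n. E l (ell2_unit k) n - ell2_unit k n))\<^sup>2 = 1 - M l k k" for l
    proof -
      let ?u = "E l (ell2_unit k)" and ?v = "ell2_unit k"
      have i: "?u \<in> ell2" "?v \<in> ell2" by (simp_all add: E_in ell2_unit)
      have "ell2_inner (\<lambda>n. ?u n - ?v n) (\<lambda>n. ?u n - ?v n)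
          = (ell2_inner ?u ?u - ell2_inner ?u ?v) - (ell2_inner ?v ?u - ell2_inner ?v ?v)"
        by (simp only: ell2_inner_diff_left ell2_inner_diff_right ell2_diff i)
      moreover have "ell2_inner ?u ?u = complex_of_real (M l k k)" using inner_E_unit[of l k l] by simp
      moreover have "ell2_inner ?u ?v = complex_of_real (M l k k)"
        by (simp only: ell2_inner_unit_right E_unit)
      moreover have "ell2_inner ?v ?u = complex_of_real (M l k k)"
        by (simp only: ell2_inner_unit_left E_unit complex_cnj_complex_of_real)
      moreover have "ell2_inner ?v ?v = 1" by (simp add: ell2_inner_unit_right) (simp add: ell2_unit_def)
      ultimately have "complex_of_real ((ell2_norm (\<lambda>n. ?u n - ?v n))\<^sup>2) = complex_of_real (1 - M l k k)"
        by (simp only: ell2_inner_self[OF ell2_diff(1)[OF i]]) simp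
      then show ?thesis by (simp only: of_real_eq_iff)
    qed
    ultimately have "((\<lambda>l. (ell2_norm (\<lambda>n. E l (ell2_unit k) n - ell2_unit k n))\<^sup>2) \<longlongrightarrow> 0) at_top"
      by simp
    then show "((\<lambda>l. ell2_norm (\<lambda>n. E l (ell2_unit k) n - ell2_unit k n)) \<longlongrightarrow> 0) at_top"
      by (rule sqrt_tendsto_0) (rule ell2_norm_nonneg[OF ell2_diff(1)[OF E_in[OF ell2_unit] ell2_unit]])
  qed
qed

sublocale E: ell2_resolution E
  by unfold_locales (rule E_resolution)

text \<open>The expanded form of the squared modulus of the sum of \<open>x j * p j\<close> over
  \<open>j < N\<close>. It is the density relative to \<open>\<rho>\<close> of the Stieltjes measure
  of the truncated vector.\<close>

definition density_poly :: "nat \<Rightarrow> (nat \<Rightarrow> complex) \<Rightarrow> real \<Rightarrow> real" where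
  "density_poly N x s = (\<Sum>j<N. \<Sum>k<N. Re (x j * cnj (x k)) * (p j s * p k s))"

lemma density_poly_nonneg: "0 \<le> density_poly N x s"
proof -
  have "density_poly N x s = (\<Sum>j<N. Re (x j) * p j s)\<^sup>2 + (\<Sum>j<N. Im (x j) * p j s)\<^sup>2"
    unfolding density_poly_def power2_eq_square sum_product sum.distrib[symmetric]
    by (intro sum.cong refl) (simp add: algebra_simps)
  then show ?thesis by simp
qed

lemma density_poly_bdd: "bdd (density_poly N x)"
  unfolding density_poly_def[abs_def] by (intro bdd_sum bdd_mult bdd_const bdd_p)

lemma integral_density_poly:
  assumes "bdd \<phi>"
  shows "(\<Sum>j<N. \<Sum>k<N. Re (x j * cnj (x k)) * (\<integral>s. \<phi> s * (p j s * p k s) \<partial>\<rho>)) = (\<integral>s. \<phi> s * density_poly N x s \<partial>\<rho>)"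
proof -
  have "(\<integral>s. \<phi> s * density_poly N x s \<partial>\<rho>) = (\<integral>s. (\<Sum>j<N. \<Sum>k<N. Re (x j * cnj (x k)) * (\<phi> s * (p j s * p k s))) \<partial>\<rho>)"
    unfolding density_poly_def sum_distrib_left
    by (intro Bochner_Integration.integral_cong sum.cong refl) (simp only: mult_ac)
  also have "\<dots> = (\<Sum>j<N. \<Sum>k<N. Re (x j * cnj (x k)) * (\<integral>s. \<phi> s * (p j s * p k s) \<partial>\<rho>))"
    using assms by (subst Bochner_Integration.integral_sum, simp)+ simp
  finally show ?thesis ..
qed

lemma lax_unit_integral: "lax_operator a (ell2_unit j) k = complex_of_real (\<integral>s. s * (p j s * p k s) \<partial>\<rho>)"
proof -
  have "(\<integral>s. s * (p j s * p k s) \<partial>\<rho>) = (\<integral>s. p j s * (s * p k s) \<partial>\<rho>)"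
    by (rule Bochner_Integration.integral_cong) auto
  also have "\<dots> = b k * (if j = Suc k then 1 else 0) + (if k = 0 then 0 else b (k - 1) * (if j = k - 1 then 1 else 0))"
    by (simp add: integral_x_p orthonormal del: orthonormal_poly.simps)
  finally show ?thesis by (auto simp: lax_operator_unit)
qed

text \<open>For truncated vectors the Stieltjes measure has a polynomial density, and both sides are
  the same finite combination of integrals of \<open>s * (p j s * p k s)\<close>. The general vector
  follows by a limit on both sides.\<close>

lemma form_eq:
  assumes bd: "\<And>n. a n \<le> B" and x: "x \<in> ell2"
  shows "integrable (stieltjes_measure E x) (\<lambda>l. l)"
    "Re (ell2_inner (lax_operator a x) x) = (\<integral>l. l \<partial>stieltjes_measure E x)"
proof -
  have L: "ell2_bounded_operator (lax_operator a)" by (rule lax_operator_bounded(1)[OF bd less_imp_le[OF pos]])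
  \<comment> \<open>One beyond \<open>R\<close>, since an atom at \<open>-R\<close> would make the
    projection at level \<open>-R\<close> nonzero.\<close>
  define C where "C = R + 1"
  have M_low: "M (- C) i j = 0" for i j
  proof -
    have "M (- C) i j = (\<integral>s. 0 \<partial>\<rho>)"
      unfolding M_def
    proof (rule integral_cong_AE)
      show "AE s in \<rho>. indicator {..- C} s * (p i s * p j s) = 0"
        using supp by eventually_elim (auto simp: C_def)
    qed auto
    then show ?thesis by simp
  qed
  have M_high: "M C i j = (if i = j then 1 else 0)" for i j
  proof -
    have "M C i j = (\<integral>s. p i s * p j s \<partial>\<rho>)"
      unfolding M_def
    proof (rule integral_cong_AE)
      show "AE s in \<rho>. indicator {..C} s * (p i s * p j s) = p i s * p j s"
        using supp by eventually_elim (auto simp: C_def)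
    qed auto
    then show ?thesis by (simp add: orthonormal)
  qed
  have F0: "E.F x (- C) = 0" if "x \<in> ell2" for x
  proof -
    have "E (- C) x = (\<lambda>n. 0)" by (auto simp: E_def matrix_operator_def M_low ell2_inner_def)
    then show ?thesis using that by (simp add: E.F_eq ell2_zero)
  qed
  have F1: "E.F x C = (ell2_norm x)\<^sup>2" if "x \<in> ell2" for x
  proof -
    have "E C x = x"
      by (rule ell2_operator_eqI[OF E_bounded ell2_bounded_operator_id _ that], unfold E_unit M_high)
        (auto simp: ell2_unit_def)
    then show ?thesis using that by (simp add: E.F_eq)
  qed
  note fm = E.stieltjes_first_moment[OF _ F0 F1]
  show "integrable (stieltjes_measure E x) (\<lambda>l. l)" by (rule fm(1)[OF x x x])
  have trunc: "Re (ell2_inner (lax_operator a (ell2_trunc N x)) (ell2_trunc N x))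
      = (\<integral>l. l \<partial>stieltjes_measure E (ell2_trunc N x))" for N
  proof -
    let ?u = "ell2_trunc N x" and ?g = "density_poly N x"
    have [measurable]: "?g \<in> borel_measurable borel" using density_poly_bdd by (rule bdd_measurable)
    have Fu: "E.F ?u l = (\<integral>s. indicator {..l} s * ?g s \<partial>\<rho>)" for l
      unfolding E.F_def ell2_form_trunc[OF E_bounded, where K = "M l", OF fun_cong[OF E_unit]]
      unfolding M_def by (rule integral_density_poly) auto
    have nu: "(ell2_norm ?u)\<^sup>2 = (\<integral>s. ?g s \<partial>\<rho>)"
    proof -
      have "(ell2_norm ?u)\<^sup>2 = (\<integral>s. indicator {..C} s * ?g s \<partial>\<rho>)"
        using F1[OF ell2_trunc, of N x] Fu by simp
      also have "\<dots> = (\<integral>s. ?g s \<partial>\<rho>)"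
      proof (rule integral_cong_AE)
        show "AE s in \<rho>. indicator {..C} s * ?g s = ?g s"
          using supp by eventually_elim (auto simp: C_def)
      qed auto
      finally show ?thesis .
    qed
    have "stieltjes_measure E ?u = density \<rho> (\<lambda>s. ennreal (?g s))"
    proof (rule measure_eqI_lessThan)
      fix l
      have "emeasure (density \<rho> (\<lambda>s. ennreal (?g s))) {l<..} = (\<integral>\<^sup>+s. ennreal (indicator {l<..} s * ?g s) \<partial>\<rho>)"
        by (subst emeasure_density) (auto intro!: nn_integral_cong simp: indicator_def)
      also have "\<dots> = ennreal (\<integral>s. indicator {l<..} s * ?g s \<partial>\<rho>)"
        by (rule nn_integral_eq_integral) (auto intro!: bdd_integrable bdd_mult density_poly_bdd AE_I2 mult_nonneg_nonneg density_poly_nonneg)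
      also have "(\<integral>s. indicator {l<..} s * ?g s \<partial>\<rho>) = (\<integral>s. ?g s - indicator {..l} s * ?g s \<partial>\<rho>)"
        by (rule Bochner_Integration.integral_cong) (auto simp: indicator_def)
      also have "\<dots> = (ell2_norm ?u)\<^sup>2 - E.F ?u l"
        unfolding Fu nu
        by (rule Bochner_Integration.integral_diff) (auto intro!: bdd_integrable bdd_mult density_poly_bdd)
      finally show "emeasure (stieltjes_measure E ?u) {l<..} = emeasure (density \<rho> (\<lambda>s. ennreal (?g s))) {l<..}"
        using E.emeasure_\<mu>_Ioi[OF ell2_trunc, of N x l] by simp
      show "emeasure (stieltjes_measure E ?u) {l<..} < \<infinity>"
        using E.emeasure_\<mu>_Ioi[OF ell2_trunc, of N x l] by simp
    qed auto
    then have "(\<integral>l. l \<partial>stieltjes_measure E ?u) = (\<integral>s. ?g s * s \<partial>\<rho>)"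
      using density_poly_nonneg[of N x] by (simp add: integral_density)
    also have "\<dots> = (\<integral>s. s * ?g s \<partial>\<rho>)" by (simp add: mult.commute)
    also have "\<dots> = (\<Sum>j<N. \<Sum>k<N. Re (x j * cnj (x k)) * (\<integral>s. s * (p j s * p k s) \<partial>\<rho>))"
      by (rule integral_density_poly[symmetric]) auto
    also have "\<dots> = Re (ell2_inner (lax_operator a ?u) ?u)"
      by (rule ell2_form_trunc[OF L lax_unit_integral, symmetric])
    finally show ?thesis ..
  qed
  have "(\<lambda>N. Re (ell2_inner (lax_operator a (ell2_trunc N x)) (ell2_trunc N x))) \<longlonglongrightarrow> Re (ell2_inner (lax_operator a x) x)"
    by (intro tendsto_Re ell2_form_trunc_tendsto[OF L x])
  \<comment> \<open>The measure varies with \<open>N\<close>, so the limit is taken in the form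
    integrated by parts: there only the values of the distribution function vary, and they stay
    below the squared norm of \<open>x\<close> on a bounded interval.\<close>
  moreover have "(\<lambda>N. \<integral>l. l \<partial>stieltjes_measure E (ell2_trunc N x)) \<longlonglongrightarrow> (\<integral>l. l \<partial>stieltjes_measure E x)"
    unfolding fm(2)[OF x x x] fm(2)[OF ell2_trunc ell2_trunc ell2_trunc]
  proof (intro tendsto_diff tendsto_mult_left)
    have "(\<lambda>N. Re (ell2_inner (ell2_trunc N x) (ell2_trunc N x))) \<longlonglongrightarrow> Re (ell2_inner x x)"
      by (intro tendsto_Re ell2_form_trunc_tendsto[OF ell2_bounded_operator_id x])
    then show "(\<lambda>N. (ell2_norm (ell2_trunc N x))\<^sup>2) \<longlonglongrightarrow> (ell2_norm x)\<^sup>2"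
      using x by (simp add: ell2_inner_self ell2_trunc)
    show "(\<lambda>N. \<integral>l. indicator {- C..C} l * E.F (ell2_trunc N x) l \<partial>lborel) \<longlonglongrightarrow> (\<integral>l. indicator {- C..C} l * E.F x l \<partial>lborel)"
    proof (rule integral_dominated_convergence[where w = "\<lambda>l. indicator {-C..C} l * (ell2_norm x)\<^sup>2"])
      show "AE l in lborel. (\<lambda>N. indicator {- C..C} l * E.F (ell2_trunc N x) l) \<longlonglongrightarrow> indicator {- C..C} l * E.F x l"
        unfolding E.F_def by (intro AE_I2 tendsto_mult_left tendsto_Re ell2_form_trunc_tendsto[OF E_bounded x])
      show "AE l in lborel. norm (indicator {- C..C} l * E.F (ell2_trunc N x) l) \<le> indicator {-C..C} l * (ell2_norm x)\<^sup>2" for N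
      proof (rule AE_I2)
        fix l
        have "(ell2_norm (ell2_trunc N x))\<^sup>2 \<le> (ell2_norm x)\<^sup>2"
          by (intro power_mono ell2_norm_trunc_le[OF x] ell2_norm_nonneg ell2_trunc)
        then show "norm (indicator {- C..C} l * E.F (ell2_trunc N x) l) \<le> indicator {-C..C} l * (ell2_norm x)\<^sup>2"
          using E.F_bounds[OF ell2_trunc, of N x l] by (auto simp: indicator_def)
      qed
      show "integrable lborel (\<lambda>l. indicator {-C..C} l * (ell2_norm x)\<^sup>2)"
        by (intro integrable_mult_left integrable_real_indicator) (auto simp: emeasure_lborel_Icc_eq)
    qed (use E.F_measurable[OF x] E.F_measurable[OF ell2_trunc] in auto)
  qed
  ultimately show "Re (ell2_inner (lax_operator a x) x) = (\<integral>l. l \<partial>stieltjes_measure E x)"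
    unfolding trunc by (rule LIMSEQ_unique)
qed

theorem has_spectral_measure_lax:
  assumes bd: "\<And>n. a n \<le> B"
  shows "has_spectral_measure (lax_operator a) (ell2_unit 0) \<rho>"
  unfolding has_spectral_measure_def
proof (intro conjI exI[of _ E])
  show sa: "ell2_bounded_selfadjoint (lax_operator a)"
    by (rule lax_operator_selfadjoint[OF bd less_imp_le[OF pos]])
  show "resolution_of_identity_of (lax_operator a) E"
    unfolding resolution_of_identity_of_def
  proof (intro conjI ballI E_resolution)
    fix x :: "nat \<Rightarrow> complex" assume x: "x \<in> ell2"
    have Lx: "lax_operator a x \<in> ell2"
      by (rule ell2_bounded_operatorD(1)[OF lax_operator_bounded(1)[OF bd less_imp_le[OF pos]] x])
    show "integrable (stieltjes_measure E x) (\<lambda>l. l)" by (rule form_eq(1)[OF bd x])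
    have "cnj (ell2_inner (lax_operator a x) x) = ell2_inner (lax_operator a x) x"
      using ell2_inner_cnj[OF Lx x] sa x by (simp add: ell2_bounded_selfadjoint_def)
    then have "Im (ell2_inner (lax_operator a x) x) = 0" by (simp add: complex_eq_iff)
    then show "ell2_inner (lax_operator a x) x = complex_of_real (\<integral>l. l \<partial>stieltjes_measure E x)"
      unfolding form_eq(2)[OF bd x, symmetric] by (simp add: complex_eq_iff)
  qed
  show "\<rho> = stieltjes_measure E (ell2_unit 0)"
  proof (rule measure_eqI_lessThan[symmetric])
    fix l
    have "E.F (ell2_unit 0) l = measure \<rho> {..l}"
      by (simp add: E.F_eq ell2_unit norm_E_unit M_def)
    moreover have "1 - measure \<rho> {..l} = measure \<rho> {l<..}"
    proof -
      have "{l<..} = space \<rho> - {..l}" by auto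
      then show ?thesis using prob_compl[of "{..l}"] by simp
    qed
    ultimately show "emeasure (stieltjes_measure E (ell2_unit 0)) {l<..} = emeasure \<rho> {l<..}"
      by (simp add: E.emeasure_\<mu>_Ioi ell2_unit ell2_norm_unit emeasure_eq_measure)
    show "emeasure (stieltjes_measure E (ell2_unit 0)) {l<..} < \<infinity>"
      by (simp add: E.emeasure_\<mu>_Ioi ell2_unit)
  qed auto
qed

end

section \<open>The essential spectrum\<close>

lemma finite_log_hamiltonian_tendsto:
  assumes pos: "\<And>n. 0 < a n" and fin: "finite_log_hamiltonian a"
  shows "a \<longlonglongrightarrow> 1" "\<exists>c>0. (\<lambda>n. \<Prod>j\<le>n. a j) \<longlonglongrightarrow> c"
proof -
  have s: "summable (\<lambda>n. ln (a n))"
    using summable_mult[OF fin[unfolded finite_log_hamiltonian_def], of 2] by simp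
  have "(\<lambda>n. exp (ln (a n))) \<longlonglongrightarrow> exp 0"
    by (intro tendsto_exp summable_LIMSEQ_zero[OF s])
  then show "a \<longlonglongrightarrow> 1" using pos by simp
  have "(\<lambda>n. exp (\<Sum>j\<le>n. ln (a j))) \<longlonglongrightarrow> exp (\<Sum>n. ln (a n))"
    by (intro tendsto_exp summable_LIMSEQ'[OF s])
  moreover have "exp (\<Sum>j\<le>n. ln (a j)) = (\<Prod>j\<le>n. a j)" for n
    using pos by (simp add: exp_sum)
  ultimately show "\<exists>c>0. (\<lambda>n. \<Prod>j\<le>n. a j) \<longlonglongrightarrow> c"
    by (intro exI[of _ "exp (\<Sum>n. ln (a n))"]) simp
qed

lemma mass_points_subset_support:
  assumes "sets \<rho> = sets borel"
  shows "mass_points \<rho> \<subseteq> topological_support \<rho>"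
  unfolding mass_points_def topological_support_def
proof safe
  fix x :: real and U :: "real set" assume x: "0 < emeasure \<rho> {x}" and U: "open U" "x \<in> U"
  have "emeasure \<rho> {x} \<le> emeasure \<rho> U" using U assms by (intro emeasure_mono) auto
  with x show "0 < emeasure \<rho> U" by simp
qed

lemma cos_three_term:
  "cos (real (Suc (Suc n)) * \<theta>) + cos (real n * \<theta>) = 2 * cos \<theta> * cos (real (Suc n) * \<theta>)"
proof -
  have "cos (u + \<theta>) + cos (u - \<theta>) = 2 * cos \<theta> * cos u" for u by (simp add: cos_add cos_diff)
  from this[of "real (Suc n) * \<theta>"] show ?thesis by (simp add: distrib_right)
qed

lemma sin_three_term:
  "sin (real (Suc (Suc n)) * \<theta>) + sin (real n * \<theta>) = 2 * cos \<theta> * sin (real (Suc n) * \<theta>)"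
proof -
  have "sin (u + \<theta>) + sin (u - \<theta>) = 2 * cos \<theta> * sin u" for u by (simp add: sin_add sin_diff)
  from this[of "real (Suc n) * \<theta>"] show ?thesis by (simp add: distrib_right)
qed

context jacobi_measure
begin

text \<open>If the support keeps distance \<open>e\<close> from \<open>x\<close>, multiplication by
  \<open>s - x\<close> enlarges the norm of every polynomial by at least \<open>e\<close>; by
  Parseval this is an inequality for the finite sequence \<open>y\<close>. The matrix spreads
  \<open>y\<close> by one place, hence the range \<open>Suc N\<close>.\<close>

lemma weyl_inequality:
  assumes gap: "AE s in \<rho>. e \<le> \<bar>s - x\<bar>" and e: "0 \<le> e" and y: "\<And>n. N \<le> n \<Longrightarrow> y n = 0"
  shows "e\<^sup>2 * (\<Sum>n<N. (y n)\<^sup>2)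
    \<le> (\<Sum>n<Suc N. (b n * y (Suc n) + (if n = 0 then 0 else b (n - 1) * y (n - 1)) - x * y n)\<^sup>2)"
proof -
  define f where "f = (\<lambda>s. \<Sum>n<N. y n * p n s)"
  have fS: "f \<in> S" unfolding f_def S_def by blast
  have bf: "bdd f" by (rule bdd_S[OF fS])
  have gS: "approximable (\<lambda>s. s * f s - x * f s)"
    by (intro approximable_diff approximable_x approximable_scale approximable_S fS)
  have cf: "coef f n = y n" for n
  proof -
    have "coef f n = (\<integral>s. (\<Sum>k<N. y k * (p k s * p n s)) \<partial>\<rho>)"
      unfolding coef_def f_def by (simp add: sum_distrib_right mult.assoc)
    also have "\<dots> = (\<Sum>k<N. y k * (\<integral>s. p k s * p n s \<partial>\<rho>))"
      by (subst Bochner_Integration.integral_sum) auto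
    also have "\<dots> = (if n < N then y n else 0)"
      unfolding orthonormal by (simp add: if_distrib cong: if_cong)
    finally show ?thesis using y[of n] by auto
  qed
  have cg: "coef (\<lambda>s. s * f s - x * f s) n
     = b n * y (Suc n) + (if n = 0 then 0 else b (n - 1) * y (n - 1)) - x * y n" for n
  proof -
    have "coef (\<lambda>s. s * f s - x * f s) n = (\<integral>s. f s * (s * p n s) - x * (f s * p n s) \<partial>\<rho>)"
      unfolding coef_def by (rule Bochner_Integration.integral_cong) (auto simp: algebra_simps)
    also have "\<dots> = (\<integral>s. f s * (s * p n s) \<partial>\<rho>) - x * coef f n"
      unfolding coef_def using bf by (subst Bochner_Integration.integral_diff) auto
    finally show ?thesis unfolding integral_x_p[OF bf] by (simp add: cf coef_def[symmetric])
  qed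
  have "(\<integral>s. (f s)\<^sup>2 \<partial>\<rho>) = (\<Sum>n<N. (y n)\<^sup>2)"
  proof -
    have "(\<Sum>n. (y n)\<^sup>2) = (\<Sum>n<N. (y n)\<^sup>2)" by (rule suminf_finite) (use y in auto)
    then show ?thesis using sums_unique[OF parseval[OF approximable_S[OF fS]]] by (simp add: cf)
  qed
  moreover have "(\<integral>s. (s * f s - x * f s)\<^sup>2 \<partial>\<rho>)
     = (\<Sum>n<Suc N. (b n * y (Suc n) + (if n = 0 then 0 else b (n - 1) * y (n - 1)) - x * y n)\<^sup>2)"
    using sums_unique[OF parseval[OF gS]] y unfolding cg
    by (subst (asm) suminf_finite[of "{..<Suc N}"]) auto
  moreover have "(\<integral>s. e\<^sup>2 * (f s)\<^sup>2 \<partial>\<rho>) \<le> (\<integral>s. (s * f s - x * f s)\<^sup>2 \<partial>\<rho>)"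
  proof (rule integral_mono_AE)
    show "AE s in \<rho>. e\<^sup>2 * (f s)\<^sup>2 \<le> (s * f s - x * f s)\<^sup>2"
      using gap
    proof eventually_elim
      case (elim s)
      have "e\<^sup>2 \<le> (s - x)\<^sup>2" using elim e by (simp add: abs_le_square_iff[symmetric])
      then have "e\<^sup>2 * (f s)\<^sup>2 \<le> (s - x)\<^sup>2 * (f s)\<^sup>2" by (rule mult_right_mono) simp
      then show ?case by (simp add: left_diff_distrib[symmetric] power_mult_distrib)
    qed
  qed (use bf in auto)
  ultimately show ?thesis by simp
qed

text \<open>A window of length \<open>L\<close> is cut from a solution of the free recurrence.
  Inside the window the residual comes only from \<open>b n - 1\<close> and is at most
  \<open>2 d\<close>. At the four end positions collected in \<open>Q\<close> it is a sum of three
  terms of size at most 2, hence the constant \<open>4 * 36 = 144\<close>; \<open>L + 2\<close>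
  counts the indices where \<open>y\<close> can contribute.\<close>

lemma weyl_residual_bound:
  assumes d: "0 \<le> d" "d \<le> 1" and b: "\<And>n. K \<le> n \<Longrightarrow> \<bar>b n - 1\<bar> \<le> d"
    and c: "\<And>n. \<bar>c n\<bar> \<le> 1" "\<And>n. c (Suc (Suc n)) + c n = x * c (Suc n)" and x: "\<bar>x\<bar> \<le> 2"
    and y: "y = (\<lambda>n. if K + 2 \<le> n \<and> n < K + 2 + L then c n else 0)"
  shows "(\<Sum>n<Suc (K + 2 + L). (b n * y (Suc n) + (if n = 0 then 0 else b (n - 1) * y (n - 1)) - x * y n)\<^sup>2)
    \<le> 4 * d\<^sup>2 * (real L + 2) + 144"
proof -
  define r where "r n = b n * y (Suc n) + (if n = 0 then 0 else b (n - 1) * y (n - 1)) - x * y n" for n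
  define Q where "Q = {K + 1, K + 2, K + 1 + L, K + 2 + L}"
  have y1: "\<bar>y n\<bar> \<le> 1" for n using c(1)[of n] by (auto simp: y)
  have r: "(r n)\<^sup>2 \<le> 4 * d\<^sup>2 * indicator {K + 1..K + 2 + L} n + 36 * indicator Q n" for n
  proof -
    consider "n < K + 1" | "K + 2 + L < n" | "n \<in> Q" | "K + 2 < n" "n < K + 1 + L"
      unfolding Q_def by force
    then show ?thesis
    proof cases
      case 1
      then have "r n = 0" by (auto simp: r_def y)
      then show ?thesis by (simp add: indicator_def)
    next
      case 2
      then have "r n = 0" by (auto simp: r_def y)
      then show ?thesis by (simp add: indicator_def)
    next
      case 3
      then obtain m where m: "n = Suc m" "K \<le> m" by (cases n) (auto simp: Q_def)
      have bm: "\<bar>b n\<bar> \<le> 2" "\<bar>b m\<bar> \<le> 2" using b[of n] b[of m] m d by linarith+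
      have "\<bar>b n * y (Suc n)\<bar> \<le> 2 * 1" "\<bar>b m * y m\<bar> \<le> 2 * 1" "\<bar>x * y n\<bar> \<le> 2 * 1"
        unfolding abs_mult using bm x y1 by (intro mult_mono; simp)+
      then have "\<bar>r n\<bar> \<le> 6" unfolding r_def m(1) by simp
      then have "(r n)\<^sup>2 \<le> 36" using abs_le_square_iff[of "r n" 6] by simp
      moreover have "0 \<le> 4 * d\<^sup>2 * (indicator {K + 1..K + 2 + L} n :: real)" by simp
      moreover have "indicator Q n = (1 :: real)" using 3 by simp
      ultimately show ?thesis by linarith
    next
      case 4
      then obtain m where m: "n = Suc m" "K \<le> m" by (cases n) auto
      have "r n = b n * c (Suc n) + b m * c m - x * c n" using 4 m by (simp add: r_def y)
      also have "\<dots> = (b n - 1) * c (Suc n) + (b m - 1) * c m"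
        using c(2)[of m] m by (simp add: algebra_simps)
      finally have rn: "r n = (b n - 1) * c (Suc n) + (b m - 1) * c m" .
      have "\<bar>(b n - 1) * c (Suc n)\<bar> \<le> d * 1" "\<bar>(b m - 1) * c m\<bar> \<le> d * 1"
        unfolding abs_mult using b[of n] b[of m] m c(1) d by (intro mult_mono; simp)+
      then have "\<bar>r n\<bar> \<le> 2 * d" unfolding rn by simp
      then have "(r n)\<^sup>2 \<le> (2 * d)\<^sup>2" using abs_le_square_iff[of "r n" "2 * d"] d by simp
      then have "(r n)\<^sup>2 \<le> 4 * d\<^sup>2" by (simp add: power_mult_distrib)
      moreover have ind1: "indicator {K + 1..K + 2 + L} n = (1 :: real)" using 4 by simp
      moreover have "0 \<le> 36 * (indicator Q n :: real)" by simp
      ultimately show ?thesis unfolding ind1 by linarith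
    qed
  qed
  have ind: "(\<Sum>n<M. indicator A n :: real) \<le> real (card A)" if "finite A" for A :: "nat set" and M
  proof -
    have "(\<Sum>n<M. indicator A n :: real) = (\<Sum>n\<in>{..<M} \<inter> A. 1)"
      by (rule sum.mono_neutral_cong_right) (auto simp: indicator_def)
    also have "\<dots> \<le> real (card A)" using that by (auto intro: card_mono)
    finally show ?thesis .
  qed
  have "(\<Sum>n<Suc (K + 2 + L). (r n)\<^sup>2)
     \<le> (\<Sum>n<Suc (K + 2 + L). 4 * d\<^sup>2 * indicator {K + 1..K + 2 + L} n + 36 * indicator Q n)"
    by (intro sum_mono r)
  also have "\<dots> = 4 * d\<^sup>2 * (\<Sum>n<Suc (K + 2 + L). indicator {K + 1..K + 2 + L} n) + 36 * (\<Sum>n<Suc (K + 2 + L). indicator Q n)"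
    by (simp only: sum.distrib sum_distrib_left)
  also have "\<dots> \<le> 4 * d\<^sup>2 * real (card {K + 1..K + 2 + L}) + 36 * real (card Q)"
    by (intro add_mono mult_left_mono ind) (auto simp: Q_def)
  also have "\<dots> \<le> 4 * d\<^sup>2 * (real L + 2) + 36 * 4"
    using card_insert_le_m1[of 4 "{K + 2, K + 1 + L, K + 2 + L}" "K + 1"]
    by (intro add_mono mult_left_mono) (auto simp: Q_def card_insert_if)
  finally show ?thesis by (simp add: r_def)
qed

text \<open>With \<open>x = 2 cos \<theta>\<close> both \<open>cos (n \<theta>)\<close> and
  \<open>sin (n \<theta>)\<close> solve the free recurrence. Adding the two inequalities makes the
  left side exactly \<open>e^2 L\<close>, so no lower estimate for either sum is needed, not even at
  the end points. A gap around \<open>x\<close> is refuted because the right side grows with a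
  smaller slope in \<open>L\<close>.\<close>

lemma interval_subset_support:
  assumes lim: "a \<longlonglongrightarrow> 1"
  shows "{-2..2} \<subseteq> topological_support \<rho>"
proof
  fix x :: real assume "x \<in> {-2..2}"
  then have x: "\<bar>x\<bar> \<le> 2" by auto
  define \<theta> where "\<theta> = arccos (x / 2)"
  have th: "x = 2 * cos \<theta>" unfolding \<theta>_def using x by (simp add: cos_arccos)
  have limb: "b \<longlonglongrightarrow> 1" using tendsto_real_sqrt[OF lim] by simp
  show "x \<in> topological_support \<rho>"
    unfolding topological_support_def
  proof safe
    fix U :: "real set" assume U: "open U" "x \<in> U"
    show "0 < emeasure \<rho> U"
    proof (rule ccontr)
      assume "\<not> 0 < emeasure \<rho> U"
      then have "emeasure \<rho> U = 0" by (simp add: zero_less_iff_neq_zero)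
      then have AE_U: "AE s in \<rho>. s \<notin> U" using U by (intro AE_not_in) auto
      obtain e where e: "e > 0" "ball x e \<subseteq> U" using U open_contains_ball by blast
      have gap: "AE s in \<rho>. e \<le> \<bar>s - x\<bar>"
        using AE_U by eventually_elim (use e in \<open>auto simp: subset_eq dist_real_def not_less abs_minus_commute\<close>)
      \<comment> \<open>\<open>d \<le> e / 4\<close> makes the slope \<open>8 d^2\<close> of the two
        residual bounds together at most \<open>e^2 / 2\<close>.\<close>
      define d where "d = min 1 (e / 4)"
      have d: "0 < d" "d \<le> 1" "d \<le> e / 4" using e by (auto simp: d_def)
      obtain K where K: "\<And>n. K \<le> n \<Longrightarrow> \<bar>b n - 1\<bar> \<le> d"
        using LIMSEQ_D[OF limb d(1)] by (auto intro: less_imp_le)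
      have one: "e\<^sup>2 * (\<Sum>n<L. (c (K + 2 + n))\<^sup>2) \<le> 4 * d\<^sup>2 * (real L + 2) + 144"
        if c: "\<And>n. \<bar>c n\<bar> \<le> 1" "\<And>n. c (Suc (Suc n)) + c n = x * c (Suc n)" for c and L :: nat
      proof -
        define y where "y = (\<lambda>n. if K + 2 \<le> n \<and> n < K + 2 + L then c n else 0)"
        have "(\<Sum>n<K + 2 + L. (y n)\<^sup>2) = (\<Sum>n\<in>{K + 2..<K + 2 + L}. (c n)\<^sup>2)"
          by (rule sum.mono_neutral_cong_right) (auto simp: y_def)
        also have "\<dots> = (\<Sum>n<L. (c (K + 2 + n))\<^sup>2)"
          by (induction L) auto
        finally have "e\<^sup>2 * (\<Sum>n<L. (c (K + 2 + n))\<^sup>2) = e\<^sup>2 * (\<Sum>n<K + 2 + L. (y n)\<^sup>2)" by simp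
        also have "\<dots> \<le> (\<Sum>n<Suc (K + 2 + L). (b n * y (Suc n) + (if n = 0 then 0 else b (n - 1) * y (n - 1)) - x * y n)\<^sup>2)"
          by (rule weyl_inequality[OF gap]) (use e in \<open>auto simp: y_def\<close>)
        also have "\<dots> \<le> 4 * d\<^sup>2 * (real L + 2) + 144"
          by (rule weyl_residual_bound[OF _ _ K c x y_def]) (use d in auto)
        finally show ?thesis .
      qed
      have L: "e\<^sup>2 * real L \<le> 2 * (4 * d\<^sup>2 * (real L + 2) + 144)" for L
      proof -
        have "e\<^sup>2 * (\<Sum>n<L. (cos (real (K + 2 + n) * \<theta>))\<^sup>2) \<le> 4 * d\<^sup>2 * (real L + 2) + 144"
          by (rule one[of "\<lambda>n. cos (real n * \<theta>)"]) (rule abs_cos_le_one, simp only: th cos_three_term)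
        moreover have "e\<^sup>2 * (\<Sum>n<L. (sin (real (K + 2 + n) * \<theta>))\<^sup>2) \<le> 4 * d\<^sup>2 * (real L + 2) + 144"
          by (rule one[of "\<lambda>n. sin (real n * \<theta>)"]) (rule abs_sin_le_one, simp only: th sin_three_term)
        ultimately have "e\<^sup>2 * ((\<Sum>n<L. (cos (real (K + 2 + n) * \<theta>))\<^sup>2) + (\<Sum>n<L. (sin (real (K + 2 + n) * \<theta>))\<^sup>2))
            \<le> 2 * (4 * d\<^sup>2 * (real L + 2) + 144)"
          unfolding distrib_left by linarith
        also have "(\<Sum>n<L. (cos (real (K + 2 + n) * \<theta>))\<^sup>2) + (\<Sum>n<L. (sin (real (K + 2 + n) * \<theta>))\<^sup>2) = real L"
          by (simp only: sum.distrib[symmetric] sin_cos_squared_add2) simp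
        finally show ?thesis .
      qed
      have "8 * d\<^sup>2 \<le> e\<^sup>2 / 2"
      proof -
        have "d\<^sup>2 \<le> (e / 4)\<^sup>2" using d by (intro power_mono) auto
        then show ?thesis by (simp add: power2_eq_square)
      qed
      \<comment> \<open>Large enough for half of \<open>e^2 L\<close> to exceed
        \<open>e^2 + 288\<close>, the constant part of the bound below.\<close>
      obtain L :: nat where L0: "2 * e\<^sup>2 + 1000 < e\<^sup>2 * real L"
      proof -
        have "\<exists>L. 2 * e\<^sup>2 + 1000 < real L * e\<^sup>2" using reals_Archimedean3[of "e\<^sup>2"] e by simp
        then show ?thesis using that by (auto simp: mult.commute)
      qed
      have "8 * d\<^sup>2 * (real L + 2) \<le> e\<^sup>2 / 2 * (real L + 2)"
        using \<open>8 * d\<^sup>2 \<le> e\<^sup>2 / 2\<close> by (intro mult_right_mono) auto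
      then have "e\<^sup>2 * real L \<le> e\<^sup>2 / 2 * (real L + 2) + 288"
      proof -
        have "2 * (4 * d\<^sup>2 * (real L + 2) + 144) = 8 * d\<^sup>2 * (real L + 2) + 288" by simp
        then show ?thesis using L[of L] \<open>8 * d\<^sup>2 * (real L + 2) \<le> e\<^sup>2 / 2 * (real L + 2)\<close> by linarith
      qed
      also have "\<dots> = e\<^sup>2 * real L / 2 + e\<^sup>2 + 288" by (simp add: algebra_simps)
      finally show False using L0 by linarith
    qed
  qed
qed

text \<open>The form of the Jacobi matrix is twice the sum of \<open>b n * c n * c (n + 1)\<close>.
  Beyond \<open>K\<close> the weights are at most \<open>1 + d\<close> and
  \<open>2 |c n c (n + 1)| \<le> (c n)^2 + (c (n + 1))^2\<close>; the first \<open>K\<close> terms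
  are paid for by the coefficients themselves. For a weakly null sequence of unit vectors the second
  contribution disappears.\<close>

lemma form_bound:
  assumes f: "approximable f" "(\<integral>s. (f s)\<^sup>2 \<partial>\<rho>) = 1"
    and d: "0 \<le> d" and b: "\<And>n. K \<le> n \<Longrightarrow> b n \<le> 1 + d" "\<And>n. b n \<le> B"
  shows "\<bar>\<integral>s. s * (f s)\<^sup>2 \<partial>\<rho>\<bar> \<le> 2 * (1 + d) + 2 * B * (\<Sum>n<K. \<bar>coef f n\<bar>)"
proof -
  define c where "c = coef f"
  have bf: "bdd f" using f by (simp add: approximable_def)
  have sq: "(\<lambda>n. (c n)\<^sup>2) sums 1" using parseval[OF f(1)] f(2) by (simp add: c_def)
  have c_le: "(\<Sum>n\<in>I. (c n)\<^sup>2) \<le> 1" if "finite I" for I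
    using sum_le_suminf[OF sums_summable[OF sq] that] sums_unique[OF sq] by simp
  have c1: "\<bar>c n\<bar> \<le> 1" for n using c_le[of "{n}"] by (simp add: abs_square_le_1)
  have B0: "0 \<le> B" using b(2)[of 0] b_pos[of 0] by linarith
  define g where "g n = b n * c (Suc n) + (if n = 0 then 0 else b (n - 1) * c (n - 1))" for n
  have cg: "coef (\<lambda>s. s * f s) n = g n" for n
    unfolding coef_def g_def c_def using integral_x_p[OF bf, of n] by (simp add: mult_ac)
  have sums: "(\<lambda>n. c n * g n) sums (\<integral>s. s * (f s)\<^sup>2 \<partial>\<rho>)"
    using parseval_bilinear[OF f(1) approximable_x[OF f(1)]]
    by (simp add: cg c_def power2_eq_square mult_ac)
  define h where "h n = b n * \<bar>c n\<bar> * \<bar>c (Suc n)\<bar>" for n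
  have h_nn: "0 \<le> h n" for n using b_pos[of n] by (simp add: h_def)
  have part: "\<bar>\<Sum>n<N. c n * g n\<bar> \<le> 2 * (\<Sum>n<N. h n)" for N
  proof -
    have "\<bar>\<Sum>n<N. c n * g n\<bar> \<le> (\<Sum>n<N. \<bar>c n * g n\<bar>)" by (rule sum_abs)
    also have "\<dots> \<le> (\<Sum>n<N. h n + (if n = 0 then 0 else h (n - 1)))"
    proof (rule sum_mono)
      fix n
      have "\<bar>c n * g n\<bar> \<le> \<bar>c n\<bar> * (\<bar>b n * c (Suc n)\<bar> + \<bar>if n = 0 then 0 else b (n - 1) * c (n - 1)\<bar>)"
        unfolding abs_mult[of "c n"] g_def by (intro mult_left_mono abs_triangle_ineq) auto
      also have "\<dots> = h n + (if n = 0 then 0 else h (n - 1))"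
        using b_pos[of n] b_pos[of "n - 1"] by (auto simp: h_def abs_mult algebra_simps)
      finally show "\<bar>c n * g n\<bar> \<le> h n + (if n = 0 then 0 else h (n - 1))" .
    qed
    also have "\<dots> = (\<Sum>n<N. h n) + (\<Sum>n<N. if n = 0 then 0 else h (n - 1))" by (rule sum.distrib)
    also have "(\<Sum>n<N. if n = 0 then 0 else h (n - 1)) \<le> (\<Sum>n<N. h n)"
    proof (cases N)
      case (Suc M)
      have "(\<Sum>n<N. if n = 0 then 0 else h (n - 1)) = (\<Sum>n<M. h n)"
        unfolding Suc by (subst sum.lessThan_Suc_shift) simp
      also have "\<dots> \<le> (\<Sum>n<N. h n)" using h_nn Suc by simp
      finally show ?thesis .
    qed simp
    finally show ?thesis by simp
  qed
  have hsum: "2 * (\<Sum>n<N. h n) \<le> 2 * (1 + d) + 2 * B * (\<Sum>n<K. \<bar>c n\<bar>)" for N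
  proof -
    have h1: "2 * h n \<le> (1 + d) * ((c n)\<^sup>2 + (c (Suc n))\<^sup>2) + (if n < K then 2 * B * \<bar>c n\<bar> else 0)" for n
    proof (cases "n < K")
      case True
      have "h n \<le> B * \<bar>c n\<bar> * 1"
        unfolding h_def using b(2)[of n] c1[of "Suc n"] b_pos[of n] B0 by (intro mult_mono) auto
      moreover have "0 \<le> (1 + d) * ((c n)\<^sup>2 + (c (Suc n))\<^sup>2)" using d by simp
      ultimately show ?thesis using True by simp
    next
      case False
      have "h n \<le> (1 + d) * (\<bar>c n\<bar> * \<bar>c (Suc n)\<bar>)"
        unfolding h_def mult.assoc using b(1)[of n] False by (intro mult_right_mono) auto
      moreover have "2 * (\<bar>c n\<bar> * \<bar>c (Suc n)\<bar>) \<le> (c n)\<^sup>2 + (c (Suc n))\<^sup>2"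
        using sum_squares_bound[of "\<bar>c n\<bar>" "\<bar>c (Suc n)\<bar>"] by (simp add: mult.assoc)
      then have "(1 + d) * (2 * (\<bar>c n\<bar> * \<bar>c (Suc n)\<bar>)) \<le> (1 + d) * ((c n)\<^sup>2 + (c (Suc n))\<^sup>2)"
        using d by (intro mult_left_mono) auto
      ultimately show ?thesis using False by (simp add: algebra_simps)
    qed
    have "2 * (\<Sum>n<N. h n) \<le> (\<Sum>n<N. (1 + d) * ((c n)\<^sup>2 + (c (Suc n))\<^sup>2) + (if n < K then 2 * B * \<bar>c n\<bar> else 0))"
      unfolding sum_distrib_left by (intro sum_mono h1)
    also have "\<dots> = (1 + d) * ((\<Sum>n<N. (c n)\<^sup>2) + (\<Sum>n<N. (c (Suc n))\<^sup>2)) + (\<Sum>n<N. if n < K then 2 * B * \<bar>c n\<bar> else 0)"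
      by (simp only: sum.distrib sum_distrib_left[symmetric])
    also have "(\<Sum>n<N. (c (Suc n))\<^sup>2) \<le> 1"
      using c_le[of "{..<Suc N}"] unfolding sum.lessThan_Suc_shift by (simp add: zero_le_power2 order_trans[rotated])
    also have "(\<Sum>n<N. (c n)\<^sup>2) \<le> 1" using c_le[of "{..<N}"] by simp
    also have "(\<Sum>n<N. if n < K then 2 * B * \<bar>c n\<bar> else 0) = (\<Sum>n\<in>{..<N} \<inter> {..<K}. 2 * B * \<bar>c n\<bar>)"
      by (subst sum.inter_restrict) auto
    also have "\<dots> \<le> (\<Sum>n<K. 2 * B * \<bar>c n\<bar>)"
      using B0 by (intro sum_mono2) auto
    finally show ?thesis using d by (simp add: sum_distrib_left)
  qed
  have "(\<lambda>N. \<bar>\<Sum>n<N. c n * g n\<bar>) \<longlonglongrightarrow> \<bar>\<integral>s. s * (f s)\<^sup>2 \<partial>\<rho>\<bar>"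
    using sums unfolding sums_def by (rule tendsto_rabs)
  then have "\<bar>\<integral>s. s * (f s)\<^sup>2 \<partial>\<rho>\<bar> \<le> 2 * (1 + d) + 2 * B * (\<Sum>n<K. \<bar>c n\<bar>)"
    by (rule LIMSEQ_le_const2) (use order_trans[OF part hsum] in blast)
  then show ?thesis by (simp add: c_def)
qed

text \<open>The normalized indicators concentrate at \<open>x\<close>, so their forms tend to
  \<open>x\<close> in modulus at least; each fixed coefficient is at most a constant times the
  square root of the mass and tends to zero. Then \<open>form_bound\<close> applies with arbitrary
  \<open>d > 0\<close>.\<close>

lemma support_limit_point_le:
  assumes lim: "a \<longlonglongrightarrow> 1" and x: "x islimpt topological_support \<rho>"
  shows "\<bar>x\<bar> \<le> 2"
proof -
  have limb: "b \<longlonglongrightarrow> 1" using tendsto_real_sqrt[OF lim] by simp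
  obtain B where B: "\<And>n. b n \<le> B"
    using Bseq_eq_bounded[of b] convergent_imp_Bseq[OF convergentI[OF limb]]
    by (auto simp: Bseq_def abs_le_iff)
  have key: "\<bar>x\<bar> \<le> 2 * (1 + d)" if d: "d > 0" for d
  proof -
    obtain K where K: "\<And>n. K \<le> n \<Longrightarrow> b n \<le> 1 + d"
      using LIMSEQ_D[OF limb d] by (auto simp: abs_less_iff) (metis less_imp_le add.commute diff_less_eq)
    \<comment> \<open>The centre is removed: these sets still have positive mass, since
      \<open>x\<close> is a limit point of the support, but their mass tends to zero even if
      \<open>x\<close> is an atom.\<close>
    define I where "I j = ball x (inverse (real (Suc j))) - {x}" for j
    have I_open: "open (I j)" for j unfolding I_def by (intro open_Diff) auto
    then have I_meas [measurable]: "I j \<in> sets borel" for j by auto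
    have I_pos: "0 < prob (I j)" for j
    proof -
      have "open (ball x (inverse (real (Suc j))))" "x \<in> ball x (inverse (real (Suc j)))" by auto
      then obtain y where y: "y \<in> topological_support \<rho>" "y \<in> ball x (inverse (real (Suc j)))" "y \<noteq> x"
        using x unfolding islimpt_def by blast
      then have "0 < emeasure \<rho> (I j)"
        using I_open unfolding topological_support_def I_def by blast
      then show ?thesis by (simp add: emeasure_eq_measure)
    qed
    have I_lim: "(\<lambda>j. prob (I j)) \<longlonglongrightarrow> 0"
    proof -
      have "(\<lambda>j. prob (I j)) \<longlonglongrightarrow> prob (\<Inter>j. I j)"
      proof (rule finite_Lim_measure_decseq)
        show "decseq I"
          unfolding decseq_def I_def by (auto elim!: less_le_trans)
      qed auto
      moreover have "(\<Inter>j. I j) = {}"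
      proof (rule ccontr)
        assume "(\<Inter>j. I j) \<noteq> {}"
        then obtain y where y: "\<And>j. y \<in> I j" by blast
        then have "dist x y > 0" using y[of 0] by (auto simp: I_def)
        then obtain j where "inverse (real (Suc j)) < dist x y" using reals_Archimedean by blast
        then show False using y[of j] by (auto simp: I_def)
      qed
      ultimately show ?thesis by simp
    qed
    define f where "f j = (\<lambda>s. (1 / sqrt (prob (I j))) * indicator (I j) s)" for j
    have fa: "approximable (f j)" for j
      unfolding f_def by (intro approximable_scale approximable_indicator I_meas)
    have f2: "(f j s)\<^sup>2 = (1 / prob (I j)) * indicator (I j) s" for j s
      using I_pos[of j] by (auto simp: f_def indicator_def power_divide)
    have f1: "(\<integral>s. (f j s)\<^sup>2 \<partial>\<rho>) = 1" for j
      unfolding f2 using I_pos[of j] by simp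
    have fx: "\<bar>x\<bar> - inverse (real (Suc j)) \<le> \<bar>\<integral>s. s * (f j s)\<^sup>2 \<partial>\<rho>\<bar>" for j
    proof -
      have i: "integrable \<rho> (\<lambda>s. s * (f j s)\<^sup>2)" "integrable \<rho> (\<lambda>s. (f j s)\<^sup>2)"
        using fa[of j] unfolding approximable_def by auto
      have "\<bar>(\<integral>s. s * (f j s)\<^sup>2 \<partial>\<rho>) - x\<bar> = \<bar>\<integral>s. (s - x) * (f j s)\<^sup>2 \<partial>\<rho>\<bar>"
        using i f1[of j] by (simp add: left_diff_distrib)
      also have "\<dots> \<le> (\<integral>s. \<bar>(s - x) * (f j s)\<^sup>2\<bar> \<partial>\<rho>)" by (rule integral_abs_bound)
      also have "\<dots> \<le> (\<integral>s. inverse (real (Suc j)) * (f j s)\<^sup>2 \<partial>\<rho>)"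
      proof (rule integral_mono)
        show "integrable \<rho> (\<lambda>s. \<bar>(s - x) * (f j s)\<^sup>2\<bar>)"
          using i by (intro integrable_abs) (simp add: left_diff_distrib)
        show "integrable \<rho> (\<lambda>s. inverse (real (Suc j)) * (f j s)\<^sup>2)" using i by simp
        fix s
        show "\<bar>(s - x) * (f j s)\<^sup>2\<bar> \<le> inverse (real (Suc j)) * (f j s)\<^sup>2"
        proof (cases "s \<in> I j")
          case True
          then have "\<bar>s - x\<bar> \<le> inverse (real (Suc j))" by (auto simp: I_def dist_real_def abs_minus_commute)
          then show ?thesis unfolding abs_mult by (simp add: mult_right_mono)
        qed (simp add: f_def)
      qed
      also have "\<dots> = inverse (real (Suc j))" using f1[of j] by simp
      finally show ?thesis by linarith
    qed
    have cl: "(\<lambda>j. \<bar>coef (f j) n\<bar>) \<longlonglongrightarrow> 0" for n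
    proof -
      obtain C where C: "0 < C" "AE s in \<rho>. \<bar>p n s\<bar> \<le> C" using bddE[OF bdd_p] by blast
      have bound: "\<bar>coef (f j) n\<bar> \<le> C * sqrt (prob (I j))" for j
      proof -
        have bd: "bdd (f j)" using fa by (simp add: approximable_def)
        have "\<bar>coef (f j) n\<bar> \<le> (\<integral>s. \<bar>f j s * p n s\<bar> \<partial>\<rho>)" unfolding coef_def by (rule integral_abs_bound)
        also have "\<dots> \<le> (\<integral>s. C * f j s \<partial>\<rho>)"
        proof (rule integral_mono_AE)
          show "AE s in \<rho>. \<bar>f j s * p n s\<bar> \<le> C * f j s"
            using C(2)
          proof eventually_elim
            case (elim s)
            have "0 \<le> f j s" by (simp add: f_def)
            then show ?case using mult_right_mono[OF elim, of "f j s"] by (simp add: abs_mult mult.commute)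
          qed
        qed (use bd in auto)
        also have "\<dots> = C * ((1 / sqrt (prob (I j))) * prob (I j))" unfolding f_def by simp
        also have "\<dots> = C * sqrt (prob (I j))" using I_pos[of j] by (simp add: real_div_sqrt)
        finally show ?thesis .
      qed
      have "(\<lambda>j. C * sqrt (prob (I j))) \<longlonglongrightarrow> C * sqrt 0"
        by (intro tendsto_mult_left tendsto_real_sqrt I_lim)
      then have "(\<lambda>j. C * sqrt (prob (I j))) \<longlonglongrightarrow> 0" by simp
      then show ?thesis
        by (rule Lim_null_comparison[rotated]) (simp add: bound)
    qed
    have "(\<lambda>j. 2 * (1 + d) + 2 * B * (\<Sum>n<K. \<bar>coef (f j) n\<bar>)) \<longlonglongrightarrow> 2 * (1 + d) + 2 * B * (\<Sum>n<K. 0)"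
      by (intro tendsto_add tendsto_const tendsto_mult_left tendsto_sum cl)
    moreover have "(\<lambda>j. \<bar>x\<bar> - inverse (real (Suc j))) \<longlonglongrightarrow> \<bar>x\<bar> - 0"
      by (intro tendsto_diff tendsto_const LIMSEQ_inverse_real_of_nat)
    moreover have "\<bar>x\<bar> - inverse (real (Suc j)) \<le> 2 * (1 + d) + 2 * B * (\<Sum>n<K. \<bar>coef (f j) n\<bar>)" for j
      by (rule order_trans[OF fx form_bound[OF fa f1 _ K B]]) (use d in auto)
    ultimately have "\<bar>x\<bar> - 0 \<le> 2 * (1 + d) + 2 * B * (\<Sum>n<K. 0)"
      by (intro LIMSEQ_le[where X = "\<lambda>j. \<bar>x\<bar> - inverse (real (Suc j))"]) auto
    then show ?thesis by simp
  qed
  show ?thesis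
  proof (rule field_le_epsilon)
    fix e :: real assume "e > 0"
    then show "\<bar>x\<bar> \<le> 2 + e" using key[of "e / 2"] by simp
  qed
qed

section \<open>Symmetry and admissibility\<close>

lemma moment_odd: "odd k \<Longrightarrow> moment \<rho> k = 0"
  by (simp add: mom jacobi_moment_odd)

text \<open>The reflected measure has the same moments, the odd ones being zero, and both measures
  are compactly supported.\<close>

lemma even_measure: "even_measure \<rho>"
proof -
  have "distr \<rho> borel uminus = \<rho>"
  proof (rule compact_moments_unique[where C = R])
    show "real_distribution (distr \<rho> borel uminus)" by (rule real_distribution_distr) simp
    show "AE x in distr \<rho> borel uminus. \<bar>x\<bar> \<le> R"
      using supp by (subst AE_distr_iff) auto
    show "real_distribution \<rho>" by unfold_locales
    show "(\<integral>x. x ^ k \<partial>distr \<rho> borel uminus) = (\<integral>x. x ^ k \<partial>\<rho>)" for k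
    proof (cases "even k")
      case True
      then show ?thesis by (subst integral_distr) auto
    next
      case False
      then show ?thesis using moment_odd[OF False]
        by (subst integral_distr) (auto simp: moment_def)
    qed
  qed (rule supp)
  then have "emeasure \<rho> B = emeasure \<rho> (uminus -` B)" if "B \<in> sets borel" for B
    using that emeasure_distr[of uminus \<rho> borel B] by simp
  moreover have "uminus ` B = uminus -` B" for B :: "real set"
    by (force simp: image_iff)
  ultimately show ?thesis by (simp add: even_measure_def)
qed

theorem admissible:
  assumes "finite_log_hamiltonian a"
  shows "admissible_measure \<rho>"
proof -
  note lim = finite_log_hamiltonian_tendsto[OF pos assms]
  note sub = interval_subset_support[OF lim(1)]
  have ess: "essential_support \<rho> = {-2..2}"
  proof (intro equalityI subsetI)
    fix x assume "x \<in> essential_support \<rho>"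
    then have "x islimpt topological_support \<rho>"
      unfolding essential_support_def by (auto simp: isolated_in_islimpt_iff)
    then have "\<bar>x\<bar> \<le> 2" by (rule support_limit_point_le[OF lim(1)])
    then show "x \<in> {-2..2}" by auto
  next
    fix x :: real assume x: "x \<in> {-2..2}"
    have "x islimpt {-2..2}" using x by (simp add: islimpt_Icc)
    then have "x islimpt topological_support \<rho>" using islimpt_subset sub by blast
    then show "x \<in> essential_support \<rho>"
      using x sub unfolding essential_support_def by (auto simp: isolated_in_islimpt_iff)
  qed
  have "countable (mass_points \<rho>)"
    using countable_support by (simp add: mass_points_def emeasure_eq_measure zero_less_measure_iff)
  then have cnt: "countable (mass_points \<rho> - {-2..2})" by auto
  have acc: "{x. x islimpt (mass_points \<rho> - {-2..2})} \<subseteq> {-2, 2}"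
  proof (rule subsetI, rule ccontr)
    fix x :: real assume "x \<in> {x. x islimpt (mass_points \<rho> - {-2..2})}" and "x \<notin> {-2, 2}"
    then have x: "x islimpt (mass_points \<rho> - {-2..2})" and "x \<noteq> 2" "x \<noteq> -2" by auto
    have "x islimpt topological_support \<rho>"
      by (rule islimpt_subset[OF x]) (use mass_points_subset_support[of \<rho>] in auto)
    then have "\<bar>x\<bar> \<le> 2" by (rule support_limit_point_le[OF lim(1)])
    then have "x \<in> {-2<..<2}" using \<open>x \<noteq> 2\<close> \<open>x \<noteq> -2\<close> by auto
    \<comment> \<open>The open interval is a neighbourhood of \<open>x\<close> that contains none of
      the mass points under consideration.\<close>
    then have "\<exists>y\<in>mass_points \<rho> - {-2..2}. y \<in> {-2<..<2} \<and> y \<noteq> x"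
      using x unfolding islimpt_def by (meson open_greaterThanLessThan)
    then show False by auto
  qed
  have "hankel_det (moment \<rho>) (n + 1) / hankel_det (moment \<rho>) n = (\<Prod>j\<le>n. a j)" for n
    unfolding mom by (rule hankel_ratio_jacobi_moment[OF pos])
  then have "\<exists>c>0. (\<lambda>n. hankel_det (moment \<rho>) (n + 1) / hankel_det (moment \<rho>) n) \<longlonglongrightarrow> c"
    using lim(2) by simp
  then show ?thesis
    unfolding admissible_measure_def
    using ess cnt acc even_measure prob_space_axioms by (simp add: bdd_integrable bdd_power bdd_id)
qed

end

section \<open>Evolution of compactly supported measures\<close>

text \<open>Bernstein's argument. Nonnegative derivatives make every \<open>\<sigma> j\<close>
  increasing, so a geometric bound at the right end \<open>b\<close> alone controls the Taylor
  remainder on the whole interval.\<close>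

lemma taylor_absolutely_monotone:
  fixes \<sigma> :: "nat \<Rightarrow> real \<Rightarrow> real"
  assumes b: "0 \<le> b"
    and deriv: "\<And>j s. 0 \<le> s \<Longrightarrow> s \<le> b \<Longrightarrow> (\<sigma> j has_real_derivative \<sigma> (Suc j) s) (at s within {0..b})"
    and nn: "\<And>j s. 0 \<le> s \<Longrightarrow> s \<le> b \<Longrightarrow> 0 \<le> \<sigma> j s"
    and bound: "\<And>j. \<sigma> j b \<le> K * C ^ j"
  shows "(\<lambda>j. \<sigma> j 0 * b ^ j / fact j) sums \<sigma> 0 b"
proof (cases "b = 0")
  case True
  have "(\<lambda>j. \<sigma> j 0 * b ^ j / fact j) = (\<lambda>j. if j = 0 then \<sigma> 0 0 else 0)"
    using True by (auto simp: fun_eq_iff)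
  then show ?thesis using sums_single[of 0 "\<lambda>_. \<sigma> 0 0"] True by (simp cong: if_cong)
next
  case False
  with b have b0: "0 < b" by simp
  have mono: "\<sigma> j s \<le> \<sigma> j b" if s: "0 \<le> s" "s \<le> b" for j s
  proof (cases "s = b")
    case False
    then have sb: "s < b" using s by simp
    have "\<exists>x\<in>{s<..<b}. \<sigma> j b - \<sigma> j s = \<sigma> (Suc j) x * (b - s)"
    proof (rule mvt_simple[OF sb])
      fix x assume x: "s \<le> x" "x \<le> b"
      have "(\<sigma> j has_real_derivative \<sigma> (Suc j) x) (at x within {s..b})"
        by (rule DERIV_subset[OF deriv]) (use x s in auto)
      then show "(\<sigma> j has_derivative (*) (\<sigma> (Suc j) x)) (at x within {s..b})"
        by (simp add: has_field_derivative_def)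
    qed
    then obtain x where "x \<in> {s<..<b}" "\<sigma> j b - \<sigma> j s = \<sigma> (Suc j) x * (b - s)" by blast
    moreover have "0 \<le> \<sigma> (Suc j) x * (b - s)"
      using calculation(1) s by (intro mult_nonneg_nonneg nn) auto
    ultimately show ?thesis by linarith
  qed simp
  \<comment> \<open>The Taylor polynomial with moving base point \<open>s\<close>, evaluated at
    \<open>b\<close>. It is \<open>\<sigma> 0 b\<close> at \<open>s = b\<close> and the desired
    partial sum at \<open>s = 0\<close>, and its derivative in \<open>s\<close> telescopes to a
    single term.\<close>
  define g where "g n s = (\<Sum>j\<le>n. \<sigma> j s * (b - s) ^ j / fact j)" for n s
  have g_deriv: "(g n has_real_derivative \<sigma> (Suc n) s * (b - s) ^ n / fact n) (at s within {0..b})"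
    if s: "0 \<le> s" "s \<le> b" for n s
  proof (induction n)
    case 0
    have "g 0 = \<sigma> 0" by (auto simp: g_def fun_eq_iff)
    then show ?case using deriv[OF s, of 0] by simp
  next
    case (Suc n)
    have "g (Suc n) = (\<lambda>s. g n s + \<sigma> (Suc n) s * (b - s) ^ Suc n / fact (Suc n))"
      by (auto simp: g_def fun_eq_iff)
    moreover have "((\<lambda>s. g n s + \<sigma> (Suc n) s * (b - s) ^ Suc n / fact (Suc n)) has_real_derivative
       \<sigma> (Suc n) s * (b - s) ^ n / fact n +
       (\<sigma> (Suc (Suc n)) s * (b - s) ^ Suc n + (real (Suc n) * (b - s) ^ n * (- 1)) * \<sigma> (Suc n) s) / fact (Suc n))
       (at s within {0..b})"
    proof (intro DERIV_add DERIV_cdivide DERIV_mult Suc deriv s)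
      show "((\<lambda>s. (b - s) ^ Suc n) has_real_derivative real (Suc n) * (b - s) ^ n * (- 1)) (at s within {0..b})"
      proof -
        have "((\<lambda>s. b - s) has_real_derivative - 1) (at s within {0..b})"
          by (auto intro!: derivative_eq_intros)
        from DERIV_power_Suc[OF this, of n] show ?thesis by (simp add: algebra_simps)
      qed
    qed
    moreover have "\<sigma> (Suc n) s * (b - s) ^ n / fact n +
       (\<sigma> (Suc (Suc n)) s * (b - s) ^ Suc n + (real (Suc n) * (b - s) ^ n * (- 1)) * \<sigma> (Suc n) s) / fact (Suc n)
       = \<sigma> (Suc (Suc n)) s * (b - s) ^ Suc n / fact (Suc n)"
    proof -
      have f: "fact (Suc n) = real (Suc n) * fact n" by simp
      have "u / fact n + (v + (real (Suc n) * w * (- 1)) * z) / fact (Suc n) = v / fact (Suc n)"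
        if "u = z * w" for u v w z :: real
        unfolding f that by (simp add: field_simps del: of_nat_Suc)
      then show ?thesis by blast
    qed
    ultimately show ?case by simp
  qed
  have gb: "g n b = \<sigma> 0 b" for n
  proof -
    have "g n b = (\<Sum>j\<le>n. if j = 0 then \<sigma> 0 b else 0)"
      unfolding g_def by (intro sum.cong) auto
    then show ?thesis by simp
  qed
  have rem: "norm (g n 0 - \<sigma> 0 b) \<le> b * (K * C) * ((C * b) ^ n / fact n)" for n
  proof -
    have "\<exists>x\<in>{0<..<b}. g n b - g n 0 = (\<sigma> (Suc n) x * (b - x) ^ n / fact n) * (b - 0)"
    proof (rule mvt_simple[OF b0])
      fix x assume "0 \<le> x" "x \<le> b"
      then show "(g n has_derivative (*) (\<sigma> (Suc n) x * (b - x) ^ n / fact n)) (at x within {0..b})"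
        using g_deriv by (simp add: has_field_derivative_def)
    qed
    then obtain x where x: "0 < x" "x < b" "g n b - g n 0 = (\<sigma> (Suc n) x * (b - x) ^ n / fact n) * b" by auto
    have nn': "0 \<le> \<sigma> (Suc n) x" using x by (intro nn) auto
    have "\<sigma> (Suc n) x \<le> K * C ^ Suc n" using mono[of x "Suc n"] bound[of "Suc n"] x by linarith
    then have "\<sigma> (Suc n) x * (b - x) ^ n \<le> (K * C ^ Suc n) * b ^ n"
      using x nn' by (intro mult_mono power_mono) auto
    then have "\<sigma> (Suc n) x * (b - x) ^ n / fact n \<le> (K * C ^ Suc n) * b ^ n / fact n"
      by (rule divide_right_mono) simp
    then have "g n b - g n 0 \<le> ((K * C ^ Suc n) * b ^ n / fact n) * b"
      unfolding x(3) using b0 by (intro mult_right_mono) auto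
    also have "\<dots> = b * (K * C) * ((C * b) ^ n / fact n)" by (simp add: power_mult_distrib)
    finally have "g n b - g n 0 \<le> b * (K * C) * ((C * b) ^ n / fact n)" .
    moreover have "0 \<le> g n b - g n 0" unfolding x(3) using x nn' by (intro mult_nonneg_nonneg divide_nonneg_nonneg) auto
    ultimately show ?thesis unfolding gb by simp
  qed
  have "(\<lambda>n. (C * b) ^ n / fact n) \<longlonglongrightarrow> 0"
    using summable_LIMSEQ_zero[OF summable_exp[of "C * b"]] by (simp add: field_simps)
  then have "(\<lambda>n. b * (K * C) * ((C * b) ^ n / fact n)) \<longlonglongrightarrow> b * (K * C) * 0" by (intro tendsto_mult_left)
  then have lim: "(\<lambda>n. b * (K * C) * ((C * b) ^ n / fact n)) \<longlonglongrightarrow> 0" by simp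
  have "(\<lambda>n. g n 0 - \<sigma> 0 b) \<longlonglongrightarrow> 0"
    by (rule Lim_null_comparison[OF _ lim]) (intro always_eventually allI rem)
  then have "(\<lambda>n. g n 0) \<longlonglongrightarrow> \<sigma> 0 b" by (simp add: LIM_zero_iff)
  then show ?thesis unfolding sums_def_le g_def by simp
qed

section \<open>Exponential moments and recovery of compact support\<close>

definition exp_moment :: "real measure \<Rightarrow> nat \<Rightarrow> real \<Rightarrow> real" where
  "exp_moment \<rho> k t = (\<integral>x. x ^ k * exp (x\<^sup>2 * t) \<partial>\<rho>)"

locale compact_distribution = real_distribution \<rho> for \<rho> +
  fixes R :: real
  assumes supp: "AE x in \<rho>. \<bar>x\<bar> \<le> R"
begin

lemma R_nonneg: "0 \<le> R"
proof (rule ccontr)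
  assume "\<not> 0 \<le> R"
  then have "AE x in \<rho>. False" by (intro eventually_mono[OF supp]) (use \<open>\<not> 0 \<le> R\<close> in auto)
  then show False using AE_False by simp
qed

lemma integrable_power: "integrable \<rho> (\<lambda>x. x ^ k)"
proof (rule integrable_const_bound[where B = "R ^ k"])
  show "AE x in \<rho>. norm (x ^ k) \<le> R ^ k"
    using supp by eventually_elim (simp add: power_abs power_mono)
qed simp

lemma exp_bound: "AE x in \<rho>. \<bar>x ^ k * exp (x\<^sup>2 * t)\<bar> \<le> R ^ k * exp (R\<^sup>2 * \<bar>t\<bar>)"
  using supp
proof eventually_elim
  case (elim x)
  have "x\<^sup>2 * t \<le> x\<^sup>2 * \<bar>t\<bar>" by (intro mult_left_mono) auto
  also have "\<dots> \<le> R\<^sup>2 * \<bar>t\<bar>"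
    using elim abs_le_square_iff[of x R] R_nonneg by (intro mult_right_mono) auto
  finally have "x\<^sup>2 * t \<le> R\<^sup>2 * \<bar>t\<bar>" .
  then show ?case
    unfolding abs_mult power_abs using elim by (intro mult_mono power_mono) auto
qed

lemma integrable_exp: "integrable \<rho> (\<lambda>x. x ^ k * exp (x\<^sup>2 * t))"
  by (rule integrable_const_bound[where B = "R ^ k * exp (R\<^sup>2 * \<bar>t\<bar>)"]) (use exp_bound in auto)

lemma exp_moment_sums: "(\<lambda>j. moment \<rho> (k + 2 * j) * t ^ j / fact j) sums exp_moment \<rho> k t"
proof -
  have "(\<lambda>n. \<integral>x. (\<Sum>j<n. x ^ k * ((x\<^sup>2 * t) ^ j / fact j)) \<partial>\<rho>) \<longlonglongrightarrow> (\<integral>x. x ^ k * exp (x\<^sup>2 * t) \<partial>\<rho>)"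
  proof (rule integral_dominated_convergence[where w = "\<lambda>_. R ^ k * exp (R\<^sup>2 * \<bar>t\<bar>)"])
    show "AE x in \<rho>. (\<lambda>n. \<Sum>j<n. x ^ k * ((x\<^sup>2 * t) ^ j / fact j)) \<longlonglongrightarrow> x ^ k * exp (x\<^sup>2 * t)"
    proof (rule AE_I2)
      fix x
      have "(\<lambda>j. (x\<^sup>2 * t) ^ j / fact j) sums exp (x\<^sup>2 * t)"
        using exp_converges[of "x\<^sup>2 * t"] by (simp add: field_simps)
      then show "(\<lambda>n. \<Sum>j<n. x ^ k * ((x\<^sup>2 * t) ^ j / fact j)) \<longlonglongrightarrow> x ^ k * exp (x\<^sup>2 * t)"
        unfolding sums_def[symmetric] by (rule sums_mult)
    qed
    show "AE x in \<rho>. norm (\<Sum>j<n. x ^ k * ((x\<^sup>2 * t) ^ j / fact j)) \<le> R ^ k * exp (R\<^sup>2 * \<bar>t\<bar>)" for n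
      using exp_bound[of k "\<bar>t\<bar>"]
    proof eventually_elim
      case (elim x)
      have "norm (\<Sum>j<n. x ^ k * ((x\<^sup>2 * t) ^ j / fact j)) = \<bar>x\<bar> ^ k * \<bar>\<Sum>j<n. (x\<^sup>2 * t) ^ j / fact j\<bar>"
        by (simp only: sum_distrib_left[symmetric] real_norm_def abs_mult power_abs)
      also have "\<dots> \<le> \<bar>x\<bar> ^ k * (\<Sum>j<n. (x\<^sup>2 * \<bar>t\<bar>) ^ j / fact j)"
      proof (rule mult_left_mono)
        have "\<bar>\<Sum>j<n. (x\<^sup>2 * t) ^ j / fact j\<bar> \<le> (\<Sum>j<n. \<bar>(x\<^sup>2 * t) ^ j / fact j\<bar>)" by (rule sum_abs)
        also have "\<dots> = (\<Sum>j<n. (x\<^sup>2 * \<bar>t\<bar>) ^ j / fact j)"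
          by (simp add: abs_mult power_abs power_mult_distrib)
        finally show "\<bar>\<Sum>j<n. (x\<^sup>2 * t) ^ j / fact j\<bar> \<le> (\<Sum>j<n. (x\<^sup>2 * \<bar>t\<bar>) ^ j / fact j)" .
      qed simp
      also have "(\<Sum>j<n. (x\<^sup>2 * \<bar>t\<bar>) ^ j / fact j) \<le> exp (x\<^sup>2 * \<bar>t\<bar>)"
      proof -
        have s: "(\<lambda>j. (x\<^sup>2 * \<bar>t\<bar>) ^ j / fact j) sums exp (x\<^sup>2 * \<bar>t\<bar>)"
          using exp_converges[of "x\<^sup>2 * \<bar>t\<bar>"] by (simp add: field_simps)
        show ?thesis unfolding sums_unique[OF s]
          by (rule sum_le_suminf[OF sums_summable[OF s]]) auto
      qed
      finally show ?case using elim by (simp add: abs_mult power_abs mult_left_mono)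
    qed
  qed auto
  moreover have "(\<integral>x. (\<Sum>j<n. x ^ k * ((x\<^sup>2 * t) ^ j / fact j)) \<partial>\<rho>) = (\<Sum>j<n. moment \<rho> (k + 2 * j) * t ^ j / fact j)" for n
  proof -
    have "(\<integral>x. (\<Sum>j<n. x ^ k * ((x\<^sup>2 * t) ^ j / fact j)) \<partial>\<rho>) = (\<integral>x. (\<Sum>j<n. (t ^ j / fact j) * x ^ (k + 2 * j)) \<partial>\<rho>)"
      by (intro Bochner_Integration.integral_cong sum.cong refl)
        (simp add: power_mult_distrib power_add power_mult)
    also have "\<dots> = (\<Sum>j<n. (t ^ j / fact j) * moment \<rho> (k + 2 * j))"
      unfolding moment_def
      by (subst Bochner_Integration.integral_sum) (simp_all add: integrable_power)
    finally show ?thesis by (simp add: mult.commute)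
  qed
  ultimately show ?thesis unfolding sums_def exp_moment_def by simp
qed

text \<open>The exponential moment is an everywhere convergent power series in \<open>t\<close>;
  differentiating termwise shifts the coefficient index by one, which raises the moment index by
  two.\<close>

lemma exp_moment_deriv: "(exp_moment \<rho> k has_real_derivative exp_moment \<rho> (k + 2) t) (at t)"
proof -
  define c where "c j = moment \<rho> (k + 2 * j) / fact j" for j
  have e: "exp_moment \<rho> k = (\<lambda>t. \<Sum>j. c j * t ^ j)"
    using sums_unique[OF exp_moment_sums[of k]] by (auto simp: c_def)
  have "summable (\<lambda>j. c j * y ^ j)" for y
    using sums_summable[OF exp_moment_sums[of k y]] by (simp add: c_def)
  from termdiffs_strong_converges_everywhere[of c, OF this]
  have "(exp_moment \<rho> k has_real_derivative (\<Sum>j. diffs c j * t ^ j)) (at t)" unfolding e .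
  moreover have "diffs c j = moment \<rho> (k + 2 + 2 * j) / fact j" for j
  proof -
    have "diffs c j = real (Suc j) * (moment \<rho> (k + 2 * Suc j) / (real (Suc j) * fact j))"
      by (simp add: diffs_def c_def)
    also have "\<dots> = moment \<rho> (k + 2 * Suc j) / fact j"
      by (simp del: of_nat_Suc mult_Suc_right)
    finally show ?thesis by (simp add: add.assoc)
  qed
  moreover have "(\<Sum>j. moment \<rho> (k + 2 + 2 * j) / fact j * t ^ j) = exp_moment \<rho> (k + 2) t"
    using sums_unique[OF exp_moment_sums[of "k + 2" t]] by simp
  ultimately show ?thesis by simp
qed

lemma exp_moment_pos: "0 < exp_moment \<rho> 0 t"
proof -
  have "exp (- (R\<^sup>2 * \<bar>t\<bar>)) * 1 = (\<integral>x. exp (- (R\<^sup>2 * \<bar>t\<bar>)) \<partial>\<rho>)" using prob_space by simp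
  also have "\<dots> \<le> (\<integral>x. x ^ 0 * exp (x\<^sup>2 * t) \<partial>\<rho>)"
  proof (rule integral_mono_AE[OF _ integrable_exp])
    show "AE x in \<rho>. exp (- (R\<^sup>2 * \<bar>t\<bar>)) \<le> x ^ 0 * exp (x\<^sup>2 * t)"
      using supp
    proof eventually_elim
      case (elim x)
      have "x\<^sup>2 * \<bar>t\<bar> \<le> R\<^sup>2 * \<bar>t\<bar>"
        using elim abs_le_square_iff[of x R] R_nonneg by (intro mult_right_mono) auto
      moreover have "- (x\<^sup>2 * t) \<le> x\<^sup>2 * \<bar>t\<bar>"
        using mult_left_mono[of "- t" "\<bar>t\<bar>" "x\<^sup>2"] by simp
      ultimately show ?case by simp
    qed
  qed simp
  finally show ?thesis unfolding exp_moment_def by (rule less_le_trans[rotated]) simp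
qed

lemma evolved_measure:
  shows "compact_distribution (evolved_measure \<rho> t) R"
    and "moment (evolved_measure \<rho> t) k = exp_moment \<rho> k t / exp_moment \<rho> 0 t"
proof -
  define Z where "Z = exp_moment \<rho> 0 t"
  have Z: "0 < Z" by (simp add: Z_def exp_moment_pos)
  have ev: "evolved_measure \<rho> t = density \<rho> (\<lambda>x. ennreal (exp (x\<^sup>2 * t) / Z))"
    by (simp add: evolved_measure_def Z_def exp_moment_def)
  have sp: "sets (evolved_measure \<rho> t) = sets borel" "space (evolved_measure \<rho> t) = UNIV"
    by (simp_all add: ev)
  have "emeasure (evolved_measure \<rho> t) UNIV = (\<integral>\<^sup>+x. ennreal (exp (x\<^sup>2 * t) / Z) \<partial>\<rho>)"
    unfolding ev by (subst emeasure_density) auto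
  also have "\<dots> = ennreal (\<integral>x. exp (x\<^sup>2 * t) / Z \<partial>\<rho>)"
    using integrable_exp[of 0 t] Z by (intro nn_integral_eq_integral) auto
  also have "(\<integral>x. exp (x\<^sup>2 * t) / Z \<partial>\<rho>) = 1"
    using Z by (simp add: Z_def exp_moment_def)
  finally have one: "emeasure (evolved_measure \<rho> t) UNIV = 1" by simp
  show "compact_distribution (evolved_measure \<rho> t) R"
  proof (intro compact_distribution.intro compact_distribution_axioms.intro real_distribution.intro
      real_distribution_axioms.intro prob_spaceI)
    show "AE x in evolved_measure \<rho> t. \<bar>x\<bar> \<le> R"
      unfolding ev using supp by (subst AE_density) (auto elim!: eventually_mono)
  qed (simp_all add: sp one)
  have "moment (evolved_measure \<rho> t) k = (\<integral>x. (exp (x\<^sup>2 * t) / Z) * x ^ k \<partial>\<rho>)"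
    unfolding moment_def ev using Z by (subst integral_density) auto
  also have "\<dots> = (\<integral>x. (1 / Z) * (x ^ k * exp (x\<^sup>2 * t)) \<partial>\<rho>)"
    by (rule Bochner_Integration.integral_cong) auto
  also have "\<dots> = exp_moment \<rho> k t / Z" by (simp add: exp_moment_def)
  finally show "moment (evolved_measure \<rho> t) k = exp_moment \<rho> k t / exp_moment \<rho> 0 t" by (simp add: Z_def)
qed

lemma moment_bounds: "0 \<le> moment \<rho> (2 * k)" "moment \<rho> (2 * k) \<le> (R\<^sup>2) ^ k"
proof -
  show "0 \<le> moment \<rho> (2 * k)"
    unfolding moment_def by (rule Bochner_Integration.integral_nonneg) (simp add: power_mult)
  have "moment \<rho> (2 * k) \<le> (\<integral>x. (R\<^sup>2) ^ k \<partial>\<rho>)"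
    unfolding moment_def
  proof (rule integral_mono_AE[OF integrable_power])
    show "AE x in \<rho>. x ^ (2 * k) \<le> (R\<^sup>2) ^ k"
      using supp
    proof eventually_elim
      case (elim x)
      have "x\<^sup>2 \<le> R\<^sup>2" using elim abs_le_square_iff[of x R] R_nonneg by simp
      then show ?case unfolding power_mult by (rule power_mono) simp
    qed
  qed simp
  then show "moment \<rho> (2 * k) \<le> (R\<^sup>2) ^ k" using prob_space by simp
qed

end

lemma compact_distribution_unique:
  assumes "compact_distribution \<rho> R" "compact_distribution \<rho>' R'" "moment \<rho> = moment \<rho>'"
  shows "\<rho> = \<rho>'"
proof -
  interpret A: compact_distribution \<rho> R by fact
  interpret B: compact_distribution \<rho>' R' by fact
  show ?thesis
  proof (rule compact_moments_unique[where C = "max R R'"])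
    show "real_distribution \<rho>" "real_distribution \<rho>'" by unfold_locales
    show "AE x in \<rho>. \<bar>x\<bar> \<le> max R R'" using A.supp by eventually_elim auto
    show "AE x in \<rho>'. \<bar>x\<bar> \<le> max R R'" using B.supp by eventually_elim auto
    show "(\<integral>x. x ^ k \<partial>\<rho>) = (\<integral>x. x ^ k \<partial>\<rho>')" for k
      using fun_cong[OF assms(3), of k] by (simp add: moment_def)
  qed
qed

text \<open>Markov's inequality for \<open>x^(2k)\<close> bounds the mass beyond any
  \<open>r > R\<close> by \<open>(R / r)^(2k)\<close> for every \<open>k\<close>, hence by zero.
  Countably many such \<open>r\<close> exhaust the complement of [-R, R]. Integrability of the
  powers is a hypothesis because nothing bounds the measure beforehand.\<close>

lemma compact_distribution_from_moments:
  assumes rd: "real_distribution \<rho>" and int: "\<And>k. integrable \<rho> (\<lambda>x. x ^ k)"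
    and R: "0 \<le> R" and le: "\<And>k. moment \<rho> (2 * k) \<le> (R\<^sup>2) ^ k"
  shows "compact_distribution \<rho> R"
proof -
  interpret real_distribution \<rho> by fact
  have "AE x in \<rho>. \<bar>x\<bar> < R + inverse (real (Suc j))" for j
  proof -
    define r where "r = R + inverse (real (Suc j))"
    have r: "0 < r" "R < r" using R by (auto simp: r_def add_nonneg_pos)
    have ev: "{x \<in> space \<rho>. r \<le> \<bar>x\<bar>} \<in> sets \<rho>" by measurable
    have "prob {x \<in> space \<rho>. r \<le> \<bar>x\<bar>} \<le> ((R / r)\<^sup>2) ^ k" for k
    proof -
      have "{x \<in> space \<rho>. r \<le> \<bar>x\<bar>} \<subseteq> {x \<in> space \<rho>. r ^ (2 * k) \<le> x ^ (2 * k)}"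
      proof safe
        fix x assume "r \<le> \<bar>x\<bar>"
        then have "r ^ (2 * k) \<le> \<bar>x\<bar> ^ (2 * k)" using r by (intro power_mono) auto
        then show "r ^ (2 * k) \<le> x ^ (2 * k)" by (simp add: power_mult)
      qed
      then have "prob {x \<in> space \<rho>. r \<le> \<bar>x\<bar>} \<le> prob {x \<in> space \<rho>. r ^ (2 * k) \<le> x ^ (2 * k)}"
        by (rule finite_measure_mono) measurable
      also have "\<dots> \<le> moment \<rho> (2 * k) / r ^ (2 * k)"
        unfolding moment_def
        by (rule integral_Markov_inequality_measure[where A = "{}"]) (use int r in auto)
      also have "\<dots> \<le> (R\<^sup>2) ^ k / r ^ (2 * k)" using le r by (intro divide_right_mono) auto
      also have "\<dots> = ((R / r)\<^sup>2) ^ k" by (simp add: power_divide power_mult)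
      finally show ?thesis .
    qed
    moreover have "(\<lambda>k. ((R / r)\<^sup>2) ^ k) \<longlonglongrightarrow> 0"
      using R r by (intro LIMSEQ_power_zero) (auto simp: power_less_one_iff abs_square_less_1)
    ultimately have "prob {x \<in> space \<rho>. r \<le> \<bar>x\<bar>} \<le> 0"
      by (intro LIMSEQ_le_const[where X = "\<lambda>k. ((R / r)\<^sup>2) ^ k"]) auto
    then have "prob {x \<in> space \<rho>. r \<le> \<bar>x\<bar>} = 0" by (simp add: antisym)
    then have "AE x in \<rho>. x \<notin> {x \<in> space \<rho>. r \<le> \<bar>x\<bar>}"
      using ev by (intro AE_not_in) (simp add: null_sets_def emeasure_eq_measure)
    then show ?thesis by eventually_elim (auto simp: r_def)
  qed
  then have "AE x in \<rho>. \<forall>j. \<bar>x\<bar> < R + inverse (real (Suc j))" by (simp add: AE_all_countable)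
  then have "AE x in \<rho>. \<bar>x\<bar> \<le> R"
  proof eventually_elim
    case (elim x)
    show ?case
    proof (rule ccontr)
      assume "\<not> \<bar>x\<bar> \<le> R"
      then obtain j where "inverse (real (Suc j)) < \<bar>x\<bar> - R"
        using reals_Archimedean[of "\<bar>x\<bar> - R"] by auto
      then show False using elim[rule_format, of j] by linarith
    qed
  qed
  then show ?thesis by unfold_locales
qed

section \<open>The correspondence\<close>

lemma jacobi_measure_compact: "jacobi_measure \<rho> a R \<Longrightarrow> compact_distribution \<rho> R"
  unfolding jacobi_measure_def compact_distribution_def jacobi_measure_axioms_def
    compact_distribution_axioms_def by blast

lemma compact_jacobi_measure:
  "compact_distribution \<rho> R \<Longrightarrow> (\<And>n. 0 < a n) \<Longrightarrow> moment \<rho> = jacobi_moment a 0 \<Longrightarrow> jacobi_measure \<rho> a R"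
  unfolding jacobi_measure_def compact_distribution_def jacobi_measure_axioms_def
    compact_distribution_axioms_def by blast

lemma spectral_measure_lax:
  assumes \<rho>: "jacobi_measure \<rho> a R" and bdd: "bdd_above (range a)"
  shows "has_spectral_measure (lax_operator a) (ell2_unit 0) \<rho>"
    "spectral_measure (lax_operator a) (ell2_unit 0) = \<rho>"
proof -
  obtain M where M: "\<And>n. a n \<le> M" using bdd by (auto simp: bdd_above_def)
  show sp: "has_spectral_measure (lax_operator a) (ell2_unit 0) \<rho>"
    by (rule jacobi_measure.has_spectral_measure_lax[OF \<rho> M])
  show "spectral_measure (lax_operator a) (ell2_unit 0) = \<rho>"
    unfolding spectral_measure_def
    by (rule the_equality) (rule sp, rule has_spectral_measure_unique[OF _ sp ell2_unit])
qed

lemma jacobi_measure_exists: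
  assumes pos: "\<And>n. 0 < a n" and bdd: "bdd_above (range a)"
  obtains \<rho> R where "jacobi_measure \<rho> a R"
proof -
  obtain M where M: "\<And>n. a n \<le> M" using bdd by (auto simp: bdd_above_def)
  obtain \<rho> where \<rho>: "real_distribution \<rho>" "AE x in \<rho>. \<bar>x\<bar> \<le> 2 * sqrt M" "moment \<rho> = jacobi_moment a 0"
    by (rule favard[OF pos M])
  have "compact_distribution \<rho> (2 * sqrt M)"
    by (intro compact_distribution.intro compact_distribution_axioms.intro \<rho>)
  from compact_jacobi_measure[OF this pos \<rho>(3)] show thesis by (rule that)
qed

text \<open>The unnormalized moments \<open>exp (\<integral>\<^sub>0\<^sup>t a\<^sub>0) s\<^bsub>2k\<^esub>\<close> of a Volterra solution form an absolutely
  monotone family, so that no bound on \<open>sup\<^sub>n a\<^sub>n\<close> uniform in time is needed.\<close>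

lemma volterra_moments_evolve:
  assumes pos: "\<And>s n. 0 \<le> s \<Longrightarrow> s \<le> t \<Longrightarrow> 0 < a s n"
    and bdd: "\<And>s. 0 \<le> s \<Longrightarrow> s \<le> t \<Longrightarrow> bdd_above (range (a s))"
    and sol: "\<And>s n. 0 \<le> s \<Longrightarrow> s \<le> t \<Longrightarrow>
        ((\<lambda>s. a s n) has_real_derivative volterra_rhs (a s) n) (at s within {0..t})"
    and t: "0 \<le> t" and \<rho>: "jacobi_measure \<rho> (a 0) R"
  shows "jacobi_moment (a t) 0 k = exp_moment \<rho> k t / exp_moment \<rho> 0 t"
proof -
  interpret compact_distribution \<rho> R by (rule jacobi_measure_compact[OF \<rho>])
  have mom: "moment \<rho> = jacobi_moment (a 0) 0" by (rule jacobi_measure.mom[OF \<rho>])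
  \<comment> \<open>The moment equation contains the term \<open>- a_0 s_k\<close>, as the second
    moment is \<open>a_0\<close>. The factor \<open>exp (G s)\<close> removes it and leaves the
    linear system \<open>\<sigma> k' = \<sigma> (k + 2)\<close>.\<close>
  define G where "G s = integral {0..s} (\<lambda>s. a s 0)" for s
  have "continuous_on {0..t} (\<lambda>s. a s 0)"
    by (rule DERIV_continuous_on) (use sol in auto)
  then have G: "(G has_real_derivative a s 0) (at s within {0..t})" if "0 \<le> s" "s \<le> t" for s
    unfolding G_def[abs_def] using that by (intro integral_has_real_derivative) auto
  have G0: "G 0 = 0" by (simp add: G_def)
  define \<sigma> where "\<sigma> k s = jacobi_moment (a s) 0 k * exp (G s)" for k s
  have \<sigma>_deriv: "(\<sigma> k has_real_derivative \<sigma> (k + 2) s) (at s within {0..t})" if s: "0 \<le> s" "s \<le> t" for k s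
  proof -
    have jm: "((\<lambda>s. jacobi_moment (a s) 0 k) has_real_derivative
        jacobi_moment (a s) 0 (k + 2) - a s 0 * jacobi_moment (a s) 0 k) (at s within {0..t})"
      using jacobi_moment_volterra_deriv[of a s "{0..t}" 0 k, OF sol[OF s]] by simp
    have ex: "((\<lambda>s. exp (G s)) has_real_derivative exp (G s) * a s 0) (at s within {0..t})"
      by (rule DERIV_chain2[OF DERIV_exp G[OF s]])
    have "(\<sigma> k has_real_derivative (jacobi_moment (a s) 0 (k + 2) - a s 0 * jacobi_moment (a s) 0 k) * exp (G s)
        + (exp (G s) * a s 0) * jacobi_moment (a s) 0 k) (at s within {0..t})"
      unfolding \<sigma>_def[abs_def] by (rule DERIV_mult[OF jm ex])
    also have "(jacobi_moment (a s) 0 (k + 2) - a s 0 * jacobi_moment (a s) 0 k) * exp (G s)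
        + (exp (G s) * a s 0) * jacobi_moment (a s) 0 k = \<sigma> (k + 2) s"
    proof -
      have "(u - v * w) * e + (e * v) * w = u * e" for u v w e :: real by (simp add: algebra_simps)
      then show ?thesis unfolding \<sigma>_def .
    qed
    finally show ?thesis .
  qed
  \<comment> \<open>At each time separately the coefficients are bounded, so a representing measure
    exists and its even moments are nonnegative and grow geometrically. The rate may depend on
    \<open>s\<close>; only the one at the final time is used.\<close>
  have moments: "\<exists>C. \<forall>k. 0 \<le> jacobi_moment (a s) 0 (2 * k) \<and> jacobi_moment (a s) 0 (2 * k) \<le> C ^ k"
    if s: "0 \<le> s" "s \<le> t" for s
  proof -
    obtain \<nu> Q where \<nu>: "jacobi_measure \<nu> (a s) Q"
      using jacobi_measure_exists[OF pos[OF s] bdd[OF s]] by blast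
    show ?thesis
      using compact_distribution.moment_bounds[OF jacobi_measure_compact[OF \<nu>]]
      unfolding jacobi_measure.mom[OF \<nu>] by blast
  qed
  obtain C where C: "\<And>k. jacobi_moment (a t) 0 (2 * k) \<le> C ^ k"
    using moments[OF t order_refl] by blast
  have \<sigma>_eq: "\<sigma> (2 * k) t = exp_moment \<rho> (2 * k) t" for k
  proof -
    have "(\<lambda>j. \<sigma> (2 * k + 2 * j) 0 * t ^ j / fact j) sums \<sigma> (2 * k + 2 * 0) t"
    proof (rule taylor_absolutely_monotone[OF t])
      fix j s assume s: "0 \<le> s" "s \<le> t"
      show "(\<sigma> (2 * k + 2 * j) has_real_derivative \<sigma> (2 * k + 2 * Suc j) s) (at s within {0..t})"
        using \<sigma>_deriv[OF s, of "2 * k + 2 * j"] by simp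
      have "0 \<le> jacobi_moment (a s) 0 (2 * (k + j))" using moments[OF s] by blast
      then show "0 \<le> \<sigma> (2 * k + 2 * j) s" by (simp add: \<sigma>_def distrib_left)
    next
      fix j
      have "\<sigma> (2 * k + 2 * j) t \<le> C ^ (k + j) * exp (G t)"
        unfolding \<sigma>_def using C[of "k + j"] by (intro mult_right_mono) (auto simp: distrib_left)
      then show "\<sigma> (2 * k + 2 * j) t \<le> (C ^ k * exp (G t)) * C ^ j" by (simp add: power_add mult_ac)
    qed
    moreover have "\<sigma> (2 * k + 2 * j) 0 = moment \<rho> (2 * k + 2 * j)" for j
      by (simp add: \<sigma>_def G0 mom)
    ultimately show ?thesis using sums_unique2[OF _ exp_moment_sums[of "2 * k" t]] by simp
  qed
  \<comment> \<open>The zeroth moment of a lattice is 1, so the case \<open>k = 0\<close> identifies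
    the scale factor with the normalizing integral.\<close>
  have e0: "exp (G t) = exp_moment \<rho> 0 t" using \<sigma>_eq[of 0] by (simp add: \<sigma>_def)
  show ?thesis
  proof (cases "even k")
    case True
    then obtain j where k: "k = 2 * j" by blast
    show ?thesis using \<sigma>_eq[of j] exp_moment_pos[of t] unfolding k \<sigma>_def e0 by (simp add: field_simps)
  next
    case False
    have "moment \<rho> (k + 2 * j) = 0" for j using False by (simp add: mom jacobi_moment_odd)
    then have "exp_moment \<rho> k t = 0" using sums_unique[OF exp_moment_sums[of k t]] by simp
    then show ?thesis using False by (simp add: jacobi_moment_odd)
  qed
qed

text \<open>The three-term recurrence with diagonal coefficients set to zero in advance, as suits an
  even measure; the quotients of squared norms become the lattice coefficients. Orthogonality is not
  built in and is proved from evenness below.\<close>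

fun monic_orthogonal :: "real measure \<Rightarrow> nat \<Rightarrow> real poly" where
  "monic_orthogonal \<rho> 0 = 1"
| "monic_orthogonal \<rho> (Suc 0) = [:0, 1:]"
| "monic_orthogonal \<rho> (Suc (Suc n)) = pCons 0 (monic_orthogonal \<rho> (Suc n))
     - Polynomial.smult ((\<integral>x. (poly (monic_orthogonal \<rho> (Suc n)) x)\<^sup>2 \<partial>\<rho>)
          / (\<integral>x. (poly (monic_orthogonal \<rho> n) x)\<^sup>2 \<partial>\<rho>)) (monic_orthogonal \<rho> n)"

lemma monic_orthogonal_coeff:
  "(\<forall>m>n. coeff (monic_orthogonal \<rho> n) m = 0) \<and> coeff (monic_orthogonal \<rho> n) n = 1"
proof (induction n rule: less_induct)
  case (less n)
  consider "n = 0" | "n = Suc 0" | k where "n = Suc (Suc k)" by (metis nat.exhaust)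
  then show ?case
  proof cases
    case 2
    have "coeff [:0, 1 :: real:] m = (if m = Suc 0 then 1 else 0)" for m
      by (auto simp: coeff_pCons split: nat.splits)
    then show ?thesis by (simp add: 2)
  next
    case (3 k)
    have "(\<forall>m>k. coeff (monic_orthogonal \<rho> k) m = 0)"
      "(\<forall>m>Suc k. coeff (monic_orthogonal \<rho> (Suc k)) m = 0) \<and> coeff (monic_orthogonal \<rho> (Suc k)) (Suc k) = 1"
      using less 3 by auto
    then show ?thesis by (auto simp: 3 coeff_pCons split: nat.splits)
  next
    case 1
    then show ?thesis by auto
  qed
qed

lemma monic_orthogonal_nonzero: "monic_orthogonal \<rho> n \<noteq> 0"
  using monic_orthogonal_coeff[of n \<rho>] by auto

lemma monic_orthogonal_uminus:
  "poly (monic_orthogonal \<rho> n) (- x) = (- 1) ^ n * poly (monic_orthogonal \<rho> n) x"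
proof (induction n rule: less_induct)
  case (less n)
  consider "n = 0" | "n = Suc 0" | k where "n = Suc (Suc k)" by (metis nat.exhaust)
  then show ?case
  proof cases
    case (3 k)
    then show ?thesis using less[of k] less[of "Suc k"] by (simp add: algebra_simps)
  qed auto
qed

locale even_moment_measure = real_distribution \<rho> for \<rho> +
  assumes int_power: "integrable \<rho> (\<lambda>x. x ^ k)" and even: "even_measure \<rho>"
    and infinite: "infinite (topological_support \<rho>)"
begin

abbreviation P where "P \<equiv> monic_orthogonal \<rho>"

lemma int_poly: "integrable \<rho> (poly p)"
  unfolding poly_altdef[abs_def] by (intro Bochner_Integration.integrable_sum integrable_mult_right int_power)

lemma int_poly_mult [simp]: "integrable \<rho> (\<lambda>x. poly p x * poly q x)"
proof -
  have "poly (p * q) = (\<lambda>x. poly p x * poly q x)" by (rule ext) simp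
  then show ?thesis using int_poly[of "p * q"] by simp
qed

lemma reflect: "(\<integral>x. f (- x) \<partial>\<rho>) = (\<integral>x. f x \<partial>\<rho>)" if [measurable]: "f \<in> borel_measurable borel" for f :: "real \<Rightarrow> real"
proof -
  have "distr \<rho> borel uminus = \<rho>"
  proof (rule measure_eqI)
    fix B assume "B \<in> sets (distr \<rho> borel uminus)"
    then have B: "B \<in> sets borel" by simp
    have "uminus -` B = uminus ` B" by (force simp: image_iff)
    then show "emeasure (distr \<rho> borel uminus) B = emeasure \<rho> B"
      using even B by (simp add: even_measure_def emeasure_distr)
  qed simp
  then have "(\<integral>x. f x \<partial>\<rho>) = (\<integral>x. f x \<partial>distr \<rho> borel uminus)" by simp
  also have "\<dots> = (\<integral>x. f (- x) \<partial>\<rho>)" by (rule integral_distr) auto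
  finally show ?thesis ..
qed

lemma poly_measurable [measurable]: "poly p \<in> borel_measurable (borel :: real measure)"
  by (intro borel_measurable_continuous_onI continuous_intros)

text \<open>If the integral vanished, the complement of the finite zero set would be an open null
  set and the support would be finite.\<close>

lemma integral_sq_pos: "0 < (\<integral>x. (poly p x)\<^sup>2 \<partial>\<rho>)" if "p \<noteq> 0"
proof (rule ccontr)
  assume "\<not> 0 < (\<integral>x. (poly p x)\<^sup>2 \<partial>\<rho>)"
  moreover have "0 \<le> (\<integral>x. (poly p x)\<^sup>2 \<partial>\<rho>)" by (rule Bochner_Integration.integral_nonneg) simp
  ultimately have "(\<integral>x. (poly p x)\<^sup>2 \<partial>\<rho>) = 0" by simp
  then have AE: "AE x in \<rho>. poly p x = 0"
    by (subst (asm) integral_nonneg_eq_0_iff_AE) (auto simp: power2_eq_square)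
  define Z where "Z = {x. poly p x = 0}"
  have fin: "finite Z" unfolding Z_def by (rule poly_roots_finite[OF that])
  then have op: "open (- Z)" by (simp add: finite_imp_closed open_Compl)
  have "emeasure \<rho> (- Z) = 0"
    by (rule AE_iff_measurable[THEN iffD1, OF _ _ AE]) (use op in \<open>auto simp: Z_def\<close>)
  then have "topological_support \<rho> \<subseteq> Z"
    using op unfolding topological_support_def by (force simp: Z_def)
  then show False using fin infinite finite_subset by blast
qed

definition h where "h n = (\<integral>x. (poly (P n) x)\<^sup>2 \<partial>\<rho>)"

lemma h_pos: "0 < h n"
  unfolding h_def by (rule integral_sq_pos[OF monic_orthogonal_nonzero])

definition a where "a n = h (Suc n) / h n"

lemma a_pos: "0 < a n" by (simp add: a_def h_pos)

lemma P_rec: "x * poly (P n) x = poly (P (Suc n)) x + (if n = 0 then 0 else a (n - 1) * poly (P (n - 1)) x)"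
  by (cases n) (auto simp: a_def h_def)

lemma integral_x_P:
  "(\<integral>x. poly q x * (x * poly (P n) x) \<partial>\<rho>) = (\<integral>x. poly q x * poly (P (Suc n)) x \<partial>\<rho>)
    + (if n = 0 then 0 else a (n - 1) * (\<integral>x. poly q x * poly (P (n - 1)) x \<partial>\<rho>))"
proof -
  have "(\<integral>x. poly q x * (x * poly (P n) x) \<partial>\<rho>) = (\<integral>x. poly q x * poly (P (Suc n)) x
     + (if n = 0 then 0 else a (n - 1)) * (poly q x * poly (P (n - 1)) x) \<partial>\<rho>)"
    unfolding P_rec by (rule Bochner_Integration.integral_cong) (auto simp: algebra_simps)
  also have "\<dots> = (\<integral>x. poly q x * poly (P (Suc n)) x \<partial>\<rho>)
     + (if n = 0 then 0 else a (n - 1)) * (\<integral>x. poly q x * poly (P (n - 1)) x \<partial>\<rho>)"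
    by (subst Bochner_Integration.integral_add) auto
  finally show ?thesis by auto
qed

text \<open>\<open>P n\<close> has the parity of \<open>n\<close>, so the integrand is odd. This is
  what justifies the missing diagonal coefficient in the recurrence.\<close>

lemma integral_x_sq: "(\<integral>x. poly (P n) x * (x * poly (P n) x) \<partial>\<rho>) = 0"
proof -
  have "(\<integral>x. poly (P n) (- x) * (- x * poly (P n) (- x)) \<partial>\<rho>) = (\<integral>x. poly (P n) x * (x * poly (P n) x) \<partial>\<rho>)"
    by (rule reflect) measurable
  moreover have "poly (P n) (- x) * (- x * poly (P n) (- x)) = - (poly (P n) x * (x * poly (P n) x))" for x
  proof -
    have "((- 1 :: real) ^ n) * ((- 1) ^ n) = 1" by (simp add: power_mult_distrib[symmetric])
    then have "((- 1) ^ n * u) * (- x * ((- 1) ^ n * u)) = - (u * (x * u))" for u :: real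
      by (metis (no_types, opaque_lifting) mult.assoc mult.commute mult.left_neutral mult_minus_left)
    then show ?thesis unfolding monic_orthogonal_uminus .
  qed
  ultimately have "(\<integral>x. - (poly (P n) x * (x * poly (P n) x)) \<partial>\<rho>) = (\<integral>x. poly (P n) x * (x * poly (P n) x) \<partial>\<rho>)"
    by (simp only:)
  then show ?thesis unfolding Bochner_Integration.integral_minus by simp
qed

text \<open>Write \<open>n = k + 1\<close> and move the factor \<open>x\<close> from
  \<open>P k\<close> to \<open>P m\<close>. For \<open>m = k\<close> what is left is the odd
  integral; for \<open>m + 1 = k\<close> the two surviving norms cancel by the choice of
  \<open>a\<close>; for smaller \<open>m\<close> every term vanishes by induction.\<close>

lemma orthogonal: "m < n \<Longrightarrow> (\<integral>x. poly (P m) x * poly (P n) x \<partial>\<rho>) = 0"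
proof (induction n arbitrary: m rule: less_induct)
  case (less n)
  then obtain k where k: "n = Suc k" by (cases n) auto
  have xx: "(\<integral>x. poly (P m) x * (x * poly (P k) x) \<partial>\<rho>) = (\<integral>x. poly (P k) x * (x * poly (P m) x) \<partial>\<rho>)"
    by (rule Bochner_Integration.integral_cong) auto
  have IH: "(\<integral>x. poly (P i) x * poly (P j) x \<partial>\<rho>) = 0" if "i \<noteq> j" "i < n" "j < n" for i j
    using less.IH[of i j] less.IH[of j i] that by (cases "i < j") (auto simp: mult.commute)
  have sq: "(\<integral>x. poly (P i) x * poly (P i) x \<partial>\<rho>) = h i" for i by (simp add: h_def power2_eq_square)
  have e: "(\<integral>x. poly (P m) x * poly (P n) x \<partial>\<rho>) = (\<integral>x. poly (P k) x * (x * poly (P m) x) \<partial>\<rho>)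
     - (if k = 0 then 0 else a (k - 1) * (\<integral>x. poly (P m) x * poly (P (k - 1)) x \<partial>\<rho>))"
    using integral_x_P[of "P m" k] xx unfolding k by simp
  show ?case
  proof (cases "m = k")
    case True
    have "(if k = 0 then 0 else a (k - 1) * (\<integral>x. poly (P m) x * poly (P (k - 1)) x \<partial>\<rho>)) = 0"
      using IH[of m "k - 1"] True k by auto
    then show ?thesis unfolding e using integral_x_sq[of k] True by simp
  next
    case False
    then have m: "Suc m \<le> k" using less.prems k by simp
    have "(\<integral>x. poly (P k) x * (x * poly (P m) x) \<partial>\<rho>) = (\<integral>x. poly (P k) x * poly (P (Suc m)) x \<partial>\<rho>)
      + (if m = 0 then 0 else a (m - 1) * (\<integral>x. poly (P k) x * poly (P (m - 1)) x \<partial>\<rho>))"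
      by (rule integral_x_P)
    also have "(if m = 0 then 0 else a (m - 1) * (\<integral>x. poly (P k) x * poly (P (m - 1)) x \<partial>\<rho>)) = 0"
      using IH[of k "m - 1"] m k by auto
    finally have e1: "(\<integral>x. poly (P k) x * (x * poly (P m) x) \<partial>\<rho>) = (\<integral>x. poly (P k) x * poly (P (Suc m)) x \<partial>\<rho>)" by simp
    show ?thesis
    proof (cases "Suc m = k")
      case True
      then show ?thesis unfolding e e1 using sq[of m] sq[of k] h_pos[of m] by (auto simp: a_def)
    next
      case False
      then show ?thesis unfolding e e1 using IH[of k "Suc m"] IH[of m "k - 1"] m k by auto
    qed
  qed
qed

text \<open>One power of \<open>x\<close> is given to \<open>P n\<close> by the recurrence, which
  reproduces the defining recursion of \<open>jacobi_moment\<close>.\<close>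

lemma moment_P: "(\<integral>x. x ^ k * poly (P n) x \<partial>\<rho>) = jacobi_moment a n k"
proof (induction k arbitrary: n)
  case 0
  show ?case
  proof (cases "n = 0")
    case True
    then show ?thesis using prob_space by simp
  next
    case False
    then show ?thesis using orthogonal[of 0 n] by simp
  qed
next
  case (Suc k)
  have pw: "poly (Polynomial.monom 1 k) x = x ^ k" for x :: real by (simp add: poly_monom)
  have "(\<integral>x. x ^ Suc k * poly (P n) x \<partial>\<rho>) = (\<integral>x. poly (Polynomial.monom 1 k) x * (x * poly (P n) x) \<partial>\<rho>)"
    by (simp add: pw mult_ac)
  then show ?case unfolding integral_x_P unfolding pw Suc.IH by simp
qed

lemma moment_eq: "moment \<rho> = jacobi_moment a 0"
  using moment_P[of _ 0] by (simp add: moment_def fun_eq_iff)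

end

theorem admissible_imp_jacobi:
  assumes adm: "admissible_measure \<rho>"
  obtains R where "jacobi_measure \<rho> (lattice_coeff \<rho>) R"
    "finite_log_hamiltonian (lattice_coeff \<rho>)" "bdd_above (range (lattice_coeff \<rho>))"
proof -
  have adm': "sets \<rho> = sets borel" "prob_space \<rho>" "even_measure \<rho>" "essential_support \<rho> = {-2..2}"
    "\<And>k. integrable \<rho> (\<lambda>x. x ^ k)"
    using adm by (auto simp: admissible_measure_def)
  obtain c where c: "c > 0" "(\<lambda>n. hankel_det (moment \<rho>) (n + 1) / hankel_det (moment \<rho>) n) \<longlonglongrightarrow> c"
    using adm by (auto simp: admissible_measure_def)
  have "{-2..2} \<subseteq> topological_support \<rho>" using adm'(4) unfolding essential_support_def by blast
  moreover have "infinite {-2..2 :: real}" by (rule infinite_Icc) simp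
  ultimately have inf: "infinite (topological_support \<rho>)" using finite_subset by blast
  have rd: "real_distribution \<rho>"
    using adm' by (simp add: real_distribution_def real_distribution_axioms_def)
  interpret even_moment_measure \<rho>
    by (intro even_moment_measure.intro even_moment_measure_axioms.intro rd adm' inf)
  have lc: "lattice_coeff \<rho> = a" by (rule lattice_coeff_jacobi_moment[OF a_pos moment_eq])
  have lim: "(\<lambda>n. \<Prod>j\<le>n. a j) \<longlonglongrightarrow> c"
    using c(2) unfolding moment_eq hankel_ratio_jacobi_moment[OF a_pos] .
  have "(\<lambda>n. ln (\<Prod>j\<le>n. a j)) \<longlonglongrightarrow> ln c" by (rule tendsto_ln[OF lim]) (use c in simp)
  moreover have "ln (\<Prod>j\<le>n. a j) = (\<Sum>j\<le>n. ln (a j))" for n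
    by (rule ln_prod) (simp_all add: less_imp_neq[OF a_pos, symmetric])
  ultimately have "(\<lambda>n. \<Sum>j\<le>n. ln (a j)) \<longlonglongrightarrow> ln c" by (simp only:)
  then have "(\<lambda>j. ln (a j)) sums ln c" by (simp add: sums_def_le)
  then have fin: "finite_log_hamiltonian a"
    unfolding finite_log_hamiltonian_def by (intro summable_mult) (auto simp: sums_iff)
  have bd: "bdd_above (range a)"
    using convergent_imp_Bseq[OF convergentI[OF finite_log_hamiltonian_tendsto(1)[OF a_pos fin]]]
    by (auto simp: Bseq_def bdd_above_def abs_le_iff)
  obtain \<nu> R where \<nu>: "jacobi_measure \<nu> a R" using jacobi_measure_exists[OF a_pos bd] by blast
  interpret N: compact_distribution \<nu> R by (rule jacobi_measure_compact[OF \<nu>])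
  \<comment> \<open>Equality of moments does not yet give equality of measures, but it transfers the
    growth rate of the moments from \<open>\<nu>\<close> to \<open>\<rho>\<close>, and with it the
    support bound.\<close>
  have "moment \<rho> = moment \<nu>" using moment_eq jacobi_measure.mom[OF \<nu>] by simp
  then have "compact_distribution \<rho> R"
    using N.moment_bounds(2) N.R_nonneg adm' rd by (intro compact_distribution_from_moments) auto
  then have "jacobi_measure \<rho> a R" by (rule compact_jacobi_measure[OF _ a_pos moment_eq])
  with that fin bd show thesis unfolding lc by blast
qed

text \<open>The evolved measure keeps the support bound valid at time 0, and the spectral measure at
  time \<open>t\<close> has a bound of its own. Agreement of moments then identifies them, by
  determinacy on a common interval.\<close>

lemma volterra_to_spectral:
  assumes T: "0 < T" and a: "a \<in> volterra_solutions T" and t: "t \<in> time_interval T"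
  obtains R where "jacobi_measure (spectral_family_of T a t) (a t) R"
    "has_spectral_measure (lax_operator (a t)) (ell2_unit 0) (spectral_family_of T a t)"
    "spectral_family_of T a t = evolved_measure (spectral_family_of T a 0) t"
proof -
  have sol: "\<And>s n. s \<in> time_interval T \<Longrightarrow> 0 < a s n" "\<And>s. s \<in> time_interval T \<Longrightarrow> bdd_above (range (a s))"
    "\<And>s n. s \<in> time_interval T \<Longrightarrow>
        ((\<lambda>s. a s n) has_real_derivative volterra_rhs (a s) n) (at s within time_interval T)"
    using a by (auto simp: volterra_solutions_def volterra_solution_def)
  have t0: "0 \<le> t" using t by (simp add: time_interval_def)
  have sub: "{0..t} \<subseteq> time_interval T"
    using t by (auto simp: time_interval_def intro: le_less_trans[of "ereal _" "ereal t"])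
  then have in_T: "\<And>s. 0 \<le> s \<Longrightarrow> s \<le> t \<Longrightarrow> s \<in> time_interval T" by auto
  have ex: "\<exists>R. jacobi_measure (spectral_family_of T a s) (a s) R \<and>
      has_spectral_measure (lax_operator (a s)) (ell2_unit 0) (spectral_family_of T a s)"
    if s: "s \<in> time_interval T" for s
  proof -
    obtain \<rho> R where \<rho>: "jacobi_measure \<rho> (a s) R" using jacobi_measure_exists[OF sol(1,2)[OF s]] by blast
    have "spectral_family_of T a s = \<rho>"
      using s by (simp add: spectral_family_of_def spectral_measure_lax(2)[OF \<rho> sol(2)[OF s]])
    then show ?thesis using \<rho> spectral_measure_lax(1)[OF \<rho> sol(2)[OF s]] by auto
  qed
  obtain R where R: "jacobi_measure (spectral_family_of T a t) (a t) R"
    "has_spectral_measure (lax_operator (a t)) (ell2_unit 0) (spectral_family_of T a t)"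
    using ex[OF t] by blast
  obtain R0 where R0: "jacobi_measure (spectral_family_of T a 0) (a 0) R0"
    using ex[OF in_T[OF order_refl t0]] by blast
  interpret \<rho>0: compact_distribution "spectral_family_of T a 0" R0
    by (rule jacobi_measure_compact[OF R0])
  have "moment (spectral_family_of T a t) k = moment (evolved_measure (spectral_family_of T a 0) t) k" for k
    unfolding \<rho>0.evolved_measure(2) jacobi_measure.mom[OF R(1)]
    by (rule volterra_moments_evolve[where a = a, OF _ _ _ t0 R0])
      (use sol in_T in \<open>auto intro: DERIV_subset[OF _ sub]\<close>)
  then have "spectral_family_of T a t = evolved_measure (spectral_family_of T a 0) t"
    by (intro compact_distribution_unique[OF jacobi_measure_compact[OF R(1)] \<rho>0.evolved_measure(1)] ext)
  with R that show thesis by blast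
qed

lemma volterra_to_spectral_families:
  assumes T: "0 < T" and a: "a \<in> volterra_solutions T"
  shows "spectral_family_of T a \<in> spectral_families T" "lattice_of T (spectral_family_of T a) = a"
proof -
  have fin: "\<And>s. s \<in> time_interval T \<Longrightarrow> finite_log_hamiltonian (a s)" and ext: "a \<in> extensional (time_interval T)"
    using a by (auto simp: volterra_solutions_def)
  show "spectral_family_of T a \<in> spectral_families T"
    unfolding spectral_families_def
  proof (intro CollectI conjI ballI)
    show "spectral_family_of T a \<in> extensional (time_interval T)" by (simp add: spectral_family_of_def)
    fix t assume t: "t \<in> time_interval T"
    show "admissible_measure (spectral_family_of T a t)"
      using volterra_to_spectral[OF T a t] jacobi_measure.admissible[OF _ fin[OF t]] by metis
    show "spectral_family_of T a t = evolved_measure (spectral_family_of T a 0) t"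
      using volterra_to_spectral[OF T a t] by metis
  qed
  show "lattice_of T (spectral_family_of T a) = a"
  proof (rule extensionalityI[OF _ ext])
    fix t assume t: "t \<in> time_interval T"
    obtain R where R: "jacobi_measure (spectral_family_of T a t) (a t) R"
      using volterra_to_spectral[OF T a t] by metis
    show "lattice_of T (spectral_family_of T a) t = a t"
      using t lattice_coeff_jacobi_moment[OF jacobi_measure.pos[OF R] jacobi_measure.mom[OF R]]
      by (simp add: lattice_of_def)
  qed (simp add: lattice_of_def)
qed

text \<open>Each \<open>\<rho> t\<close> is the orthogonality measure of its own coefficients, and
  its moments times the normalizing integral are the exponential moments of \<open>\<rho> 0\<close>.
  Differentiation thus takes place in one compactly supported measure, with the normalizing integral
  as the factor \<open>\<tau>\<close> of \<open>volterra_from_moments\<close>.\<close>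

lemma spectral_families_to_volterra:
  assumes T: "0 < T" and \<rho>: "\<rho> \<in> spectral_families T"
  shows "lattice_of T \<rho> \<in> volterra_solutions T" "spectral_family_of T (lattice_of T \<rho>) = \<rho>"
    "t \<in> time_interval T \<Longrightarrow> odd k \<Longrightarrow> moment (\<rho> t) k = 0"
proof -
  define S where "S = time_interval T"
  have ext: "\<rho> \<in> extensional S" and adm: "\<And>t. t \<in> S \<Longrightarrow> admissible_measure (\<rho> t)"
    and ev: "\<And>t. t \<in> S \<Longrightarrow> \<rho> t = evolved_measure (\<rho> 0) t"
    using \<rho> by (auto simp: spectral_families_def S_def)
  have "0 \<in> S" using T by (simp add: S_def time_interval_def zero_ereal_def[symmetric])
  define a where "a t = lattice_coeff (\<rho> t)" for t
  have ex: "\<exists>R. jacobi_measure (\<rho> t) (a t) R \<and> finite_log_hamiltonian (a t) \<and> bdd_above (range (a t))"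
    if "t \<in> S" for t
    unfolding a_def using admissible_imp_jacobi[OF adm[OF that]] by metis
  obtain R0 where R0: "jacobi_measure (\<rho> 0) (a 0) R0" using ex[OF \<open>0 \<in> S\<close>] by blast
  interpret \<rho>0: compact_distribution "\<rho> 0" R0 by (rule jacobi_measure_compact[OF R0])
  have pos: "0 < a t n" if "t \<in> S" for t n using ex[OF that] jacobi_measure.pos by blast
  have mom: "exp_moment (\<rho> 0) 0 t * jacobi_moment (a t) 0 k = exp_moment (\<rho> 0) k t" if t: "t \<in> S" for t k
  proof -
    obtain R where R: "jacobi_measure (\<rho> t) (a t) R" using ex[OF t] by blast
    have "jacobi_moment (a t) 0 k = moment (evolved_measure (\<rho> 0) t) k"
      using jacobi_measure.mom[OF R] ev[OF t] by simp
    then show ?thesis using \<rho>0.exp_moment_pos[of t] by (simp add: \<rho>0.evolved_measure(2))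
  qed
  have sol: "((\<lambda>s. a s n) has_real_derivative volterra_rhs (a t) n) (at t within S)" if t: "t \<in> S" for t n
  proof (rule volterra_from_moments[where \<tau> = "exp_moment (\<rho> 0) 0", OF pos \<rho>0.exp_moment_pos _ t])
    fix s k assume s: "s \<in> S"
    have "(exp_moment (\<rho> 0) k has_real_derivative exp_moment (\<rho> 0) (k + 2) s) (at s within S)"
      using \<rho>0.exp_moment_deriv by (rule has_field_derivative_at_within)
    then show "((\<lambda>s. exp_moment (\<rho> 0) 0 s * jacobi_moment (a s) 0 k) has_real_derivative
        exp_moment (\<rho> 0) 0 s * jacobi_moment (a s) 0 (k + 2)) (at s within S)"
      unfolding mom[OF s]
      by (rule has_field_derivative_transform_within[where d = 1]) (use s mom in auto)
  qed
  have lat: "lattice_of T \<rho> t = a t" if "t \<in> S" for t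
    using that by (simp add: lattice_of_def a_def S_def)
  show "lattice_of T \<rho> \<in> volterra_solutions T"
    unfolding volterra_solutions_def volterra_solution_def S_def[symmetric]
  proof (intro CollectI conjI ballI allI)
    show "lattice_of T \<rho> \<in> extensional S" by (simp add: lattice_of_def S_def)
    fix t assume t: "t \<in> S"
    show "0 < lattice_of T \<rho> t n" for n using pos[OF t] by (simp add: lat[OF t])
    show "bdd_above (range (lattice_of T \<rho> t))" "finite_log_hamiltonian (lattice_of T \<rho> t)"
      using ex[OF t] by (auto simp: lat[OF t])
    show "((\<lambda>s. lattice_of T \<rho> s n) has_real_derivative volterra_rhs (lattice_of T \<rho> t) n) (at t within S)" for n
      unfolding lat[OF t]
      by (rule has_field_derivative_transform_within[OF sol[OF t], where d = 1]) (use t lat in auto)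
  qed
  show "spectral_family_of T (lattice_of T \<rho>) = \<rho>"
  proof (rule extensionalityI[OF _ ext])
    show "spectral_family_of T (lattice_of T \<rho>) \<in> extensional S" by (simp add: spectral_family_of_def S_def)
    fix t assume t: "t \<in> S"
    obtain R where R: "jacobi_measure (\<rho> t) (a t) R" "bdd_above (range (a t))" using ex[OF t] by blast
    have "spectral_family_of T (lattice_of T \<rho>) t = spectral_measure (lax_operator (a t)) (ell2_unit 0)"
      using t lat[OF t] by (simp add: spectral_family_of_def S_def)
    then show "spectral_family_of T (lattice_of T \<rho>) t = \<rho> t"
      by (simp add: spectral_measure_lax(2)[OF R])
  qed
  show "moment (\<rho> t) k = 0" if t: "t \<in> time_interval T" and k: "odd k"
  proof -
    obtain R where "jacobi_measure (\<rho> t) (a t) R" using ex[of t] t unfolding S_def by blast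
    then show ?thesis using k by (rule jacobi_measure.moment_odd)
  qed
qed

theorem theorem2:
  fixes T :: ereal
  assumes "0 < T"
  shows "bij_betw (spectral_family_of T) (volterra_solutions T) (spectral_families T) \<and>
    (\<forall>a\<in>volterra_solutions T.
       spectral_family_of T a \<in> spectral_families T \<and>
       (\<forall>t\<in>time_interval T.
          has_spectral_measure (lax_operator (a t)) (ell2_unit 0) (spectral_family_of T a t)) \<and>
       lattice_of T (spectral_family_of T a) = a) \<and>
    (\<forall>\<rho>\<in>spectral_families T.
       lattice_of T \<rho> \<in> volterra_solutions T \<and>
       spectral_family_of T (lattice_of T \<rho>) = \<rho> \<and>
       (\<forall>t\<in>time_interval T. \<forall>k. odd k \<longrightarrow> moment (\<rho> t) k = 0))"
proof -
  note V = volterra_to_spectral_families[OF assms] and S = spectral_families_to_volterra[OF assms]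
  have sp: "has_spectral_measure (lax_operator (a t)) (ell2_unit 0) (spectral_family_of T a t)"
    if "a \<in> volterra_solutions T" "t \<in> time_interval T" for a t
    using volterra_to_spectral[OF assms that] by metis
  have "bij_betw (spectral_family_of T) (volterra_solutions T) (spectral_families T)"
    by (rule bij_betw_byWitness[where f' = "lattice_of T"]) (use V S in auto)
  with V S sp show ?thesis by blast
qed

end
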